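(* Let $R$ be a commutative Noetherian local ring, let $M$ be a non-zero finitely generated $R$-module, let $\mathfrak{p}\in\operatorname{Supp}_R(M)$, and suppose that $M$ is $\mathfrak{p}$-Cohen Macaulay. Then the following statements hold: (1) $M_\mathfrak{p}$ is Cohen Macaulay over $R_\mathfrak{p}$. (2) Every maximal $M$-regular sequence in $\mathfrak{p}$ is a system of parameters of $M_\mathfrak{p}$; that is, if $x_1,\dots,x_n\in\mathfrak{p}$ is a maximal $M$-regular sequence in $\mathfrak{p}$, then $\frac{x_1}{1},\dots,\frac{x_n}{1}\in\mathfrak{p}R_\mathfrak{p}$ is a system of parameters of $M_\mathfrak{p}$. (3) For every $\mathfrak{q}\in\operatorname{Supp}_R(M)$ with $\mathfrak{q}\subseteq\mathfrak{p}$, $M_\mathfrak{q}$ is Cohen Macaulay over $R_\mathfrak{q}$.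
   Context: For a proper ideal $I$ of a commutative Noetherian ring $R$, a finitely generated $R$-module $M$ is called $I$-Cohen Macaulay if $\operatorname{grade}(I,M)+\dim_R(M/IM)=\dim_R(M)$, where $\operatorname{grade}(I,M)$ is the length of a maximal $M$-regular sequence contained in $I$ and $\dim$ denotes Krull dimension. *)

theory Defs
  imports "HOL-Algebra.Ring_Divisibility" "HOL-Algebra.Module" "HOL-Library.Extended_Real"
begin

section \<open>Modules\<close>

definition module_span :: "('a, 'r) ring_scheme \<Rightarrow> ('a, 'b, 'm) module_scheme \<Rightarrow> 'b set \<Rightarrow> 'b set"
  where "module_span R M G = \<Inter>{N. submodule N R M \<and> G \<subseteq> N}"

definition finitely_generated :: "('a, 'r) ring_scheme \<Rightarrow> ('a, 'b, 'm) module_scheme \<Rightarrow> bool"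
  where "finitely_generated R M \<longleftrightarrow>
    (\<exists>G. finite G \<and> G \<subseteq> carrier M \<and> module_span R M G = carrier M)"

definition zero_module :: "('a, 'b, 'm) module_scheme \<Rightarrow> bool"
  where "zero_module M \<longleftrightarrow> carrier M = {\<zero>\<^bsub>M\<^esub>}"

text \<open>The record of modules extends that of rings; the fields \<^const>\<open>mult\<close> and \<^const>\<open>one\<close> play no
  role for a module and are left unspecified in the constructions below.\<close>

definition FactModule :: "('a, 'b, 'm) module_scheme \<Rightarrow> 'b set \<Rightarrow> ('a, 'b set) module"
  where "FactModule M N =
    \<lparr>carrier = a_rcosets\<^bsub>M\<^esub> N, mult = undefined, one = undefined,
     zero = N, add = set_add M,
     smult = (\<lambda>a C. \<Union>x\<in>C. N +>\<^bsub>M\<^esub> (a \<odot>\<^bsub>M\<^esub> x))\<rparr>"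

definition ideal_smult :: "('a, 'r) ring_scheme \<Rightarrow> 'a set \<Rightarrow> ('a, 'b, 'm) module_scheme \<Rightarrow> 'b set"
  where "ideal_smult R I M = module_span R M {a \<odot>\<^bsub>M\<^esub> x | a x. a \<in> I \<and> x \<in> carrier M}"

definition ideal_quotient ::
  "('a, 'r) ring_scheme \<Rightarrow> 'a set \<Rightarrow> ('a, 'b, 'm) module_scheme \<Rightarrow> ('a, 'b set) module"
  where "ideal_quotient R I M = FactModule M (ideal_smult R I M)"

definition annihilator :: "('a, 'r) ring_scheme \<Rightarrow> ('a, 'b, 'm) module_scheme \<Rightarrow> 'a set"
  where "annihilator R M = {a \<in> carrier R. \<forall>x\<in>carrier M. a \<odot>\<^bsub>M\<^esub> x = \<zero>\<^bsub>M\<^esub>}"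

definition module_length :: "('a, 'r) ring_scheme \<Rightarrow> ('a, 'b, 'm) module_scheme \<Rightarrow> enat"
  where "module_length R M =
    (SUP Ns \<in> {Ns. Ns \<noteq> [] \<and> sorted_wrt (\<subset>) Ns \<and> (\<forall>N\<in>set Ns. submodule N R M)}.
      enat (length Ns - 1))"


section \<open>Krull dimension\<close>

text \<open>A chain of primes given by a list \<open>Ps\<close> has length \<open>length Ps - 1\<close>.
  The supremum is taken in \<^typ>\<open>ereal\<close>, so that the zero ring has dimension \<open>-\<infinity>\<close>.\<close>

definition krull_dim :: "('a, 'r) ring_scheme \<Rightarrow> ereal"
  where "krull_dim R =
    (SUP Ps \<in> {Ps. Ps \<noteq> [] \<and> sorted_wrt (\<subset>) Ps \<and> (\<forall>P\<in>set Ps. primeideal P R)}.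
      ereal (real (length Ps - 1)))"

definition module_dim :: "('a, 'r) ring_scheme \<Rightarrow> ('a, 'b, 'm) module_scheme \<Rightarrow> ereal"
  where "module_dim R M = krull_dim (R Quot annihilator R M)"


section \<open>Localization\<close>

text \<open>The fraction \<open>a/s\<close> is the class of all \<open>(b, t)\<close> with \<open>u(ta - sb) = 0\<close> for some \<open>u\<close> in the
  multiplicative set \<open>S\<close>.  As in \<^const>\<open>rcoset_mult\<close>, an operation on classes is the union
  of the results over all representatives.\<close>

definition ring_fraction :: "('a, 'r) ring_scheme \<Rightarrow> 'a set \<Rightarrow> 'a \<Rightarrow> 'a \<Rightarrow> ('a \<times> 'a) set"
  where "ring_fraction R S a s =
    {(b, t). b \<in> carrier R \<and> t \<in> S \<and>
      (\<exists>u\<in>S. u \<otimes>\<^bsub>R\<^esub> (t \<otimes>\<^bsub>R\<^esub> a) = u \<otimes>\<^bsub>R\<^esub> (s \<otimes>\<^bsub>R\<^esub> b))}"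

definition ring_localization :: "('a, 'r) ring_scheme \<Rightarrow> 'a set \<Rightarrow> ('a \<times> 'a) set ring"
  where "ring_localization R S =
    \<lparr>carrier = {ring_fraction R S a s | a s. a \<in> carrier R \<and> s \<in> S},
     mult = (\<lambda>A B. \<Union>(a, s)\<in>A. \<Union>(b, t)\<in>B. ring_fraction R S (a \<otimes>\<^bsub>R\<^esub> b) (s \<otimes>\<^bsub>R\<^esub> t)),
     one = ring_fraction R S \<one>\<^bsub>R\<^esub> \<one>\<^bsub>R\<^esub>,
     zero = ring_fraction R S \<zero>\<^bsub>R\<^esub> \<one>\<^bsub>R\<^esub>,
     add = (\<lambda>A B. \<Union>(a, s)\<in>A. \<Union>(b, t)\<in>B.
       ring_fraction R S ((t \<otimes>\<^bsub>R\<^esub> a) \<oplus>\<^bsub>R\<^esub> (s \<otimes>\<^bsub>R\<^esub> b)) (s \<otimes>\<^bsub>R\<^esub> t))\<rparr>"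

definition module_fraction :: "('a, 'b, 'm) module_scheme \<Rightarrow> 'a set \<Rightarrow> 'b \<Rightarrow> 'a \<Rightarrow> ('b \<times> 'a) set"
  where "module_fraction M S x s =
    {(y, t). y \<in> carrier M \<and> t \<in> S \<and>
      (\<exists>u\<in>S. u \<odot>\<^bsub>M\<^esub> (t \<odot>\<^bsub>M\<^esub> x) = u \<odot>\<^bsub>M\<^esub> (s \<odot>\<^bsub>M\<^esub> y))}"

definition module_localization ::
  "('a, 'r) ring_scheme \<Rightarrow> 'a set \<Rightarrow> ('a, 'b, 'm) module_scheme \<Rightarrow>
    (('a \<times> 'a) set, ('b \<times> 'a) set) module"
  where "module_localization R S M =
    \<lparr>carrier = {module_fraction M S x s | x s. x \<in> carrier M \<and> s \<in> S},
     mult = undefined, one = undefined,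
     zero = module_fraction M S \<zero>\<^bsub>M\<^esub> \<one>\<^bsub>R\<^esub>,
     add = (\<lambda>U V. \<Union>(x, s)\<in>U. \<Union>(y, t)\<in>V.
       module_fraction M S ((t \<odot>\<^bsub>M\<^esub> x) \<oplus>\<^bsub>M\<^esub> (s \<odot>\<^bsub>M\<^esub> y)) (s \<otimes>\<^bsub>R\<^esub> t)),
     smult = (\<lambda>A U. \<Union>(a, s)\<in>A. \<Union>(x, t)\<in>U.
       module_fraction M S (a \<odot>\<^bsub>M\<^esub> x) (s \<otimes>\<^bsub>R\<^esub> t))\<rparr>"

definition ring_localization_at :: "('a, 'r) ring_scheme \<Rightarrow> 'a set \<Rightarrow> ('a \<times> 'a) set ring"
  where "ring_localization_at R P = ring_localization R (carrier R - P)"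

definition module_localization_at ::
  "('a, 'r) ring_scheme \<Rightarrow> 'a set \<Rightarrow> ('a, 'b, 'm) module_scheme \<Rightarrow>
    (('a \<times> 'a) set, ('b \<times> 'a) set) module"
  where "module_localization_at R P M = module_localization R (carrier R - P) M"

definition localization_map :: "('a, 'r) ring_scheme \<Rightarrow> 'a set \<Rightarrow> 'a \<Rightarrow> ('a \<times> 'a) set"
  where "localization_map R P a = ring_fraction R (carrier R - P) a \<one>\<^bsub>R\<^esub>"

definition Supp :: "('a, 'r) ring_scheme \<Rightarrow> ('a, 'b, 'm) module_scheme \<Rightarrow> 'a set set"
  where "Supp R M = {P. primeideal P R \<and> \<not> zero_module (module_localization_at R P M)}"


section \<open>Regular sequences and grade\<close>

definition nonzerodivisor_on :: "('a, 'b, 'm) module_scheme \<Rightarrow> 'a \<Rightarrow> bool"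
  where "nonzerodivisor_on M a \<longleftrightarrow> (\<forall>x\<in>carrier M. a \<odot>\<^bsub>M\<^esub> x = \<zero>\<^bsub>M\<^esub> \<longrightarrow> x = \<zero>\<^bsub>M\<^esub>)"

definition regular_sequence :: "('a, 'r) ring_scheme \<Rightarrow> ('a, 'b, 'm) module_scheme \<Rightarrow> 'a list \<Rightarrow> bool"
  where "regular_sequence R M xs \<longleftrightarrow>
    set xs \<subseteq> carrier R \<and>
    (\<forall>i<length xs. nonzerodivisor_on (ideal_quotient R (Idl\<^bsub>R\<^esub> (set (take i xs))) M) (xs ! i)) \<and>
    \<not> zero_module (ideal_quotient R (Idl\<^bsub>R\<^esub> (set xs)) M)"

definition maximal_regular_sequence ::
  "('a, 'r) ring_scheme \<Rightarrow> 'a set \<Rightarrow> ('a, 'b, 'm) module_scheme \<Rightarrow> 'a list \<Rightarrow> bool"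
  where "maximal_regular_sequence R I M xs \<longleftrightarrow>
    set xs \<subseteq> I \<and> regular_sequence R M xs \<and>
    (\<forall>y\<in>I. \<not> regular_sequence R M (xs @ [y]))"

text \<open>If \<open>R\<close> is Noetherian, \<open>M\<close> finitely generated and \<open>IM \<noteq> M\<close>, then maximal \<open>M\<close>-regular
  sequences in \<open>I\<close> exist and have the same length (Rees).  If \<open>IM = M\<close>, the grade is \<open>\<infinity>\<close>
  by convention.\<close>

definition grade :: "('a, 'r) ring_scheme \<Rightarrow> 'a set \<Rightarrow> ('a, 'b, 'm) module_scheme \<Rightarrow> enat"
  where "grade R I M =
    (if ideal_smult R I M = carrier M then \<infinity>
     else enat (THE n. \<exists>xs. maximal_regular_sequence R I M xs \<and> length xs = n))"

definition ideal_cohen_macaulay ::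
  "('a, 'r) ring_scheme \<Rightarrow> 'a set \<Rightarrow> ('a, 'b, 'm) module_scheme \<Rightarrow> bool"
  where "ideal_cohen_macaulay R I M \<longleftrightarrow>
    cring R \<and> noetherian_ring R \<and> ideal I R \<and> I \<noteq> carrier R \<and>
    module R M \<and> finitely_generated R M \<and>
    ereal_of_enat (grade R I M) + module_dim R (ideal_quotient R I M) = module_dim R M"


section \<open>Local rings\<close>

definition local_ring :: "('a, 'r) ring_scheme \<Rightarrow> bool"
  where "local_ring R \<longleftrightarrow> cring R \<and> (\<exists>!m. maximalideal m R)"

definition max_ideal :: "('a, 'r) ring_scheme \<Rightarrow> 'a set"
  where "max_ideal R = (THE m. maximalideal m R)"

definition depth :: "('a, 'r) ring_scheme \<Rightarrow> ('a, 'b, 'm) module_scheme \<Rightarrow> enat"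
  where "depth R M = grade R (max_ideal R) M"

definition cohen_macaulay :: "('a, 'r) ring_scheme \<Rightarrow> ('a, 'b, 'm) module_scheme \<Rightarrow> bool"
  where "cohen_macaulay R M \<longleftrightarrow>
    local_ring R \<and> noetherian_ring R \<and> module R M \<and> finitely_generated R M \<and>
    (zero_module M \<or> ereal_of_enat (depth R M) = module_dim R M)"

definition system_of_parameters ::
  "('a, 'r) ring_scheme \<Rightarrow> ('a, 'b, 'm) module_scheme \<Rightarrow> 'a list \<Rightarrow> bool"
  where "system_of_parameters R M xs \<longleftrightarrow>
    set xs \<subseteq> max_ideal R \<and>
    ereal (real (length xs)) = module_dim R M \<and>
    module_length R (ideal_quotient R (Idl\<^bsub>R\<^esub> (set xs)) M) < \<infinity>"

end

theory Submission
  imports Defs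
begin

text \<open>Let \<open>n\<close> be the grade of \<open>p\<close> on \<open>M\<close>. By Rees' theorem every maximal \<open>M\<close>-regular sequence in \<open>p\<close> has
  length \<open>n\<close>; it stays regular on \<open>M\<^sub>p\<close>, so that the dimension of \<open>M\<^sub>p\<close> is at least \<open>n\<close>. Concatenating
  chains of primes below and above \<open>p\<close> gives \<open>dim M\<^sub>p + dim M/pM \<le> dim M\<close>, and these dimensions are finite
  by Krull's height theorem. Hence \<open>M\<close> being \<open>p\<close>-Cohen Macaulay forces \<open>dim M\<^sub>p = n\<close>, which yields (1)
  and (2).

  For (3), a Cohen Macaulay module over a local ring has in every prime \<open>q\<close> of its support a regular
  sequence as long as the height of \<open>q\<close> in the support. Indeed, if \<open>q\<close> consists of zerodivisors, then it
  annihilates a nonzero element, and from such a prime a chain of length the depth leads to the maximal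
  ideal, so that \<open>q\<close> is minimal in the support; otherwise one divides by a nonzerodivisor in \<open>q\<close>, which
  lowers the height by at most one. After clearing denominators, such a sequence for \<open>M\<^sub>p\<close> is regular
  on \<open>M\<^sub>q\<close>.

  Quotients of \<open>M\<close> are avoided: a submodule \<open>N\<close> always stands for \<open>M/N\<close>.\<close>

section \<open>Submodules\<close>

text \<open>An actual quotient of \<open>M\<close> lives in a new type of cosets, so an induction
  along a regular sequence that quotients at every step cannot stay in one fixed type; enlarging a
  submodule \<open>N\<close> of the same \<open>M\<close> can. The support of \<open>M/N\<close> is
  handled as the set of primes above \<open>ann_quot R M N\<close>, so that dimension becomes a
  matter of chains of primes of \<open>R\<close> itself. Finiteness is what makes the cancellation
  legitimate: dimensions are extended reals, and \<open>n + dim M/pM = dim M\<close> bounds the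
  chains below \<open>p\<close> by \<open>n\<close> only because \<open>dim M/pM\<close> is a real
  number. Two facts link regular sequences with dimension. A nonzerodivisor \<open>x\<close>
  lengthens chains, because below every prime of the support there is one that omits
  \<open>x\<close>. Conversely, Krull's theorem reroutes a chain through primes containing
  \<open>x\<close> at the cost of one step. For (3) the sequence is found in \<open>qR_p\<close>,
  over the module \<open>M_p\<close> that (1) shows to be Cohen Macaulay, since \<open>M\<close>
  itself need not be so over \<open>R\<close>. Its entries are unit multiples of images of elements
  of \<open>q\<close>, which is how they come back to \<open>R\<close>.\<close>

definition line :: "('a, 'r) ring_scheme \<Rightarrow> ('a, 'b, 'm) module_scheme \<Rightarrow> 'b \<Rightarrow> 'b set"
  where "line R M u = (\<lambda>a. a \<odot>\<^bsub>M\<^esub> u) ` carrier R"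

definition mult_image :: "('a, 'b, 'm) module_scheme \<Rightarrow> 'a \<Rightarrow> 'b set"
  where "mult_image M x = (\<lambda>m. x \<odot>\<^bsub>M\<^esub> m) ` carrier M"

text \<open>The annihilator of the class of \<open>u\<close> in \<open>M/N\<close>. It also serves
  as the coefficient ideal of a cyclic extension when ascending chains of submodules are
  compared.\<close>

definition colon :: "('a, 'r) ring_scheme \<Rightarrow> ('a, 'b, 'm) module_scheme \<Rightarrow> 'b set \<Rightarrow> 'b \<Rightarrow> 'a set"
  where "colon R M N u = {a \<in> carrier R. a \<odot>\<^bsub>M\<^esub> u \<in> N}"

text \<open>For finitely generated \<open>M\<close> the primes that contain this ideal form the
  support of \<open>M/N\<close>; support and dimension enter most later statements through
  it.\<close>

definition ann_quot :: "('a, 'r) ring_scheme \<Rightarrow> ('a, 'b, 'm) module_scheme \<Rightarrow> 'b set \<Rightarrow> 'a set"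
  where "ann_quot R M N = {a \<in> carrier R. \<forall>x\<in>carrier M. a \<odot>\<^bsub>M\<^esub> x \<in> N}"

section \<open>Closure properties of ideals and primes\<close>

lemma (in cring) idealI_cring:
  assumes "I \<subseteq> carrier R" "\<zero> \<in> I"
    and "\<And>a b. a \<in> I \<Longrightarrow> b \<in> I \<Longrightarrow> a \<oplus> b \<in> I"
    and "\<And>a r. a \<in> I \<Longrightarrow> r \<in> carrier R \<Longrightarrow> r \<otimes> a \<in> I"
  shows "ideal I R"
proof (rule idealI)
  show "ring R" by (rule ring_axioms)
  show "subgroup I (add_monoid R)"
  proof (rule add.subgroupI)
    show "I \<noteq> {}" using assms(2) by auto
    show "\<ominus> a \<in> I" if "a \<in> I" for a
    proof -
      have "a \<in> carrier R" using that assms(1) by auto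
      then show ?thesis using assms(4)[OF that, of "\<ominus> \<one>"] by (simp add: l_minus)
    qed
  qed (use assms in auto)
  show "x \<otimes> a \<in> I" if "a \<in> I" "x \<in> carrier R" for a x using assms(4) that by auto
  show "a \<otimes> x \<in> I" if "a \<in> I" "x \<in> carrier R" for a x using assms(1,4) that by (metis m_comm subsetD)
qed

lemma ideal_facts:
  assumes "ideal I R"
  shows ideal_subset: "I \<subseteq> carrier R"
    and ideal_zero: "\<zero>\<^bsub>R\<^esub> \<in> I"
    and ideal_add: "\<And>a b. a \<in> I \<Longrightarrow> b \<in> I \<Longrightarrow> a \<oplus>\<^bsub>R\<^esub> b \<in> I"
    and ideal_neg: "\<And>a. a \<in> I \<Longrightarrow> \<ominus>\<^bsub>R\<^esub> a \<in> I"
    and ideal_lmult: "\<And>a r. a \<in> I \<Longrightarrow> r \<in> carrier R \<Longrightarrow> r \<otimes>\<^bsub>R\<^esub> a \<in> I"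
    and ideal_rmult: "\<And>a r. a \<in> I \<Longrightarrow> r \<in> carrier R \<Longrightarrow> a \<otimes>\<^bsub>R\<^esub> r \<in> I"
proof -
  interpret ideal I R by fact
  show "I \<subseteq> carrier R" by (rule a_subset)
  show "\<zero>\<^bsub>R\<^esub> \<in> I" by simp
  show "\<And>a b. a \<in> I \<Longrightarrow> b \<in> I \<Longrightarrow> a \<oplus>\<^bsub>R\<^esub> b \<in> I" by simp
  show "\<And>a. a \<in> I \<Longrightarrow> \<ominus>\<^bsub>R\<^esub> a \<in> I" by simp
  show "\<And>a r. a \<in> I \<Longrightarrow> r \<in> carrier R \<Longrightarrow> r \<otimes>\<^bsub>R\<^esub> a \<in> I" by (rule I_l_closed)
  show "\<And>a r. a \<in> I \<Longrightarrow> r \<in> carrier R \<Longrightarrow> a \<otimes>\<^bsub>R\<^esub> r \<in> I" by (rule I_r_closed)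
qed

lemma (in cring) ideal_minus_cancel:
  assumes "ideal I R" "a \<in> I" "b \<in> carrier R" "a \<oplus> b \<in> I"
  shows "b \<in> I"
proof -
  have "\<ominus> a \<oplus> (a \<oplus> b) \<in> I" using assms by (meson ideal_add ideal_neg)
  moreover have "a \<in> carrier R" using assms ideal_subset by blast
  ultimately show ?thesis using assms(3) by (simp add: r_neg1)
qed

lemma prime_facts:
  assumes "primeideal P R"
  shows prime_ideal: "ideal P R"
    and prime_one: "\<one>\<^bsub>R\<^esub> \<notin> P"
    and prime_mult: "\<And>a b. a \<in> carrier R \<Longrightarrow> b \<in> carrier R \<Longrightarrow> a \<otimes>\<^bsub>R\<^esub> b \<in> P \<Longrightarrow> a \<in> P \<or> b \<in> P"
    and prime_subset: "P \<subseteq> carrier R"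
proof -
  interpret primeideal P R by fact
  show "ideal P R" by (rule is_ideal)
  show "\<one>\<^bsub>R\<^esub> \<notin> P" using I_notcarr one_imp_carrier by auto
  show "\<And>a b. a \<in> carrier R \<Longrightarrow> b \<in> carrier R \<Longrightarrow> a \<otimes>\<^bsub>R\<^esub> b \<in> P \<Longrightarrow> a \<in> P \<or> b \<in> P"
    by (rule I_prime)
  show "P \<subseteq> carrier R" by (rule a_subset)
qed

lemma (in cring) primeidealI_cring:
  assumes "ideal P R" "\<one> \<notin> P"
    and "\<And>a b. a \<in> carrier R \<Longrightarrow> b \<in> carrier R \<Longrightarrow> a \<otimes> b \<in> P \<Longrightarrow> a \<notin> P \<Longrightarrow> b \<in> P"
  shows "primeideal P R"
proof (rule primeidealI[OF assms(1) is_cring])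
  show "carrier R \<noteq> P" using assms(2) by auto
qed (use assms(3) in blast)

section \<open>Submodules, their sums and colon ideals\<close>

context module begin

lemma submodule_zero: "submodule N R M \<Longrightarrow> \<zero>\<^bsub>M\<^esub> \<in> N"
  using subgroup.one_closed[OF submodule.axioms(1)] by fastforce

lemmas submodule_subset = submoduleE(1)
  and submodule_neg = submoduleE(3)
  and submodule_smult = submoduleE(4)
  and submodule_add = submoduleE(5)

lemma submodule_carr: "submodule N R M \<Longrightarrow> x \<in> N \<Longrightarrow> x \<in> carrier M"
  using submodule_subset by blast

lemma submodule_cancel:
  assumes "submodule N R M" "n \<in> N" "y \<in> carrier M" "n \<oplus>\<^bsub>M\<^esub> y \<in> N"
  shows "y \<in> N"
proof -
  have "\<ominus>\<^bsub>M\<^esub> n \<oplus>\<^bsub>M\<^esub> (n \<oplus>\<^bsub>M\<^esub> y) \<in> N" using assms by (meson submodule_add submodule_neg)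
  then show ?thesis using assms submodule_carr by (simp add: M.r_neg1)
qed

lemma submoduleI_smult:
  assumes "H \<subseteq> carrier M" "\<zero>\<^bsub>M\<^esub> \<in> H"
    and "\<And>a b. a \<in> H \<Longrightarrow> b \<in> H \<Longrightarrow> a \<oplus>\<^bsub>M\<^esub> b \<in> H"
    and "\<And>a x. a \<in> carrier R \<Longrightarrow> x \<in> H \<Longrightarrow> a \<odot>\<^bsub>M\<^esub> x \<in> H"
  shows "submodule H R M"
proof (rule submoduleI)
  show "\<ominus>\<^bsub>M\<^esub> a \<in> H" if "a \<in> H" for a
    using assms(4)[of "\<ominus> \<one>" a] that assms(1) smult_l_minus[of \<one> a] by auto
qed (use assms in auto)

lemma zero_submodule: "submodule {\<zero>\<^bsub>M\<^esub>} R M"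
  by (rule submoduleI_smult) auto

lemma submodule_Inter:
  assumes "\<N> \<noteq> {}" "\<And>N. N \<in> \<N> \<Longrightarrow> submodule N R M"
  shows "submodule (\<Inter>\<N>) R M"
proof (rule submoduleI_smult)
  show "\<Inter>\<N> \<subseteq> carrier M" using assms submodule_subset by blast
  show "\<zero>\<^bsub>M\<^esub> \<in> \<Inter>\<N>" using assms submodule_zero by blast
  show "a \<oplus>\<^bsub>M\<^esub> b \<in> \<Inter>\<N>" if "a \<in> \<Inter>\<N>" "b \<in> \<Inter>\<N>" for a b
    using that by (auto intro: submodule_add[OF assms(2)])
  show "a \<odot>\<^bsub>M\<^esub> x \<in> \<Inter>\<N>" if "a \<in> carrier R" "x \<in> \<Inter>\<N>" for a x
    using that by (auto intro: submodule_smult[OF assms(2)])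
qed

lemma submodule_Int: "submodule N R M \<Longrightarrow> submodule K R M \<Longrightarrow> submodule (N \<inter> K) R M"
  using submodule_Inter[of "{N, K}"] by auto

lemma mem_set_add_iff: "y \<in> N <+>\<^bsub>M\<^esub> K \<longleftrightarrow> (\<exists>n\<in>N. \<exists>k\<in>K. y = n \<oplus>\<^bsub>M\<^esub> k)"
  by (auto simp: set_add_def')

lemma submodule_set_add:
  assumes N: "submodule N R M" and K: "submodule K R M"
  shows "submodule (N <+>\<^bsub>M\<^esub> K) R M"
proof (rule submoduleI_smult)
  show "N <+>\<^bsub>M\<^esub> K \<subseteq> carrier M"
    using submodule_carr[OF N] submodule_carr[OF K] by (auto simp: mem_set_add_iff)
  show "\<zero>\<^bsub>M\<^esub> \<in> N <+>\<^bsub>M\<^esub> K"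
    using submodule_zero[OF N] submodule_zero[OF K] by (auto simp: mem_set_add_iff intro!: bexI)
next
  fix a b assume "a \<in> N <+>\<^bsub>M\<^esub> K" "b \<in> N <+>\<^bsub>M\<^esub> K"
  then obtain n k n' k' where *: "n \<in> N" "k \<in> K" "n' \<in> N" "k' \<in> K" "a = n \<oplus>\<^bsub>M\<^esub> k" "b = n' \<oplus>\<^bsub>M\<^esub> k'"
    by (auto simp: mem_set_add_iff)
  then have "a \<oplus>\<^bsub>M\<^esub> b = (n \<oplus>\<^bsub>M\<^esub> n') \<oplus>\<^bsub>M\<^esub> (k \<oplus>\<^bsub>M\<^esub> k')"
    using submodule_carr[OF N] submodule_carr[OF K] by (simp add: M.a_ac)
  then show "a \<oplus>\<^bsub>M\<^esub> b \<in> N <+>\<^bsub>M\<^esub> K"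
    using * submodule_add[OF N] submodule_add[OF K] mem_set_add_iff by blast
next
  fix a x assume a: "a \<in> carrier R" and "x \<in> N <+>\<^bsub>M\<^esub> K"
  then obtain n k where *: "n \<in> N" "k \<in> K" "x = n \<oplus>\<^bsub>M\<^esub> k"
    by (auto simp: mem_set_add_iff)
  then have "a \<odot>\<^bsub>M\<^esub> x = a \<odot>\<^bsub>M\<^esub> n \<oplus>\<^bsub>M\<^esub> a \<odot>\<^bsub>M\<^esub> k"
    using submodule_carr[OF N] submodule_carr[OF K] a by (simp add: smult_r_distr)
  moreover have "a \<odot>\<^bsub>M\<^esub> n \<in> N" "a \<odot>\<^bsub>M\<^esub> k \<in> K"
    using * a submodule_smult[OF N] submodule_smult[OF K] by auto
  ultimately show "a \<odot>\<^bsub>M\<^esub> x \<in> N <+>\<^bsub>M\<^esub> K"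
    using mem_set_add_iff by blast
qed

lemma set_add_upper1:
  assumes N: "submodule N R M" and K: "submodule K R M"
  shows "N \<subseteq> N <+>\<^bsub>M\<^esub> K"
proof
  fix x assume "x \<in> N"
  then have "x = x \<oplus>\<^bsub>M\<^esub> \<zero>\<^bsub>M\<^esub>" using submodule_carr[OF N] by simp
  then show "x \<in> N <+>\<^bsub>M\<^esub> K" using \<open>x \<in> N\<close> submodule_zero[OF K] mem_set_add_iff by blast
qed

lemma set_add_upper2:
  assumes N: "submodule N R M" and K: "submodule K R M"
  shows "K \<subseteq> N <+>\<^bsub>M\<^esub> K"
proof
  fix x assume "x \<in> K"
  then have "x = \<zero>\<^bsub>M\<^esub> \<oplus>\<^bsub>M\<^esub> x" using submodule_carr[OF K] by simp
  then show "x \<in> N <+>\<^bsub>M\<^esub> K" using \<open>x \<in> K\<close> submodule_zero[OF N] mem_set_add_iff by blast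
qed

lemma set_add_least:
  assumes "submodule L R M" "N \<subseteq> L" "K \<subseteq> L"
  shows "N <+>\<^bsub>M\<^esub> K \<subseteq> L"
proof
  fix y assume "y \<in> N <+>\<^bsub>M\<^esub> K"
  then obtain n k where "n \<in> N" "k \<in> K" "y = n \<oplus>\<^bsub>M\<^esub> k"
    unfolding mem_set_add_iff by (elim bexE)
  then show "y \<in> L" using assms submodule_add[OF assms(1), of n k] by auto
qed

lemma submodule_line: "u \<in> carrier M \<Longrightarrow> submodule (line R M u) R M"
proof (rule submoduleI_smult)
  assume u: "u \<in> carrier M"
  show "\<zero>\<^bsub>M\<^esub> \<in> line R M u"
    using smult_l_null[OF u] unfolding line_def by (metis R.zero_closed image_eqI)
  show "a \<oplus>\<^bsub>M\<^esub> b \<in> line R M u" if "a \<in> line R M u" "b \<in> line R M u" for a b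
    using that u unfolding line_def by (auto simp flip: smult_l_distr)
  show "a \<odot>\<^bsub>M\<^esub> x \<in> line R M u" if "a \<in> carrier R" "x \<in> line R M u" for a x
    using that u unfolding line_def by (auto simp flip: smult_assoc1)
qed (auto simp: line_def)

lemma line_self: "u \<in> carrier M \<Longrightarrow> u \<in> line R M u"
  unfolding line_def using smult_one[of u] by (metis R.one_closed image_eqI)

lemma submodule_mult_image: "x \<in> carrier R \<Longrightarrow> submodule (mult_image M x) R M"
proof (rule submoduleI_smult)
  assume x: "x \<in> carrier R"
  show "\<zero>\<^bsub>M\<^esub> \<in> mult_image M x"
    using smult_r_null[OF x] unfolding mult_image_def by (metis M.zero_closed image_eqI)
  show "a \<oplus>\<^bsub>M\<^esub> b \<in> mult_image M x" if "a \<in> mult_image M x" "b \<in> mult_image M x" for a b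
    using that x unfolding mult_image_def by (auto simp flip: smult_r_distr)
  show "a \<odot>\<^bsub>M\<^esub> y \<in> mult_image M x" if a: "a \<in> carrier R" and y: "y \<in> mult_image M x" for a y
  proof -
    obtain m where m: "m \<in> carrier M" "y = x \<odot>\<^bsub>M\<^esub> m" using y unfolding mult_image_def by auto
    have "a \<odot>\<^bsub>M\<^esub> y = x \<odot>\<^bsub>M\<^esub> (a \<odot>\<^bsub>M\<^esub> m)"
      using x a m by (metis R.m_comm smult_assoc1)
    then show ?thesis using a m unfolding mult_image_def by auto
  qed
qed (auto simp: mult_image_def)

lemma colon_ideal:
  assumes N: "submodule N R M" and u: "u \<in> carrier M"
  shows "ideal (colon R M N u) R"
proof (rule R.idealI_cring)
  show "\<zero> \<in> colon R M N u" using N u submodule_zero by (simp add: colon_def)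
  show "a \<oplus> b \<in> colon R M N u" if "a \<in> colon R M N u" "b \<in> colon R M N u" for a b
    using that u submodule_add[OF N] by (auto simp: colon_def smult_l_distr)
  show "r \<otimes> a \<in> colon R M N u" if "a \<in> colon R M N u" "r \<in> carrier R" for a r
    using that u submodule_smult[OF N] by (auto simp: colon_def smult_assoc1)
qed (auto simp: colon_def)

lemma ann_quot_ideal:
  assumes N: "submodule N R M"
  shows "ideal (ann_quot R M N) R"
proof (rule R.idealI_cring)
  show "\<zero> \<in> ann_quot R M N" using N submodule_zero by (simp add: ann_quot_def)
  show "a \<oplus> b \<in> ann_quot R M N" if "a \<in> ann_quot R M N" "b \<in> ann_quot R M N" for a b
    using that submodule_add[OF N] by (auto simp: ann_quot_def smult_l_distr)
  show "r \<otimes> a \<in> ann_quot R M N" if "a \<in> ann_quot R M N" "r \<in> carrier R" for a r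
    using that submodule_smult[OF N] by (auto simp: ann_quot_def smult_assoc1)
qed (auto simp: ann_quot_def)

lemma ann_quot_subset_colon: "u \<in> carrier M \<Longrightarrow> ann_quot R M N \<subseteq> colon R M N u"
  by (auto simp: ann_quot_def colon_def)

lemma ann_quot_mono: "N \<subseteq> K \<Longrightarrow> ann_quot R M N \<subseteq> ann_quot R M K"
  by (auto simp: ann_quot_def)

lemma module_span_submodule:
  assumes "G \<subseteq> carrier M" shows "submodule (module_span R M G) R M"
  unfolding module_span_def
  by (rule submodule_Inter) (use assms carrier_is_submodule in auto)

lemma module_span_incl: "G \<subseteq> module_span R M G"
  unfolding module_span_def by auto

lemma module_span_least: "submodule N R M \<Longrightarrow> G \<subseteq> N \<Longrightarrow> module_span R M G \<subseteq> N"
  unfolding module_span_def by blast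

end

section \<open>The ascending chain condition\<close>

text \<open>The first component of a pair is the larger ideal, so well-foundedness is the ascending
  chain condition, and the minimal elements of a family are its maximal members.\<close>

lemma (in noetherian_ring) wf_ideals:
  "wf {(I, J). ideal I R \<and> ideal J R \<and> J \<subset> I}"
  unfolding wf_iff_no_infinite_down_chain
proof
  assume "\<exists>f. \<forall>i. (f (Suc i), f i) \<in> {(I, J). ideal I R \<and> ideal J R \<and> J \<subset> I}"
  then obtain f where "\<forall>i. ideal (f i) R \<and> f i \<subset> f (Suc i)" unfolding mem_Collect_eq case_prod_conv by metis
  then have f: "\<And>i. ideal (f i) R" "\<And>i. f i \<subset> f (Suc i)" by auto
  have mono: "i \<le> j \<Longrightarrow> f i \<subseteq> f j" for i j
    by (rule lift_Suc_mono_le[of f]) (rule psubset_imp_subset[OF f(2)])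
  have "subset.chain {I. ideal I R} (range f)"
    unfolding subset_chain_def
  proof (intro conjI ballI)
    show "X \<subseteq> Y \<or> Y \<subseteq> X" if XY: "X \<in> range f" "Y \<in> range f" for X Y
    proof -
      obtain i j where "X = f i" "Y = f j" using XY by (elim rangeE)
      then show ?thesis using mono[of i j] mono[of j i] by (cases "i \<le> j") auto
    qed
  qed (use f(1) in auto)
  then obtain k where "\<Union>(range f) = f k" using ideal_chain_is_trivial[of "range f"] by auto
  with f(2)[of k] show False by blast
qed

locale noetherian_module = module +
  assumes noetherian: "noetherian_ring R" and fin_gen: "finitely_generated R M"
begin

text \<open>Inside \<open>N + Ru\<close> a submodule \<open>K\<close> is recorded by
  \<open>K \<inter> N\<close> and by the ideal of all \<open>a\<close> with \<open>au\<close> in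
  \<open>N + K\<close>. If \<open>K\<close> grows while the first datum stays the same, the second
  one grows, so the chain conditions for \<open>N\<close> and for \<open>R\<close> combine
  lexicographically.\<close>

lemma wf_submodules_step:
  assumes N: "submodule N R M" and u: "u \<in> carrier M"
    and wf: "wf {(K, L). submodule K R M \<and> submodule L R M \<and> K \<subseteq> N \<and> L \<subset> K}" (is "wf ?A")
  shows "wf {(K, L). submodule K R M \<and> submodule L R M \<and> K \<subseteq> N <+>\<^bsub>M\<^esub> line R M u \<and> L \<subset> K}" (is "wf ?B")
proof -
  let ?I = "\<lambda>K. colon R M (N <+>\<^bsub>M\<^esub> K) u"
  let ?f = "\<lambda>K. (K \<inter> N, ?I K)"
  let ?C = "{(I, J). ideal I R \<and> ideal J R \<and> J \<subset> I}"
  have "wf (inv_image (?A <*lex*> ?C) ?f)"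
    using wf noetherian_ring.wf_ideals[OF noetherian] by auto
  moreover have "?B \<subseteq> inv_image (?A <*lex*> ?C) ?f"
  proof
    fix KL assume "KL \<in> ?B"
    then obtain K L x where KL: "KL = (K, L)" and K: "submodule K R M" "K \<subseteq> N <+>\<^bsub>M\<^esub> line R M u"
      and L: "submodule L R M" and LK: "L \<subseteq> K" and x: "x \<in> K" "x \<notin> L"
      by blast
    have sub: "submodule (K \<inter> N) R M" "submodule (L \<inter> N) R M"
      using K L N submodule_Int by auto
    have id: "ideal (?I K) R" "ideal (?I L) R"
      using K L N u by (auto intro!: colon_ideal submodule_set_add)
    have le: "?I L \<subseteq> ?I K" using LK by (auto simp: colon_def mem_set_add_iff)
    have "(K, L) \<in> inv_image (?A <*lex*> ?C) ?f"
    proof (cases "K \<inter> N = L \<inter> N")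
      case False
      then show ?thesis using sub LK by auto
    next
      case True
      \<comment> \<open>Equal ideals would move the coefficient of \<open>u\<close> in
        \<open>x\<close> from \<open>K\<close> to \<open>L\<close>: then \<open>x\<close> is an
        element \<open>y\<close> of \<open>L\<close> plus \<open>n + n'\<close>, and the latter lies
        in \<open>K\<close> and in \<open>N\<close>, hence in \<open>L\<close>.\<close>
      have "?I L \<noteq> ?I K"
      proof
        assume eq: "?I L = ?I K"
        obtain n a where n: "n \<in> N" "a \<in> carrier R" "x = n \<oplus>\<^bsub>M\<^esub> a \<odot>\<^bsub>M\<^esub> u"
          using subsetD[OF K(2) x(1)] unfolding mem_set_add_iff line_def by (elim bexE imageE) simp
        have nM: "n \<in> carrier M" using n N submodule_carr by auto
        have "a \<odot>\<^bsub>M\<^esub> u = \<ominus>\<^bsub>M\<^esub> n \<oplus>\<^bsub>M\<^esub> x" using n nM u by (simp add: M.r_neg1)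
        then have "a \<in> ?I K" using n(1,2) x submodule_neg[OF N]
          by (auto simp: colon_def mem_set_add_iff)
        then have "a \<in> ?I L" using eq by simp
        then obtain n' y where y: "n' \<in> N" "y \<in> L" "a \<odot>\<^bsub>M\<^esub> u = n' \<oplus>\<^bsub>M\<^esub> y"
          by (auto simp: colon_def mem_set_add_iff)
        have carr: "n' \<in> carrier M" "y \<in> carrier M" using y N L submodule_carr by auto
        have "x = y \<oplus>\<^bsub>M\<^esub> (n \<oplus>\<^bsub>M\<^esub> n')" using n y nM carr by (simp add: M.a_ac)
        moreover have "n \<oplus>\<^bsub>M\<^esub> n' \<in> K"
          using submodule_cancel[OF K(1), of y "n \<oplus>\<^bsub>M\<^esub> n'"] y LK x calculation nM carr by auto
        moreover have "n \<oplus>\<^bsub>M\<^esub> n' \<in> N" using n y N submodule_add by auto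
        ultimately have "x \<in> L" using True y L submodule_add by blast
        then show False using x by simp
      qed
      then show ?thesis using True le id by auto
    qed
    then show "KL \<in> inv_image (?A <*lex*> ?C) ?f" using KL by simp
  qed
  ultimately show ?thesis by (rule wf_subset)
qed

text \<open>Adjoining the generators one at a time carries the chain condition from the zero
  submodule up to \<open>M\<close>. Later arguments about \<open>M\<close> take a maximal submodule
  with a suitable property instead of inducting on generators.\<close>

lemma wf_submodules: "wf {(K, L). submodule K R M \<and> submodule L R M \<and> L \<subset> K}"
proof -
  obtain G where G: "finite G" "G \<subseteq> carrier M" "module_span R M G = carrier M"
    using fin_gen unfolding finitely_generated_def by auto
  from G(1,2) have "\<exists>N. submodule N R M \<and> G \<subseteq> N \<and>
      wf {(K, L). submodule K R M \<and> submodule L R M \<and> K \<subseteq> N \<and> L \<subset> K}"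
  proof (induction G rule: finite_induct)
    case empty
    have *: "{(K, L). submodule K R M \<and> submodule L R M \<and> K \<subseteq> {\<zero>\<^bsub>M\<^esub>} \<and> L \<subset> K} = {}"
      using submodule_zero by blast
    show ?case using zero_submodule unfolding * by (intro exI[of _ "{\<zero>\<^bsub>M\<^esub>}"], subst *) simp
  next
    case (insert u G)
    then obtain N where N: "submodule N R M" "G \<subseteq> N"
      "wf {(K, L). submodule K R M \<and> submodule L R M \<and> K \<subseteq> N \<and> L \<subset> K}" by auto
    have u: "u \<in> carrier M" using insert by auto
    have "insert u G \<subseteq> N <+>\<^bsub>M\<^esub> line R M u"
      using set_add_upper1[OF N(1) submodule_line[OF u]] set_add_upper2[OF N(1) submodule_line[OF u]]
        N(2) line_self[OF u] by auto
    then show ?case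
      using wf_submodules_step[OF N(1) u N(3)] submodule_set_add[OF N(1) submodule_line[OF u]] by blast
  qed
  then obtain N where N: "submodule N R M" "G \<subseteq> N"
    "wf {(K, L). submodule K R M \<and> submodule L R M \<and> K \<subseteq> N \<and> L \<subset> K}" by auto
  have "carrier M \<subseteq> N" using module_span_least[OF N(1,2)] G(3) by simp
  then show ?thesis
    by (intro wf_subset[OF N(3)]) (use submodule_subset in blast)
qed

lemma maximal_submodule:
  assumes "N \<in> \<F>" "\<And>N. N \<in> \<F> \<Longrightarrow> submodule N R M"
  obtains K where "K \<in> \<F>" "\<And>L. L \<in> \<F> \<Longrightarrow> \<not> K \<subset> L"
proof -
  obtain K where K: "K \<in> \<F>" "\<And>y. (y, K) \<in> {(K, L). submodule K R M \<and> submodule L R M \<and> L \<subset> K} \<Longrightarrow> y \<notin> \<F>"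
    using wfE_min[OF wf_submodules assms(1)] by blast
  have "\<not> K \<subset> L" if "L \<in> \<F>" for L
    using K(2)[of L] that assms(2)[OF that] assms(2)[OF K(1)] by auto
  then show thesis using that K(1) by blast
qed

end

section \<open>Zerodivisors and Nakayama's lemma\<close>

text \<open>This is \<open>nonzerodivisor_on\<close> for \<open>M/N\<close>. The case
  \<open>N = carrier M\<close> is allowed, and properness is tracked separately.\<close>

definition nzd :: "('a, 'b, 'm) module_scheme \<Rightarrow> 'b set \<Rightarrow> 'a \<Rightarrow> bool"
  where "nzd M N x \<longleftrightarrow> (\<forall>m\<in>carrier M. x \<odot>\<^bsub>M\<^esub> m \<in> N \<longrightarrow> m \<in> N)"

definition ideal_mult :: "('a, 'r) ring_scheme \<Rightarrow> ('a, 'b, 'm) module_scheme \<Rightarrow> 'a set \<Rightarrow> 'b set \<Rightarrow> 'b set"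
  where "ideal_mult R M I N = module_span R M {a \<odot>\<^bsub>M\<^esub> x | a x. a \<in> I \<and> x \<in> N}"

text \<open>The colon ideals singled out here are the maximal associated primes of
  \<open>M/N\<close>, obtained as maximal annihilators of nonzero classes.\<close>

definition max_colon :: "('a, 'r) ring_scheme \<Rightarrow> ('a, 'b, 'm) module_scheme \<Rightarrow> 'b set \<Rightarrow> 'b \<Rightarrow> bool"
  where "max_colon R M N u \<longleftrightarrow> u \<in> carrier M - N \<and> (\<forall>v\<in>carrier M - N. \<not> colon R M N u \<subset> colon R M N v)"

section \<open>Prime avoidance\<close>

text \<open>Pick an element outside \<open>P\<close> in each of the ideals: the product lies in all
  of them and, \<open>P\<close> being prime, outside \<open>P\<close>.\<close>

lemma (in cring) prime_finite_Int:
  assumes P: "primeideal P R" and "finite F"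
    and "\<And>Q. Q \<in> F \<Longrightarrow> ideal Q R" "\<And>Q. Q \<in> F \<Longrightarrow> \<not> Q \<subseteq> P"
  shows "\<exists>c\<in>carrier R. c \<notin> P \<and> (\<forall>Q\<in>F. c \<in> Q)"
  using assms(2-)
proof (induction F rule: finite_induct)
  case empty
  then show ?case using prime_one[OF P] by auto
next
  case (insert Q F)
  then obtain c where c: "c \<in> carrier R" "c \<notin> P" "\<forall>Q\<in>F. c \<in> Q" by auto
  have Q: "ideal Q R" using insert by simp
  obtain d where d: "d \<in> Q" "d \<notin> P" using insert.prems(2)[of Q] by auto
  have dR: "d \<in> carrier R" using d Q ideal_subset by blast
  have "c \<otimes> d \<notin> P" using prime_mult[OF P c(1) dR] c d by auto
  moreover have "c \<otimes> d \<in> Q" using ideal_lmult[OF Q d(1) c(1)] .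
  moreover have "c \<otimes> d \<in> Q'" if "Q' \<in> F" for Q'
    using ideal_rmult[of Q' R c d] that c(3) dR insert.prems(1) by auto
  ultimately show ?case using c dR by (intro bexI[of _ "c \<otimes> d"]) auto
qed

text \<open>Induction drops one prime \<open>P\<close> and gives \<open>a\<close> in
  \<open>I\<close> that avoids the others. If \<open>a\<close> lies in \<open>P\<close> and no other
  prime is contained in \<open>P\<close>, then \<open>prime_finite_Int\<close> yields a correction
  \<open>c\<close> in \<open>I\<close> and in all the other primes but outside \<open>P\<close>, and
  \<open>a + c\<close> avoids everything.\<close>

lemma (in cring) prime_avoidance:
  assumes I: "ideal I R" and "finite F" "\<And>P. P \<in> F \<Longrightarrow> primeideal P R" "\<And>P. P \<in> F \<Longrightarrow> \<not> I \<subseteq> P"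
  shows "\<exists>a\<in>I. \<forall>P\<in>F. a \<notin> P"
  using assms(2-)
proof (induction "card F" arbitrary: F rule: less_induct)
  case less
  show ?case
  proof (cases "F = {}")
    case True
    then show ?thesis using ideal_zero[OF I] by auto
  next
    case False
    then obtain P where P: "P \<in> F" by auto
    have cardlt: "card (F - {X}) < card F" if "X \<in> F" for X
      using card_Diff1_less[OF less.prems(1) that] .
    have sub: "\<exists>a\<in>I. \<forall>P\<in>F - {X}. a \<notin> P" if "X \<in> F" for X
      using less.hyps[OF cardlt[OF that]] less.prems by simp
    have pP: "primeideal P R" using P less.prems by simp
    obtain a where a: "a \<in> I" "\<forall>Q\<in>F - {P}. a \<notin> Q" using sub[OF P] by auto
    have aR: "a \<in> carrier R" using a I ideal_subset by blast
    consider "a \<notin> P" | Q where "Q \<in> F" "Q \<noteq> P" "Q \<subseteq> P" | "a \<in> P" "\<forall>Q\<in>F - {P}. \<not> Q \<subseteq> P"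
      by blast
    then show ?thesis
    proof cases
      case 1
      then show ?thesis using a by auto
    next
      case 2
      \<comment> \<open>An element that avoids all primes but \<open>Q\<close> avoids
        \<open>P\<close>, and hence also \<open>Q\<close>, which lies inside
        \<open>P\<close>.\<close>
      obtain b where "b \<in> I" "\<forall>X\<in>F - {Q}. b \<notin> X" using sub[OF 2(1)] by auto
      then show ?thesis using 2 P by (metis DiffI empty_iff insert_iff subsetD)
    next
      case 3
      have ids: "ideal Q R \<and> \<not> Q \<subseteq> P" if "Q \<in> insert I (F - {P})" for Q
      proof (cases "Q = I")
        case True
        then show ?thesis using I less.prems(3)[OF P] by simp
      next
        case False
        then have "Q \<in> F - {P}" using that by simp
        then show ?thesis using 3(2) prime_ideal[OF less.prems(2), of Q] by simp
      qed
      obtain c where c: "c \<in> carrier R" "c \<notin> P" "\<forall>Q\<in>insert I (F - {P}). c \<in> Q"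
        using prime_finite_Int[OF pP, of "insert I (F - {P})"] ids less.prems(1) by auto
      have "a \<oplus> c \<notin> Q" if Q: "Q \<in> F" for Q
      proof (cases "Q = P")
        case True
        then show ?thesis using ideal_minus_cancel[OF prime_ideal[OF pP] 3(1) c(1)] c(2) by auto
      next
        case False
        then have iQ: "ideal Q R" and cQ: "c \<in> Q" and "a \<notin> Q" using Q ids c(3) a by auto
        then show ?thesis
          using ideal_minus_cancel[OF iQ cQ aR] c(1) aR by (auto simp: a_comm)
      qed
      moreover have "a \<oplus> c \<in> I" using ideal_add[OF I a(1)] c(3) by auto
      ultimately show ?thesis by auto
    qed
  qed
qed

context module begin

lemma submodule_preimage:
  assumes N: "submodule N R M" and a: "a \<in> carrier R"
  shows "submodule {m \<in> carrier M. a \<odot>\<^bsub>M\<^esub> m \<in> N} R M"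
proof (rule submoduleI_smult)
  show "\<zero>\<^bsub>M\<^esub> \<in> {m \<in> carrier M. a \<odot>\<^bsub>M\<^esub> m \<in> N}" using a submodule_zero[OF N] by simp
  show "x \<oplus>\<^bsub>M\<^esub> y \<in> {m \<in> carrier M. a \<odot>\<^bsub>M\<^esub> m \<in> N}"
    if "x \<in> {m \<in> carrier M. a \<odot>\<^bsub>M\<^esub> m \<in> N}" "y \<in> {m \<in> carrier M. a \<odot>\<^bsub>M\<^esub> m \<in> N}" for x y
    using that a submodule_add[OF N] by (simp add: smult_r_distr)
  show "r \<odot>\<^bsub>M\<^esub> x \<in> {m \<in> carrier M. a \<odot>\<^bsub>M\<^esub> m \<in> N}"
    if r: "r \<in> carrier R" and x: "x \<in> {m \<in> carrier M. a \<odot>\<^bsub>M\<^esub> m \<in> N}" for r x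
  proof -
    have "a \<odot>\<^bsub>M\<^esub> (r \<odot>\<^bsub>M\<^esub> x) = r \<odot>\<^bsub>M\<^esub> (a \<odot>\<^bsub>M\<^esub> x)"
      using a r x by (simp add: R.m_comm flip: smult_assoc1)
    then show ?thesis using r x submodule_smult[OF N] by simp
  qed
qed simp

lemma smult_commute:
  "a \<in> carrier R \<Longrightarrow> b \<in> carrier R \<Longrightarrow> x \<in> carrier M \<Longrightarrow> a \<odot>\<^bsub>M\<^esub> (b \<odot>\<^bsub>M\<^esub> x) = b \<odot>\<^bsub>M\<^esub> (a \<odot>\<^bsub>M\<^esub> x)"
  by (simp add: R.m_comm flip: smult_assoc1)

lemma submodule_killed:
  assumes N: "submodule N R M" and A: "A \<subseteq> carrier R"
  shows "submodule {m \<in> carrier M. \<forall>a\<in>A. a \<odot>\<^bsub>M\<^esub> m \<in> N} R M"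
proof -
  have "{m \<in> carrier M. \<forall>a\<in>A. a \<odot>\<^bsub>M\<^esub> m \<in> N} =
    \<Inter>(insert (carrier M) ((\<lambda>a. {m \<in> carrier M. a \<odot>\<^bsub>M\<^esub> m \<in> N}) ` A))"
    by auto
  moreover have "submodule X R M"
    if "X \<in> insert (carrier M) ((\<lambda>a. {m \<in> carrier M. a \<odot>\<^bsub>M\<^esub> m \<in> N}) ` A)" for X
    using that A carrier_is_submodule submodule_preimage[OF N] by blast
  ultimately show ?thesis
    using submodule_Inter[of "insert (carrier M) ((\<lambda>a. {m \<in> carrier M. a \<odot>\<^bsub>M\<^esub> m \<in> N}) ` A)"] by simp
qed

lemma submodule_ideal_image:
  assumes I: "ideal I R" and u: "u \<in> carrier M"
  shows "submodule ((\<lambda>a. a \<odot>\<^bsub>M\<^esub> u) ` I) R M"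
proof (rule submoduleI_smult)
  have IR: "I \<subseteq> carrier R" using ideal_subset[OF I] .
  show "(\<lambda>a. a \<odot>\<^bsub>M\<^esub> u) ` I \<subseteq> carrier M" using IR u by auto
  show "\<zero>\<^bsub>M\<^esub> \<in> (\<lambda>a. a \<odot>\<^bsub>M\<^esub> u) ` I"
    using ideal_zero[OF I] smult_l_null[OF u] by (metis image_eqI)
  show "x \<oplus>\<^bsub>M\<^esub> y \<in> (\<lambda>a. a \<odot>\<^bsub>M\<^esub> u) ` I"
    if xy: "x \<in> (\<lambda>a. a \<odot>\<^bsub>M\<^esub> u) ` I" "y \<in> (\<lambda>a. a \<odot>\<^bsub>M\<^esub> u) ` I" for x y
  proof -
    obtain a b where ab: "a \<in> I" "b \<in> I" "x = a \<odot>\<^bsub>M\<^esub> u" "y = b \<odot>\<^bsub>M\<^esub> u" using xy by auto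
    moreover have "a \<in> carrier R" "b \<in> carrier R" using ab IR by auto
    ultimately have "x \<oplus>\<^bsub>M\<^esub> y = (a \<oplus> b) \<odot>\<^bsub>M\<^esub> u" using u smult_l_distr[of a b u] by simp
    then show ?thesis using ab ideal_add[OF I] by blast
  qed
  show "r \<odot>\<^bsub>M\<^esub> x \<in> (\<lambda>a. a \<odot>\<^bsub>M\<^esub> u) ` I"
    if r: "r \<in> carrier R" and x: "x \<in> (\<lambda>a. a \<odot>\<^bsub>M\<^esub> u) ` I" for r x
  proof -
    obtain a where a: "a \<in> I" "x = a \<odot>\<^bsub>M\<^esub> u" using x by auto
    then have "r \<odot>\<^bsub>M\<^esub> x = (r \<otimes> a) \<odot>\<^bsub>M\<^esub> u" using IR u r smult_assoc1[of r a u] by auto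
    then show ?thesis using a r ideal_lmult[OF I] by blast
  qed
qed

lemma submodule_ideal_mult:
  assumes "I \<subseteq> carrier R" "N \<subseteq> carrier M"
  shows "submodule (ideal_mult R M I N) R M"
  unfolding ideal_mult_def by (rule module_span_submodule) (use assms in auto)

lemma ideal_mult_least:
  assumes "submodule L R M" "\<And>a x. a \<in> I \<Longrightarrow> x \<in> N \<Longrightarrow> a \<odot>\<^bsub>M\<^esub> x \<in> L"
  shows "ideal_mult R M I N \<subseteq> L"
  unfolding ideal_mult_def by (rule module_span_least) (use assms in auto)

lemma ideal_mult_mem: "a \<in> I \<Longrightarrow> x \<in> N \<Longrightarrow> a \<odot>\<^bsub>M\<^esub> x \<in> ideal_mult R M I N"
  unfolding ideal_mult_def by (rule subsetD[OF module_span_incl]) auto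

lemma set_add_mono: "N \<subseteq> N' \<Longrightarrow> K \<subseteq> K' \<Longrightarrow> N <+>\<^bsub>M\<^esub> K \<subseteq> N' <+>\<^bsub>M\<^esub> K'"
  by (auto simp: set_add_def')

lemma line_least: "submodule N R M \<Longrightarrow> u \<in> N \<Longrightarrow> line R M u \<subseteq> N"
  unfolding line_def using submodule_smult by auto

end

section \<open>Associated primes, Nakayama's lemma and common multipliers\<close>

context noetherian_module begin

lemma maximal_submodule_pred:
  assumes "submodule N R M" "Q N"
  shows "\<exists>K. submodule K R M \<and> Q K \<and> (\<forall>L. submodule L R M \<longrightarrow> Q L \<longrightarrow> K \<subseteq> L \<longrightarrow> L = K)"
proof -
  have "N \<in> {K. submodule K R M \<and> Q K}" using assms by simp
  then obtain K where K: "K \<in> {K. submodule K R M \<and> Q K}" "\<And>L. L \<in> {K. submodule K R M \<and> Q K} \<Longrightarrow> \<not> K \<subset> L"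
    by (rule maximal_submodule) auto
  show ?thesis using K by (intro exI[of _ K]) (auto simp: psubset_eq)
qed

text \<open>If \<open>ab\<close> kills the class of \<open>u\<close> and \<open>a\<close> does not,
  then \<open>au\<close> is a nonzero class whose annihilator contains that of \<open>u\<close>. By
  maximality the two agree, and \<open>b\<close> kills \<open>au\<close>.\<close>

lemma max_colon_prime:
  assumes N: "submodule N R M" and u: "max_colon R M N u"
  shows "primeideal (colon R M N u) R"
proof (rule R.primeidealI_cring)
  have uM: "u \<in> carrier M" "u \<notin> N" using u by (auto simp: max_colon_def)
  show "ideal (colon R M N u) R" by (rule colon_ideal[OF N uM(1)])
  show "\<one> \<notin> colon R M N u" using uM by (simp add: colon_def)
  show "b \<in> colon R M N u"
    if ab: "a \<in> carrier R" "b \<in> carrier R" "a \<otimes> b \<in> colon R M N u" and a: "a \<notin> colon R M N u" for a b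
  proof -
    have au: "a \<odot>\<^bsub>M\<^esub> u \<in> carrier M - N" using ab a uM by (simp add: colon_def)
    have "colon R M N u \<subseteq> colon R M N (a \<odot>\<^bsub>M\<^esub> u)"
    proof
      fix x assume "x \<in> colon R M N u"
      then show "x \<in> colon R M N (a \<odot>\<^bsub>M\<^esub> u)"
        using uM(1) ab(1) submodule_smult[OF N ab(1)] by (simp add: colon_def smult_commute[of x a])
    qed
    then have "colon R M N u = colon R M N (a \<odot>\<^bsub>M\<^esub> u)"
      using u au by (auto simp: max_colon_def)
    moreover have "b \<in> colon R M N (a \<odot>\<^bsub>M\<^esub> u)"
      using ab uM by (simp add: colon_def smult_commute[of b a] smult_assoc1)
    ultimately show ?thesis by simp
  qed
qed

lemma max_colon_exists:
  assumes N: "submodule N R M" and u: "u \<in> carrier M - N"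
  obtains v where "max_colon R M N v" "colon R M N u \<subseteq> colon R M N v"
proof -
  let ?F = "{colon R M N v | v. v \<in> carrier M - N \<and> colon R M N u \<subseteq> colon R M N v}"
  have "colon R M N u \<in> ?F" using u by blast
  then obtain J where J: "J \<in> ?F"
      "\<And>y. (y, J) \<in> {(I, J). ideal I R \<and> ideal J R \<and> J \<subset> I} \<Longrightarrow> y \<notin> ?F"
    by (rule wfE_min[OF noetherian_ring.wf_ideals[OF noetherian]]) blast
  obtain v where v: "v \<in> carrier M - N" "colon R M N u \<subseteq> colon R M N v" "J = colon R M N v"
    using J(1) by blast
  have "\<not> colon R M N v \<subset> colon R M N w" if w: "w \<in> carrier M - N" for w
  proof
    assume lt: "colon R M N v \<subset> colon R M N w"
    then have "colon R M N w \<notin> ?F" using J(2)[of "colon R M N w"] v w colon_ideal[OF N] by auto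
    then show False using w v(2) lt by blast
  qed
  then show thesis using that v unfolding max_colon_def by blast
qed

text \<open>Finitely many elements \<open>G\<close> with maximal colon already span a submodule
  \<open>K\<close> that contains all such elements. A multiplier that kills \<open>G\<close> modulo
  \<open>N\<close> kills \<open>K\<close>, so the prime colon of any such \<open>u\<close> contains
  the intersection of the colons of \<open>G\<close>, hence one of them, and equals it by
  maximality.\<close>

lemma finite_max_colons:
  assumes N: "submodule N R M"
  shows "finite {colon R M N u | u. max_colon R M N u}"
proof -
  let ?U = "{u. max_colon R M N u}"
  define Q where "Q K \<longleftrightarrow> (\<exists>G. finite G \<and> G \<subseteq> ?U \<and> K = module_span R M G)" for K
  have U: "?U \<subseteq> carrier M" by (auto simp: max_colon_def)
  have "submodule (module_span R M {}) R M" by (rule module_span_submodule) auto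
  moreover have "Q (module_span R M {})" unfolding Q_def by auto
  ultimately obtain K where K: "Q K" "\<And>L. submodule L R M \<Longrightarrow> Q L \<Longrightarrow> K \<subseteq> L \<Longrightarrow> L = K"
    using maximal_submodule_pred[of "module_span R M {}" Q] by auto
  obtain G where G: "finite G" "G \<subseteq> ?U" "K = module_span R M G" using K(1) unfolding Q_def by auto
  have "colon R M N u \<in> colon R M N ` G" if u: "max_colon R M N u" for u
  proof -
    have P: "primeideal (colon R M N u) R" by (rule max_colon_prime[OF N u])
    have iU: "insert u G \<subseteq> ?U" using G u by auto
    have "Q (module_span R M (insert u G))"
      unfolding Q_def using G(1) iU by (intro exI[of _ "insert u G"]) auto
    moreover have sub: "submodule (module_span R M (insert u G)) R M"
      using iU U by (intro module_span_submodule) auto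
    moreover have "K \<subseteq> module_span R M (insert u G)"
      unfolding G(3) using module_span_incl[of "insert u G"] by (intro module_span_least[OF sub]) auto
    ultimately have "module_span R M (insert u G) = K" using K(2) by blast
    then have uK: "u \<in> K" using module_span_incl[of "insert u G"] by auto
    have "\<exists>g\<in>G. colon R M N g \<subseteq> colon R M N u"
    proof (rule ccontr)
      assume neg: "\<not> ?thesis"
      have "\<exists>c\<in>carrier R. c \<notin> colon R M N u \<and> (\<forall>Q\<in>colon R M N ` G. c \<in> Q)"
      proof (rule R.prime_finite_Int[OF P])
        show "finite (colon R M N ` G)" using G by simp
        show "ideal Q R" if "Q \<in> colon R M N ` G" for Q using that G U colon_ideal[OF N] by blast
        show "\<not> Q \<subseteq> colon R M N u" if "Q \<in> colon R M N ` G" for Q using that neg by blast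
      qed
      then obtain c where c: "c \<in> carrier R" "c \<notin> colon R M N u" "\<forall>g\<in>G. c \<in> colon R M N g" by auto
      have "K \<subseteq> {m \<in> carrier M. c \<odot>\<^bsub>M\<^esub> m \<in> N}"
        unfolding G(3) using c(3) G(2) U
        by (intro module_span_least[OF submodule_preimage[OF N c(1)]]) (auto simp: colon_def)
      then show False using uK c by (auto simp: colon_def)
    qed
    then obtain g where g: "g \<in> G" "colon R M N g \<subseteq> colon R M N u" by auto
    then have "max_colon R M N g" using G by auto
    then have "colon R M N g = colon R M N u" using g u unfolding max_colon_def by auto
    then show ?thesis using g by auto
  qed
  then have "{colon R M N u | u. max_colon R M N u} \<subseteq> colon R M N ` G" by blast
  then show ?thesis using G(1) finite_surj by blast
qed

text \<open>Every zerodivisor on \<open>M/N\<close> lies in one of the finitely many maximal colons,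
  so prime avoidance applies. A finite family of quotients is treated together because
  \<open>killed_transfer\<close> looks for one element that is a nonzerodivisor on several of them
  at once.\<close>

lemma common_zero_divisor:
  assumes I: "ideal I R" and fin: "finite \<N>" and sub: "\<And>N. N \<in> \<N> \<Longrightarrow> submodule N R M"
    and zd: "\<And>a. a \<in> I \<Longrightarrow> \<exists>N\<in>\<N>. \<not> nzd M N a"
  shows "\<exists>N\<in>\<N>. \<exists>u\<in>carrier M - N. I \<subseteq> colon R M N u"
proof (rule ccontr)
  assume neg: "\<not> ?thesis"
  let ?F = "\<Union>N\<in>\<N>. {colon R M N u | u. max_colon R M N u}"
  have "\<exists>a\<in>I. \<forall>P\<in>?F. a \<notin> P"
  proof (rule R.prime_avoidance[OF I])
    show "finite ?F" using fin sub finite_max_colons by blast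
    show "primeideal P R" if "P \<in> ?F" for P using that sub max_colon_prime by blast
    show "\<not> I \<subseteq> P" if "P \<in> ?F" for P using that neg by (auto simp: max_colon_def)
  qed
  then obtain a where a: "a \<in> I" "\<forall>P\<in>?F. a \<notin> P" by blast
  have aR: "a \<in> carrier R" using a I ideal_subset by blast
  obtain N where N: "N \<in> \<N>" "\<not> nzd M N a" using zd[OF a(1)] by blast
  then obtain u where u: "u \<in> carrier M - N" "a \<odot>\<^bsub>M\<^esub> u \<in> N" unfolding nzd_def by auto
  obtain v where v: "max_colon R M N v" "colon R M N u \<subseteq> colon R M N v"
    using max_colon_exists[OF sub[OF N(1)] u(1)] .
  have "a \<in> colon R M N v" using u aR v(2) by (auto simp: colon_def)
  then show False using a(2) v(1) N(1) by blast
qed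

text \<open>Instead of the determinant trick: a maximal \<open>K\<close> that violates the conclusion satisfies it after
  adding one element \<open>u\<close>, and the hypothesis then makes a multiple of \<open>u\<close> fall into \<open>K\<close>.\<close>

lemma Nakayama_prime:
  assumes P: "primeideal P R" and N0: "submodule N0 R M" and N: "submodule N R M"
    and s: "s \<in> carrier R" "s \<notin> P" and le: "\<And>x. x \<in> N \<Longrightarrow> s \<odot>\<^bsub>M\<^esub> x \<in> N0 <+>\<^bsub>M\<^esub> ideal_mult R M P N"
  shows "\<exists>t\<in>carrier R - P. \<forall>x\<in>N. t \<odot>\<^bsub>M\<^esub> x \<in> N0"
proof (rule ccontr)
  assume neg: "\<not> ?thesis"
  define Q where "Q K \<longleftrightarrow> N0 \<subseteq> K \<and> \<not> (\<exists>t\<in>carrier R - P. \<forall>x\<in>N. t \<odot>\<^bsub>M\<^esub> x \<in> K)" for K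
  have "Q N0" unfolding Q_def using neg by blast
  then obtain K where K: "submodule K R M" "Q K" "\<And>L. submodule L R M \<Longrightarrow> Q L \<Longrightarrow> K \<subseteq> L \<Longrightarrow> L = K"
    using maximal_submodule_pred[of N0 Q, OF N0] by auto
  have Ks: "submodule K R M" "N0 \<subseteq> K" using K(1,2) unfolding Q_def by auto
  have Kneg: "\<not> (\<exists>t\<in>carrier R - P. \<forall>x\<in>N. t \<odot>\<^bsub>M\<^esub> x \<in> K)" using K(2) unfolding Q_def by blast
  have Pid: "ideal P R" and PR: "P \<subseteq> carrier R" using prime_ideal[OF P] prime_subset[OF P] by auto
  have NM: "N \<subseteq> carrier M" using submodule_subset[OF N] .
  have "\<not> N \<subseteq> K"
  proof
    assume "N \<subseteq> K"
    then have "\<forall>x\<in>N. \<one> \<odot>\<^bsub>M\<^esub> x \<in> K" using NM smult_one by (metis subsetD)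
    then show False using Kneg prime_one[OF P] by blast
  qed
  then obtain u where u: "u \<in> N" "u \<notin> K" by auto
  have uM: "u \<in> carrier M" using u NM by auto
  let ?L = "K <+>\<^bsub>M\<^esub> line R M u"
  have Ls: "submodule ?L R M" "K \<subseteq> ?L" "u \<in> ?L"
    using submodule_set_add[OF Ks(1) submodule_line[OF uM]] set_add_upper1[OF Ks(1) submodule_line[OF uM]]
      set_add_upper2[OF Ks(1) submodule_line[OF uM]] line_self[OF uM] by auto
  then have "\<not> Q ?L" using K(3)[OF Ls(1) _ Ls(2)] u(2) by auto
  then obtain t where t: "t \<in> carrier R" "t \<notin> P" "\<And>x. x \<in> N \<Longrightarrow> t \<odot>\<^bsub>M\<^esub> x \<in> ?L"
    unfolding Q_def using Ls(2) Ks(2) by auto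
  let ?D = "K <+>\<^bsub>M\<^esub> (\<lambda>a. a \<odot>\<^bsub>M\<^esub> u) ` P"
  have Pu: "submodule ((\<lambda>a. a \<odot>\<^bsub>M\<^esub> u) ` P) R M" by (rule submodule_ideal_image[OF Pid uM])
  have D: "submodule ?D R M" "K \<subseteq> ?D"
    using submodule_set_add[OF Ks(1) Pu] set_add_upper1[OF Ks(1) Pu] by auto
  have "t \<odot>\<^bsub>M\<^esub> (a \<odot>\<^bsub>M\<^esub> x) \<in> ?D" if a: "a \<in> P" and x: "x \<in> N" for a x
  proof -
    have aR: "a \<in> carrier R" and xM: "x \<in> carrier M" using a x PR NM by auto
    obtain k b where kb: "k \<in> K" "b \<in> carrier R" "t \<odot>\<^bsub>M\<^esub> x = k \<oplus>\<^bsub>M\<^esub> b \<odot>\<^bsub>M\<^esub> u"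
      using t(3)[OF x] unfolding mem_set_add_iff line_def by auto
    have kM: "k \<in> carrier M" using kb submodule_carr[OF Ks(1)] by auto
    have "t \<odot>\<^bsub>M\<^esub> (a \<odot>\<^bsub>M\<^esub> x) = a \<odot>\<^bsub>M\<^esub> (k \<oplus>\<^bsub>M\<^esub> b \<odot>\<^bsub>M\<^esub> u)"
      using smult_commute[OF t(1) aR xM] kb(3) by simp
    also have "\<dots> = a \<odot>\<^bsub>M\<^esub> k \<oplus>\<^bsub>M\<^esub> (a \<otimes> b) \<odot>\<^bsub>M\<^esub> u"
      using aR kM kb uM by (simp add: smult_r_distr smult_assoc1)
    finally have eq: "t \<odot>\<^bsub>M\<^esub> (a \<odot>\<^bsub>M\<^esub> x) = a \<odot>\<^bsub>M\<^esub> k \<oplus>\<^bsub>M\<^esub> (a \<otimes> b) \<odot>\<^bsub>M\<^esub> u" .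
    have "a \<odot>\<^bsub>M\<^esub> k \<in> K" "a \<otimes> b \<in> P"
      using submodule_smult[OF Ks(1) aR kb(1)] ideal_rmult[OF Pid a kb(2)] by auto
    then show ?thesis unfolding mem_set_add_iff eq by blast
  qed
  then have "ideal_mult R M P N \<subseteq> {m \<in> carrier M. t \<odot>\<^bsub>M\<^esub> m \<in> ?D}"
    using PR NM by (intro ideal_mult_least submodule_preimage D t(1)) auto
  moreover have "N0 \<subseteq> {m \<in> carrier M. t \<odot>\<^bsub>M\<^esub> m \<in> ?D}"
    using Ks D(2) t(1) submodule_carr[OF N0] submodule_smult[OF Ks(1) t(1)] by blast
  ultimately have "N0 <+>\<^bsub>M\<^esub> ideal_mult R M P N \<subseteq> {m \<in> carrier M. t \<odot>\<^bsub>M\<^esub> m \<in> ?D}"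
    by (intro set_add_least submodule_preimage D t(1))
  then have "t \<odot>\<^bsub>M\<^esub> (s \<odot>\<^bsub>M\<^esub> u) \<in> ?D" using le[OF u(1)] by blast
  then obtain k p where kp: "k \<in> K" "p \<in> P" "t \<odot>\<^bsub>M\<^esub> (s \<odot>\<^bsub>M\<^esub> u) = k \<oplus>\<^bsub>M\<^esub> p \<odot>\<^bsub>M\<^esub> u"
    unfolding mem_set_add_iff by auto
  have pR: "p \<in> carrier R" and kM: "k \<in> carrier M" using kp PR submodule_carr[OF Ks(1)] by auto
  \<comment> \<open>Read off from \<open>tsu = k + pu\<close>: the element \<open>ts - p\<close>
    sends \<open>u\<close> into \<open>K\<close>, and it lies outside \<open>P\<close> because
    \<open>ts\<close> does and \<open>p\<close> does not.\<close>
  define r where "r = t \<otimes> s \<oplus> \<ominus> p"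
  have rR: "r \<in> carrier R" using t s pR by (simp add: r_def)
  have "r \<notin> P"
  proof
    assume "r \<in> P"
    then have "r \<oplus> p \<in> P" using kp(2) ideal_add[OF Pid] by auto
    moreover have "r \<oplus> p = t \<otimes> s" using t s pR by (simp add: r_def R.a_assoc R.l_neg)
    ultimately show False using prime_mult[OF P t(1) s(1)] t s by auto
  qed
  have "r \<odot>\<^bsub>M\<^esub> u = t \<odot>\<^bsub>M\<^esub> (s \<odot>\<^bsub>M\<^esub> u) \<oplus>\<^bsub>M\<^esub> \<ominus>\<^bsub>M\<^esub> (p \<odot>\<^bsub>M\<^esub> u)"
    using t s pR uM by (simp add: r_def smult_l_distr smult_l_minus smult_assoc1)
  also have "\<dots> = k" unfolding kp(3) using kM pR uM by (simp add: M.a_assoc M.r_neg)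
  finally have ru: "r \<odot>\<^bsub>M\<^esub> u \<in> K" using kp by simp
  \<comment> \<open>The multiplier \<open>t\<close> brings \<open>N\<close> into
    \<open>K + Ru\<close>, and \<open>r\<close> then brings \<open>u\<close> into \<open>K\<close>;
    so \<open>rt\<close> is a multiplier of the kind that \<open>K\<close> was chosen not to
    have.\<close>
  have "(r \<otimes> t) \<odot>\<^bsub>M\<^esub> x \<in> K" if x: "x \<in> N" for x
  proof -
    obtain k b where kb: "k \<in> K" "b \<in> carrier R" "t \<odot>\<^bsub>M\<^esub> x = k \<oplus>\<^bsub>M\<^esub> b \<odot>\<^bsub>M\<^esub> u"
      using t(3)[OF x] unfolding mem_set_add_iff line_def by auto
    have kM: "k \<in> carrier M" "x \<in> carrier M" using kb x NM submodule_carr[OF Ks(1)] by auto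
    have "(r \<otimes> t) \<odot>\<^bsub>M\<^esub> x = r \<odot>\<^bsub>M\<^esub> k \<oplus>\<^bsub>M\<^esub> b \<odot>\<^bsub>M\<^esub> (r \<odot>\<^bsub>M\<^esub> u)"
      using rR t(1) kM kb(2) uM by (simp add: smult_assoc1 kb(3) smult_r_distr smult_commute[of b r])
    then show ?thesis
      using submodule_add[OF Ks(1)] submodule_smult[OF Ks(1)] rR kb ru by simp
  qed
  moreover have "r \<otimes> t \<in> carrier R - P" using prime_mult[OF P rR t(1)] \<open>r \<notin> P\<close> t rR by auto
  ultimately show False using Kneg by blast
qed

text \<open>A maximal submodule of \<open>N\<close> with a common multiplier \<open>s\<close> must
  be \<open>N\<close>: if \<open>u\<close> needs \<open>t\<close>, then \<open>st\<close> works
  after adjoining \<open>u\<close>. This turns elementwise statements about a localization into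
  statements with a single denominator.\<close>

lemma uniform_multiplier:
  assumes N0: "submodule N0 R M" and N: "submodule N R M"
    and S: "S \<subseteq> carrier R" "\<one> \<in> S" "\<And>s t. s \<in> S \<Longrightarrow> t \<in> S \<Longrightarrow> s \<otimes> t \<in> S"
    and ex: "\<And>x. x \<in> N \<Longrightarrow> \<exists>s\<in>S. s \<odot>\<^bsub>M\<^esub> x \<in> N0"
  shows "\<exists>s\<in>S. \<forall>x\<in>N. s \<odot>\<^bsub>M\<^esub> x \<in> N0"
proof -
  define Q where "Q K \<longleftrightarrow> K \<subseteq> N \<and> (\<exists>s\<in>S. \<forall>x\<in>K. s \<odot>\<^bsub>M\<^esub> x \<in> N0)" for K
  have "\<forall>x\<in>{\<zero>\<^bsub>M\<^esub>}. \<one> \<odot>\<^bsub>M\<^esub> x \<in> N0" using submodule_zero[OF N0] by simp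
  then have "Q {\<zero>\<^bsub>M\<^esub>}" unfolding Q_def using submodule_zero[OF N] S(2) by blast
  then obtain K where K: "submodule K R M" "Q K" "\<And>L. submodule L R M \<Longrightarrow> Q L \<Longrightarrow> K \<subseteq> L \<Longrightarrow> L = K"
    using maximal_submodule_pred[of "{\<zero>\<^bsub>M\<^esub>}" Q, OF zero_submodule] by auto
  have Ks: "submodule K R M" "K \<subseteq> N" using K(1,2) unfolding Q_def by auto
  obtain s where s: "s \<in> S" "\<forall>x\<in>K. s \<odot>\<^bsub>M\<^esub> x \<in> N0" using K(2) unfolding Q_def by blast
  have "u \<in> K" if u: "u \<in> N" for u
  proof -
    have uM: "u \<in> carrier M" using u submodule_carr[OF N] by auto
    obtain t where t: "t \<in> S" "t \<odot>\<^bsub>M\<^esub> u \<in> N0" using ex[OF u] by auto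
    have st: "s \<in> carrier R" "t \<in> carrier R" "s \<otimes> t \<in> S" using s t S by auto
    let ?L = "K <+>\<^bsub>M\<^esub> line R M u"
    have sub: "submodule {m \<in> carrier M. (s \<otimes> t) \<odot>\<^bsub>M\<^esub> m \<in> N0} R M"
      using st by (intro submodule_preimage N0) auto
    have "u \<in> {m \<in> carrier M. (s \<otimes> t) \<odot>\<^bsub>M\<^esub> m \<in> N0}"
      using submodule_smult[OF N0 st(1) t(2)] uM st by (simp add: smult_assoc1)
    moreover have "k \<in> {m \<in> carrier M. (s \<otimes> t) \<odot>\<^bsub>M\<^esub> m \<in> N0}" if "k \<in> K" for k
      using submodule_smult[OF N0 st(2), of "s \<odot>\<^bsub>M\<^esub> k"] s(2) that submodule_carr[OF Ks(1) that] st
      by (simp add: smult_assoc1 smult_commute[of s t])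
    ultimately have "?L \<subseteq> {m \<in> carrier M. (s \<otimes> t) \<odot>\<^bsub>M\<^esub> m \<in> N0}"
      by (intro set_add_least[OF sub] line_least[OF sub]) auto
    moreover have "?L \<subseteq> N" using Ks(2) line_least[OF N u] by (intro set_add_least[OF N])
    ultimately have Q: "Q ?L" unfolding Q_def using st(3) by blast
    have "K \<subseteq> ?L" "u \<in> ?L" using set_add_upper1[OF Ks(1) submodule_line[OF uM]]
      set_add_upper2[OF Ks(1) submodule_line[OF uM]] line_self[OF uM] by auto
    then show ?thesis using K(3)[OF submodule_set_add[OF Ks(1) submodule_line[OF uM]] Q] by auto
  qed
  then show ?thesis using s by blast
qed

end

section \<open>Regular sequences and Rees' theorem\<close>

primrec quot_by :: "('a, 'b, 'm) module_scheme \<Rightarrow> 'b set \<Rightarrow> 'a list \<Rightarrow> 'b set" where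
  "quot_by M N [] = N"
| "quot_by M N (x # xs) = quot_by M (N <+>\<^bsub>M\<^esub> mult_image M x) xs"

text \<open>Weak regularity: the last quotient may be zero. Lists can therefore be split and
  permuted freely, and nonvanishing comes from Nakayama's lemma or from
  \<open>ideal_smult R I M \<noteq> carrier M\<close>.\<close>

primrec regular :: "('a, 'b, 'm) module_scheme \<Rightarrow> 'b set \<Rightarrow> 'a list \<Rightarrow> bool" where
  "regular M N [] \<longleftrightarrow> True"
| "regular M N (x # xs) \<longleftrightarrow> nzd M N x \<and> regular M (N <+>\<^bsub>M\<^esub> mult_image M x) xs"

text \<open>In other words \<open>Hom(R/I, M/N)\<close> is nonzero. Over a Noetherian module this is
  the exact opposite of \<open>I\<close> containing a nonzerodivisor on \<open>M/N\<close>.\<close>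

definition killed :: "('a, 'r) ring_scheme \<Rightarrow> ('a, 'b, 'm) module_scheme \<Rightarrow> 'b set \<Rightarrow> 'a set \<Rightarrow> bool"
  where "killed R M N I \<longleftrightarrow> (\<exists>u\<in>carrier M - N. I \<subseteq> colon R M N u)"

lemma quot_by_append [simp]: "quot_by M N (xs @ ys) = quot_by M (quot_by M N xs) ys"
  by (induction xs arbitrary: N) auto

lemma regular_append [simp]:
  "regular M N (xs @ ys) \<longleftrightarrow> regular M N xs \<and> regular M (quot_by M N xs) ys"
  by (induction xs arbitrary: N) auto

lemma regular_nth:
  assumes "regular M N xs" "i < length xs"
  shows "nzd M (quot_by M N (take i xs)) (xs ! i)"
proof -
  have "regular M N (take i xs @ xs ! i # drop (Suc i) xs)"
    using assms by (simp flip: id_take_nth_drop)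
  then show ?thesis by simp
qed

lemma regular_take: "regular M N xs \<Longrightarrow> regular M N (take i xs)"
  by (metis append_take_drop_id regular_append)

section \<open>Exchanging and permuting regular elements\<close>

context module begin

lemma mem_adj_iff: "y \<in> N <+>\<^bsub>M\<^esub> mult_image M x \<longleftrightarrow> (\<exists>n\<in>N. \<exists>m\<in>carrier M. y = n \<oplus>\<^bsub>M\<^esub> x \<odot>\<^bsub>M\<^esub> m)"
  by (auto simp: mem_set_add_iff mult_image_def)

lemma submodule_adj: "submodule N R M \<Longrightarrow> x \<in> carrier R \<Longrightarrow> submodule (N <+>\<^bsub>M\<^esub> mult_image M x) R M"
  by (intro submodule_set_add submodule_mult_image)

lemma adj_upper: "submodule N R M \<Longrightarrow> x \<in> carrier R \<Longrightarrow> N \<subseteq> N <+>\<^bsub>M\<^esub> mult_image M x"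
  by (intro set_add_upper1 submodule_mult_image)

lemma adj_upper2:
  "submodule N R M \<Longrightarrow> x \<in> carrier R \<Longrightarrow> m \<in> carrier M \<Longrightarrow> x \<odot>\<^bsub>M\<^esub> m \<in> N <+>\<^bsub>M\<^esub> mult_image M x"
  using set_add_upper2[OF _ submodule_mult_image, of N x] by (auto simp: mult_image_def)

lemma adj_least:
  assumes "submodule L R M" "N \<subseteq> L" "\<And>m. m \<in> carrier M \<Longrightarrow> x \<odot>\<^bsub>M\<^esub> m \<in> L"
  shows "N <+>\<^bsub>M\<^esub> mult_image M x \<subseteq> L"
  by (rule set_add_least[OF assms(1,2)]) (use assms(3) in \<open>auto simp: mult_image_def\<close>)

lemma adj_commute_subset:
  assumes N: "submodule N R M" and x: "x \<in> carrier R" and y: "y \<in> carrier R"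
  shows "N <+>\<^bsub>M\<^esub> mult_image M x <+>\<^bsub>M\<^esub> mult_image M y \<subseteq> N <+>\<^bsub>M\<^esub> mult_image M y <+>\<^bsub>M\<^esub> mult_image M x"
proof -
  let ?Ny = "N <+>\<^bsub>M\<^esub> mult_image M y"
  have Ny: "submodule ?Ny R M" by (rule submodule_adj[OF N y])
  have L: "submodule (?Ny <+>\<^bsub>M\<^esub> mult_image M x) R M" by (rule submodule_adj[OF Ny x])
  show ?thesis
  proof (rule adj_least[OF L adj_least[OF L]])
    show "N \<subseteq> ?Ny <+>\<^bsub>M\<^esub> mult_image M x" using adj_upper[OF N y] adj_upper[OF Ny x] by simp
    show "x \<odot>\<^bsub>M\<^esub> m \<in> ?Ny <+>\<^bsub>M\<^esub> mult_image M x" if "m \<in> carrier M" for m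
      using adj_upper2[OF Ny x that] .
    show "y \<odot>\<^bsub>M\<^esub> m \<in> ?Ny <+>\<^bsub>M\<^esub> mult_image M x" if "m \<in> carrier M" for m
      using adj_upper2[OF N y that] adj_upper[OF Ny x] by auto
  qed
qed

lemma adj_commute:
  "submodule N R M \<Longrightarrow> x \<in> carrier R \<Longrightarrow> y \<in> carrier R \<Longrightarrow>
    N <+>\<^bsub>M\<^esub> mult_image M x <+>\<^bsub>M\<^esub> mult_image M y = N <+>\<^bsub>M\<^esub> mult_image M y <+>\<^bsub>M\<^esub> mult_image M x"
  using adj_commute_subset by (intro equalityI) simp_all

lemma quot_by_adj:
  "submodule N R M \<Longrightarrow> x \<in> carrier R \<Longrightarrow> set xs \<subseteq> carrier R \<Longrightarrow>
    quot_by M (N <+>\<^bsub>M\<^esub> mult_image M x) xs = quot_by M N xs <+>\<^bsub>M\<^esub> mult_image M x"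
proof (induction xs arbitrary: N)
  case (Cons y ys)
  then show ?case using Cons.IH[OF submodule_adj[OF Cons.prems(1), of y]]
    by (simp add: adj_commute[OF Cons.prems(1), of x y])
qed simp

lemma submodule_quot_by: "submodule N R M \<Longrightarrow> set xs \<subseteq> carrier R \<Longrightarrow> submodule (quot_by M N xs) R M"
proof (induction xs arbitrary: N)
  case (Cons y ys)
  then show ?case using Cons.IH[OF submodule_adj[OF Cons.prems(1), of y]] by simp
qed simp

lemma quot_by_upper: "submodule N R M \<Longrightarrow> set xs \<subseteq> carrier R \<Longrightarrow> N \<subseteq> quot_by M N xs"
proof (induction xs arbitrary: N)
  case (Cons y ys)
  then show ?case using Cons.IH[OF submodule_adj[OF Cons.prems(1), of y]]
    adj_upper[OF Cons.prems(1), of y] by auto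
qed simp

lemma quot_by_least:
  "submodule L R M \<Longrightarrow> N \<subseteq> L \<Longrightarrow> (\<And>x m. x \<in> set xs \<Longrightarrow> m \<in> carrier M \<Longrightarrow> x \<odot>\<^bsub>M\<^esub> m \<in> L) \<Longrightarrow> quot_by M N xs \<subseteq> L"
proof (induction xs arbitrary: N)
  case (Cons y ys)
  show ?case unfolding quot_by.simps
    by (rule Cons.IH[OF Cons.prems(1) adj_least[OF Cons.prems(1,2)]]) (use Cons.prems(3) in auto)
qed simp

lemma quot_by_mem:
  "submodule N R M \<Longrightarrow> set xs \<subseteq> carrier R \<Longrightarrow> x \<in> set xs \<Longrightarrow> m \<in> carrier M \<Longrightarrow> x \<odot>\<^bsub>M\<^esub> m \<in> quot_by M N xs"
proof (induction xs arbitrary: N)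
  case (Cons y ys)
  then have sub: "submodule (N <+>\<^bsub>M\<^esub> mult_image M y) R M" using submodule_adj by simp
  show ?case
  proof (cases "x = y")
    case True
    then show ?thesis using adj_upper2[OF Cons.prems(1), of y m] Cons.prems quot_by_upper[OF sub, of ys] by auto
  next
    case False
    then show ?thesis using Cons.IH[OF sub] Cons.prems by simp
  qed
qed simp

lemma eq_add_imp_mem:
  assumes "submodule N R M" "n \<in> N" "n' \<in> N" "z \<in> carrier M" "z' \<in> carrier M"
    and "n \<oplus>\<^bsub>M\<^esub> z = n' \<oplus>\<^bsub>M\<^esub> z'"
  shows "z \<oplus>\<^bsub>M\<^esub> \<ominus>\<^bsub>M\<^esub> z' \<in> N"
proof -
  have nM: "n \<in> carrier M" "n' \<in> carrier M" using assms submodule_carr by auto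
  have "z \<oplus>\<^bsub>M\<^esub> \<ominus>\<^bsub>M\<^esub> z' = \<ominus>\<^bsub>M\<^esub> n \<oplus>\<^bsub>M\<^esub> (n \<oplus>\<^bsub>M\<^esub> z) \<oplus>\<^bsub>M\<^esub> \<ominus>\<^bsub>M\<^esub> z'"
    using nM assms(4) by (simp add: M.r_neg1)
  also have "\<dots> = \<ominus>\<^bsub>M\<^esub> n \<oplus>\<^bsub>M\<^esub> n'"
    unfolding assms(6) using nM assms(5) by (simp add: M.a_assoc M.r_neg)
  finally show ?thesis using assms(1-3) by (simp add: submodule_add submodule_neg)
qed

lemma mem_diff_imp_eq:
  assumes "z \<in> carrier M" "z' \<in> carrier M"
  shows "z = (z \<oplus>\<^bsub>M\<^esub> \<ominus>\<^bsub>M\<^esub> z') \<oplus>\<^bsub>M\<^esub> z'"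
  using assms by (simp add: M.a_assoc M.l_neg)

lemma smult_diff:
  assumes "a \<in> carrier R" "z \<in> carrier M" "z' \<in> carrier M"
  shows "a \<odot>\<^bsub>M\<^esub> (z \<oplus>\<^bsub>M\<^esub> \<ominus>\<^bsub>M\<^esub> z') = a \<odot>\<^bsub>M\<^esub> z \<oplus>\<^bsub>M\<^esub> \<ominus>\<^bsub>M\<^esub> (a \<odot>\<^bsub>M\<^esub> z')"
  using assms by (simp add: smult_r_distr smult_r_minus)

text \<open>Homologically, both sides say that \<open>Ext^1(R/I, M/N)\<close> is nonzero. By hand:
  if \<open>u\<close> is the witness for \<open>x\<close>, then \<open>yu\<close> lies in
  \<open>N + xM\<close>, and writing \<open>yu = n + xv\<close> makes \<open>v\<close> the witness
  for \<open>y\<close>.\<close>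

lemma killed_exchange:
  assumes N: "submodule N R M" and I: "ideal I R" and x: "x \<in> I" "nzd M N x" and y: "y \<in> I" "nzd M N y"
    and k: "killed R M (N <+>\<^bsub>M\<^esub> mult_image M x) I"
  shows "killed R M (N <+>\<^bsub>M\<^esub> mult_image M y) I"
proof -
  have IR: "I \<subseteq> carrier R" using ideal_subset[OF I] .
  have xR: "x \<in> carrier R" and yR: "y \<in> carrier R" using x y IR by auto
  obtain u where u: "u \<in> carrier M" "u \<notin> N <+>\<^bsub>M\<^esub> mult_image M x"
    and Iu: "I \<subseteq> colon R M (N <+>\<^bsub>M\<^esub> mult_image M x) u" using k unfolding killed_def by auto
  obtain n v where nv: "n \<in> N" "v \<in> carrier M" "y \<odot>\<^bsub>M\<^esub> u = n \<oplus>\<^bsub>M\<^esub> x \<odot>\<^bsub>M\<^esub> v"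
    using Iu y(1) by (auto simp: colon_def mem_adj_iff)
  have nM: "n \<in> carrier M" using nv submodule_carr[OF N] by auto
  \<comment> \<open>If \<open>v = n' + yw\<close>, then \<open>y(u - xw)\<close> lies in
    \<open>N\<close>; cancelling \<open>y\<close> puts \<open>u\<close> into
    \<open>N + xM\<close>.\<close>
  have "v \<notin> N <+>\<^bsub>M\<^esub> mult_image M y"
  proof
    assume "v \<in> N <+>\<^bsub>M\<^esub> mult_image M y"
    then obtain n' w where w: "n' \<in> N" "w \<in> carrier M" "v = n' \<oplus>\<^bsub>M\<^esub> y \<odot>\<^bsub>M\<^esub> w"
      by (auto simp: mem_adj_iff)
    have n'M: "n' \<in> carrier M" using w submodule_carr[OF N] by auto
    have "\<zero>\<^bsub>M\<^esub> \<oplus>\<^bsub>M\<^esub> y \<odot>\<^bsub>M\<^esub> u = (n \<oplus>\<^bsub>M\<^esub> x \<odot>\<^bsub>M\<^esub> n') \<oplus>\<^bsub>M\<^esub> y \<odot>\<^bsub>M\<^esub> (x \<odot>\<^bsub>M\<^esub> w)"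
      unfolding nv(3) w(3) using nM n'M w(2) xR yR by (simp add: smult_r_distr M.a_assoc smult_commute[of x y])
    then have "y \<odot>\<^bsub>M\<^esub> u \<oplus>\<^bsub>M\<^esub> \<ominus>\<^bsub>M\<^esub> (y \<odot>\<^bsub>M\<^esub> (x \<odot>\<^bsub>M\<^esub> w)) \<in> N"
      using nv(1) w(1,2) xR yR u(1) N nM n'M
      by (intro eq_add_imp_mem[OF N submodule_zero[OF N], of "n \<oplus>\<^bsub>M\<^esub> x \<odot>\<^bsub>M\<^esub> n'"])
        (auto intro: submodule_add submodule_smult)
    then have "y \<odot>\<^bsub>M\<^esub> (u \<oplus>\<^bsub>M\<^esub> \<ominus>\<^bsub>M\<^esub> (x \<odot>\<^bsub>M\<^esub> w)) \<in> N"
      using xR yR u(1) w(2) by (simp add: smult_diff)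
    then have "u \<oplus>\<^bsub>M\<^esub> \<ominus>\<^bsub>M\<^esub> (x \<odot>\<^bsub>M\<^esub> w) \<in> N"
      using y(2) xR u(1) w(2) unfolding nzd_def by simp
    then have "u \<in> N <+>\<^bsub>M\<^esub> mult_image M x"
      using mem_diff_imp_eq[of u "x \<odot>\<^bsub>M\<^esub> w"] u(1) w(2) xR unfolding mem_adj_iff by blast
    then show False using u by simp
  qed
  \<comment> \<open>With \<open>iu = n' + xw\<close>, computing \<open>iyu\<close> in two ways gives
    \<open>x(iv - yw)\<close> in \<open>N\<close>, and \<open>x\<close> cancels.\<close>
  moreover have "i \<in> colon R M (N <+>\<^bsub>M\<^esub> mult_image M y) v" if i: "i \<in> I" for i
  proof -
    have iR: "i \<in> carrier R" using i IR by auto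
    obtain n' w where w: "n' \<in> N" "w \<in> carrier M" "i \<odot>\<^bsub>M\<^esub> u = n' \<oplus>\<^bsub>M\<^esub> x \<odot>\<^bsub>M\<^esub> w"
      using Iu i by (auto simp: colon_def mem_adj_iff)
    have n'M: "n' \<in> carrier M" using w submodule_carr[OF N] by auto
    have "i \<odot>\<^bsub>M\<^esub> n \<oplus>\<^bsub>M\<^esub> x \<odot>\<^bsub>M\<^esub> (i \<odot>\<^bsub>M\<^esub> v) = i \<odot>\<^bsub>M\<^esub> (y \<odot>\<^bsub>M\<^esub> u)"
      unfolding nv(3) using nM nv(2) iR xR by (simp add: smult_r_distr smult_commute[of x i])
    also have "\<dots> = y \<odot>\<^bsub>M\<^esub> (i \<odot>\<^bsub>M\<^esub> u)" using iR yR u(1) by (rule smult_commute)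
    also have "\<dots> = y \<odot>\<^bsub>M\<^esub> n' \<oplus>\<^bsub>M\<^esub> x \<odot>\<^bsub>M\<^esub> (y \<odot>\<^bsub>M\<^esub> w)"
      unfolding w(3) using n'M w(2) xR yR by (simp add: smult_r_distr smult_commute[of x y])
    finally have "x \<odot>\<^bsub>M\<^esub> (i \<odot>\<^bsub>M\<^esub> v) \<oplus>\<^bsub>M\<^esub> \<ominus>\<^bsub>M\<^esub> (x \<odot>\<^bsub>M\<^esub> (y \<odot>\<^bsub>M\<^esub> w)) \<in> N"
      using submodule_smult[OF N iR nv(1)] submodule_smult[OF N yR w(1)] iR xR yR nv(2) w(2)
      by (intro eq_add_imp_mem[OF N]) auto
    then have "x \<odot>\<^bsub>M\<^esub> (i \<odot>\<^bsub>M\<^esub> v \<oplus>\<^bsub>M\<^esub> \<ominus>\<^bsub>M\<^esub> (y \<odot>\<^bsub>M\<^esub> w)) \<in> N"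
      using iR xR yR nv(2) w(2) by (simp add: smult_diff)
    then have "i \<odot>\<^bsub>M\<^esub> v \<oplus>\<^bsub>M\<^esub> \<ominus>\<^bsub>M\<^esub> (y \<odot>\<^bsub>M\<^esub> w) \<in> N"
      using x(2) iR yR nv(2) w(2) unfolding nzd_def by simp
    then have "i \<odot>\<^bsub>M\<^esub> v \<in> N <+>\<^bsub>M\<^esub> mult_image M y"
      using mem_diff_imp_eq[of "i \<odot>\<^bsub>M\<^esub> v" "y \<odot>\<^bsub>M\<^esub> w"] nv(2) w(2) yR iR unfolding mem_adj_iff by blast
    then show ?thesis using iR by (simp add: colon_def)
  qed
  ultimately show ?thesis using nv(2) unfolding killed_def by blast
qed

text \<open>The half of permutability that holds over every ring: from \<open>xu = n + zv\<close>,
  regularity of \<open>z\<close> modulo \<open>N + xM\<close> gives \<open>v = n' + xw\<close>, and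
  cancelling \<open>x\<close> gives \<open>u - zw\<close> in \<open>N\<close>.\<close>

lemma nzd_adj_swap:
  assumes N: "submodule N R M" and x: "x \<in> carrier R" "nzd M N x"
    and z: "z \<in> carrier R" "nzd M (N <+>\<^bsub>M\<^esub> mult_image M x) z"
  shows "nzd M (N <+>\<^bsub>M\<^esub> mult_image M z) x"
  unfolding nzd_def
proof (intro ballI impI)
  fix u assume u: "u \<in> carrier M" "x \<odot>\<^bsub>M\<^esub> u \<in> N <+>\<^bsub>M\<^esub> mult_image M z"
  then obtain n v where nv: "n \<in> N" "v \<in> carrier M" "x \<odot>\<^bsub>M\<^esub> u = n \<oplus>\<^bsub>M\<^esub> z \<odot>\<^bsub>M\<^esub> v"
    by (auto simp: mem_adj_iff)
  have nM: "n \<in> carrier M" using nv submodule_carr[OF N] by auto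
  have "z \<odot>\<^bsub>M\<^esub> v = \<ominus>\<^bsub>M\<^esub> n \<oplus>\<^bsub>M\<^esub> x \<odot>\<^bsub>M\<^esub> u"
    unfolding nv(3) using nM nv(2) z(1) by (simp add: M.r_neg1)
  then have "z \<odot>\<^bsub>M\<^esub> v \<in> N <+>\<^bsub>M\<^esub> mult_image M x"
    unfolding mem_adj_iff using nv(1) u(1) submodule_neg[OF N] by blast
  then have "v \<in> N <+>\<^bsub>M\<^esub> mult_image M x" using z(2) nv(2) unfolding nzd_def by blast
  then obtain n' w where w: "n' \<in> N" "w \<in> carrier M" "v = n' \<oplus>\<^bsub>M\<^esub> x \<odot>\<^bsub>M\<^esub> w"
    by (auto simp: mem_adj_iff)
  have n'M: "n' \<in> carrier M" using w submodule_carr[OF N] by auto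
  have "\<zero>\<^bsub>M\<^esub> \<oplus>\<^bsub>M\<^esub> x \<odot>\<^bsub>M\<^esub> u = (n \<oplus>\<^bsub>M\<^esub> z \<odot>\<^bsub>M\<^esub> n') \<oplus>\<^bsub>M\<^esub> x \<odot>\<^bsub>M\<^esub> (z \<odot>\<^bsub>M\<^esub> w)"
    unfolding nv(3) w(3) using nM n'M w(2) x(1) z(1) by (simp add: smult_r_distr M.a_assoc smult_commute[of z x])
  then have "x \<odot>\<^bsub>M\<^esub> u \<oplus>\<^bsub>M\<^esub> \<ominus>\<^bsub>M\<^esub> (x \<odot>\<^bsub>M\<^esub> (z \<odot>\<^bsub>M\<^esub> w)) \<in> N"
    using nv(1) w(1,2) x(1) z(1) u(1) N nM n'M
    by (intro eq_add_imp_mem[OF N submodule_zero[OF N], of "n \<oplus>\<^bsub>M\<^esub> z \<odot>\<^bsub>M\<^esub> n'"])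
      (auto intro: submodule_add submodule_smult)
  then have "x \<odot>\<^bsub>M\<^esub> (u \<oplus>\<^bsub>M\<^esub> \<ominus>\<^bsub>M\<^esub> (z \<odot>\<^bsub>M\<^esub> w)) \<in> N"
    using x(1) z(1) u(1) w(2) by (simp add: smult_diff)
  then have "u \<oplus>\<^bsub>M\<^esub> \<ominus>\<^bsub>M\<^esub> (z \<odot>\<^bsub>M\<^esub> w) \<in> N"
    using x(2) z(1) u(1) w(2) unfolding nzd_def by simp
  then show "u \<in> N <+>\<^bsub>M\<^esub> mult_image M z"
    using mem_diff_imp_eq[of u "z \<odot>\<^bsub>M\<^esub> w"] u(1) w(2) z(1) unfolding mem_adj_iff by blast
qed

text \<open>A \<open>z\<close> that is a nonzerodivisor at every stage is moved from the end of
  \<open>xs\<close> to its front, past one entry at a time.\<close>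

lemma regular_adj:
  "submodule N R M \<Longrightarrow> set xs \<subseteq> carrier R \<Longrightarrow> z \<in> carrier R \<Longrightarrow> regular M N xs \<Longrightarrow>
    (\<And>i. i \<le> length xs \<Longrightarrow> nzd M (quot_by M N (take i xs)) z) \<Longrightarrow>
    regular M (N <+>\<^bsub>M\<^esub> mult_image M z) xs"
proof (induction xs arbitrary: N)
  case (Cons x xs)
  have x: "x \<in> carrier R" "nzd M N x" using Cons.prems by auto
  have "nzd M (N <+>\<^bsub>M\<^esub> mult_image M x) z" using Cons.prems(5)[of 1] by simp
  then have "nzd M (N <+>\<^bsub>M\<^esub> mult_image M z) x"
    using nzd_adj_swap[OF Cons.prems(1) x Cons.prems(3)] by simp
  moreover have "regular M (N <+>\<^bsub>M\<^esub> mult_image M x <+>\<^bsub>M\<^esub> mult_image M z) xs"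
  proof (rule Cons.IH[OF submodule_adj[OF Cons.prems(1) x(1)]])
    show "nzd M (quot_by M (N <+>\<^bsub>M\<^esub> mult_image M x) (take i xs)) z" if "i \<le> length xs" for i
      using Cons.prems(5)[of "Suc i"] that by simp
  qed (use Cons.prems in auto)
  ultimately show ?case using adj_commute[OF Cons.prems(1) x(1) Cons.prems(3)] by simp
qed simp

lemma killed_no_nzd:
  assumes "killed R M N I" "a \<in> I" shows "\<not> nzd M N a"
  using assms by (auto simp: killed_def nzd_def colon_def)

end

section \<open>Rees' theorem\<close>

context noetherian_module begin

lemma nzd_exists:
  assumes "ideal I R" "submodule N R M" "\<not> killed R M N I"
  shows "\<exists>a\<in>I. nzd M N a"
  using common_zero_divisor[of I "{N}"] assms by (auto simp: killed_def)

text \<open>Two regular sequences in \<open>I\<close> are compared through a common last term \<open>z\<close>, which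
  is then moved to the front (Kaplansky's proof of Rees' theorem, without Ext).\<close>

lemma killed_transfer:
  assumes I: "ideal I R"
  shows "submodule N R M \<Longrightarrow> length xs = length ys \<Longrightarrow> set xs \<subseteq> I \<Longrightarrow> set ys \<subseteq> I \<Longrightarrow>
    regular M N xs \<Longrightarrow> regular M N ys \<Longrightarrow>
    killed R M (quot_by M N xs) I \<Longrightarrow> killed R M (quot_by M N ys) I"
proof (induction "length xs" arbitrary: N xs ys)
  case 0
  then show ?case by simp
next
  case (Suc n)
  note N = Suc.prems(1)
  have IR: "I \<subseteq> carrier R" using ideal_subset[OF I] .
  obtain xs' x where xs: "xs = xs' @ [x]" using Suc.hyps(2) by (cases xs rule: rev_cases) auto
  obtain ys' y where ys: "ys = ys' @ [y]" using Suc.hyps(2) Suc.prems(2) by (cases ys rule: rev_cases) auto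
  have len: "length xs' = n" "length ys' = n" using Suc.hyps(2) Suc.prems(2) xs ys by auto
  have R: "set xs' \<subseteq> carrier R" "set ys' \<subseteq> carrier R" using Suc.prems(3,4) IR xs ys by auto
  \<comment> \<open>These are the quotients by proper initial segments of both lists. In each of
    them the next entry of its list is a nonzerodivisor in \<open>I\<close>, so \<open>I\<close>
    kills no nonzero class there, and one \<open>z\<close> in \<open>I\<close> serves all of
    them.\<close>
  let ?fam = "(\<lambda>i. quot_by M N (take i xs)) ` {..n} \<union> (\<lambda>i. quot_by M N (take i ys)) ` {..n}"
  have "\<exists>z\<in>I. \<forall>K\<in>?fam. nzd M K z"
  proof (rule ccontr)
    assume neg: "\<not> ?thesis"
    have "\<exists>K\<in>?fam. \<exists>u\<in>carrier M - K. I \<subseteq> colon R M K u"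
    proof (rule common_zero_divisor[OF I])
      show "finite ?fam" by simp
      show "submodule K R M" if "K \<in> ?fam" for K
        using that Suc.prems(3,4) IR set_take_subset
        by (auto intro!: submodule_quot_by[OF N]) (blast dest: in_set_takeD)+
      show "\<exists>K\<in>?fam. \<not> nzd M K a" if "a \<in> I" for a using that neg by blast
    qed
    then obtain K where K: "K \<in> ?fam" "killed R M K I" unfolding killed_def by blast
    have "\<exists>a\<in>I. nzd M K a"
    proof -
      consider i where "i \<le> n" "K = quot_by M N (take i xs)" | i where "i \<le> n" "K = quot_by M N (take i ys)"
        using K(1) by auto
      then show ?thesis
      proof cases
        case 1
        then have "i < length xs" using Suc.hyps(2) by simp
        then show ?thesis using regular_nth[OF Suc.prems(5)] 1(2) nth_mem Suc.prems(3) by blast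
      next
        case 2
        then have "i < length ys" using Suc.hyps(2) Suc.prems(2) by simp
        then show ?thesis using regular_nth[OF Suc.prems(6)] 2(2) nth_mem Suc.prems(4) by blast
      qed
    qed
    then show False using killed_no_nzd[OF K(2)] by blast
  qed
  then obtain z where z: "z \<in> I" "\<And>K. K \<in> ?fam \<Longrightarrow> nzd M K z" by blast
  have zR: "z \<in> carrier R" using z IR by auto
  have zx: "nzd M (quot_by M N (take i xs')) z" if "i \<le> length xs'" for i
    using z(2)[of "quot_by M N (take i xs)"] that len xs by auto
  have zy: "nzd M (quot_by M N (take i ys')) z" if "i \<le> length ys'" for i
    using z(2)[of "quot_by M N (take i ys)"] that len ys by auto
  have rx: "regular M N xs'" "nzd M (quot_by M N xs') x" using Suc.prems(5) xs by auto
  have ry: "regular M N ys'" "nzd M (quot_by M N ys') y" using Suc.prems(6) ys by auto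
  have xI: "x \<in> I" "set xs' \<subseteq> I" and yI: "y \<in> I" "set ys' \<subseteq> I" using Suc.prems(3,4) xs ys by auto
  \<comment> \<open>The last entry \<open>x\<close> is exchanged for \<open>z\<close>, and
    \<open>z\<close> is moved to the front. The induction hypothesis compares the shorter lists over
    \<open>N + zM\<close>, and the same moves backwards lead to \<open>y\<close>.\<close>
  have "killed R M (quot_by M N xs' <+>\<^bsub>M\<^esub> mult_image M x) I" using Suc.prems(7) xs by simp
  then have "killed R M (quot_by M N xs' <+>\<^bsub>M\<^esub> mult_image M z) I"
    using killed_exchange[OF submodule_quot_by[OF N R(1)] I xI(1) rx(2) z(1)] zx[of n] len by simp
  then have "killed R M (quot_by M (N <+>\<^bsub>M\<^esub> mult_image M z) xs') I"
    using quot_by_adj[OF N zR R(1)] by simp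
  then have "killed R M (quot_by M (N <+>\<^bsub>M\<^esub> mult_image M z) ys') I"
    using Suc.hyps(1)[OF len(1)[symmetric] submodule_adj[OF N zR] _ xI(2) yI(2)
        regular_adj[OF N R(1) zR rx(1) zx] regular_adj[OF N R(2) zR ry(1) zy]] len by simp
  then have "killed R M (quot_by M N ys' <+>\<^bsub>M\<^esub> mult_image M z) I"
    using quot_by_adj[OF N zR R(2)] by simp
  then have "killed R M (quot_by M N ys' <+>\<^bsub>M\<^esub> mult_image M y) I"
    using killed_exchange[OF submodule_quot_by[OF N R(2)] I z(1) _ yI(1) ry(2)] zy[of n] len by simp
  then show ?case using ys by simp
qed

text \<open>If \<open>ys\<close> were longer, \<open>killed_transfer\<close> would make
  \<open>I\<close> kill a class modulo its initial segment of length \<open>length xs\<close>,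
  although the next entry of \<open>ys\<close> is a nonzerodivisor there.\<close>

lemma regular_length_le:
  assumes I: "ideal I R" and N: "submodule N R M" and xs: "set xs \<subseteq> I" "regular M N xs"
    and k: "killed R M (quot_by M N xs) I" and ys: "set ys \<subseteq> I" "regular M N ys"
  shows "length ys \<le> length xs"
proof (rule ccontr)
  assume "\<not> ?thesis"
  then have l: "length xs < length ys" by simp
  have "killed R M (quot_by M N (take (length xs) ys)) I"
    using l xs ys set_take_subset[of "length xs" ys]
    by (intro killed_transfer[OF I N _ xs(1) _ xs(2) _ k] regular_take[OF ys(2)]) auto
  moreover have "nzd M (quot_by M N (take (length xs) ys)) (ys ! length xs)"
    by (rule regular_nth[OF ys(2) l])
  ultimately show False using killed_no_nzd ys(1) l nth_mem by blast
qed

text \<open>The proper submodule \<open>L\<close> contains \<open>N\<close> and \<open>IM\<close>,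
  hence every submodule met on the way, so none of them is \<open>M\<close> and each nonzerodivisor
  enlarges \<open>N\<close> strictly. The ascending chain condition ends the process.\<close>

lemma regular_extend:
  assumes I: "ideal I R" and L: "submodule L R M" "L \<noteq> carrier M"
    and IL: "\<And>a m. a \<in> I \<Longrightarrow> m \<in> carrier M \<Longrightarrow> a \<odot>\<^bsub>M\<^esub> m \<in> L"
  shows "submodule N R M \<Longrightarrow> N \<subseteq> L \<Longrightarrow> \<exists>zs. set zs \<subseteq> I \<and> regular M N zs \<and> killed R M (quot_by M N zs) I"
proof (induction N rule: wf_induct_rule[OF wf_submodules])
  case (1 N)
  show ?case
  proof (cases "killed R M N I")
    case True
    then show ?thesis by (intro exI[of _ "[]"]) auto
  next
    case False
    then obtain a where a: "a \<in> I" "nzd M N a" using nzd_exists[OF I 1(2)] by auto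
    have aR: "a \<in> carrier R" using a ideal_subset[OF I] by auto
    let ?N = "N <+>\<^bsub>M\<^esub> mult_image M a"
    have sub: "submodule ?N R M" by (rule submodule_adj[OF 1(2) aR])
    have "N \<noteq> ?N"
    proof
      assume eq: "N = ?N"
      have "m \<in> N" if "m \<in> carrier M" for m
        using adj_upper2[OF 1(2) aR that] eq a(2) that unfolding nzd_def by auto
      then show False using 1(3) L submodule_subset by blast
    qed
    then have "(?N, N) \<in> {(K, L). submodule K R M \<and> submodule L R M \<and> L \<subset> K}"
      using sub 1(2) adj_upper[OF 1(2) aR] by auto
    moreover have "?N \<subseteq> L" by (rule adj_least[OF L(1) 1(3)]) (use IL a in auto)
    ultimately obtain zs where "set zs \<subseteq> I" "regular M ?N zs" "killed R M (quot_by M ?N zs) I"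
      using 1(1) sub by blast
    then show ?thesis using a by (intro exI[of _ "a # zs"]) auto
  qed
qed

end

section \<open>Chains of primes\<close>

text \<open>The number counts strict inclusions, from \<open>Q\<close> at the bottom to
  \<open>P\<close> at the top. Keeping both ends as arguments is what concatenation at a common
  prime needs.\<close>

inductive prime_chain :: "('a, 'r) ring_scheme \<Rightarrow> nat \<Rightarrow> 'a set \<Rightarrow> 'a set \<Rightarrow> bool" for R where
  refl: "primeideal P R \<Longrightarrow> prime_chain R 0 P P"
| step: "primeideal Q R \<Longrightarrow> Q \<subset> Q' \<Longrightarrow> prime_chain R n Q' P \<Longrightarrow> prime_chain R (Suc n) Q P"

lemma prime_chain_facts:
  "prime_chain R n Q P \<Longrightarrow> primeideal Q R \<and> primeideal P R \<and> Q \<subseteq> P"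
  by (induction rule: prime_chain.induct) auto

lemma prime_chain_trans:
  "prime_chain R n Q P' \<Longrightarrow> prime_chain R k P' P \<Longrightarrow> prime_chain R (n + k) Q P"
  by (induction rule: prime_chain.induct) (auto intro: prime_chain.step)

lemma prime_chain_le:
  assumes "primeideal Q R" "primeideal P R" "Q \<subseteq> P"
  shows "\<exists>k. prime_chain R k Q P"
proof (cases "Q = P")
  case True then show ?thesis using assms prime_chain.refl by blast
next
  case False
  then have "prime_chain R (Suc 0) Q P"
    using assms by (intro prime_chain.step[of Q R P] prime_chain.refl) auto
  then show ?thesis by blast
qed

lemma prime_chain_extend:
  assumes "prime_chain R n Q P" "primeideal P' R" "P \<subseteq> P'"
  shows "\<exists>k\<ge>n. prime_chain R k Q P'"
proof -
  have "primeideal P R" using assms(1) prime_chain_facts by blast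
  then obtain j where "prime_chain R j P P'" using prime_chain_le assms(2,3) by blast
  then have "prime_chain R (n + j) Q P'" using prime_chain_trans assms(1) by blast
  then show ?thesis by (intro exI[of _ "n + j"]) auto
qed

lemma prime_chain_of_list:
  "Ps \<noteq> [] \<Longrightarrow> sorted_wrt (\<subset>) Ps \<Longrightarrow> \<forall>P\<in>set Ps. primeideal P R \<Longrightarrow>
    prime_chain R (length Ps - 1) (hd Ps) (last Ps)"
proof (induction Ps)
  case (Cons P Ps)
  show ?case
  proof (cases Ps)
    case Nil
    then show ?thesis using Cons.prems prime_chain.refl by auto
  next
    case (Cons Q Qs)
    then have "prime_chain R (length Ps - 1) Q (last Ps)" using Cons.IH Cons.prems by auto
    then have "prime_chain R (Suc (length Ps - 1)) P (last Ps)"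
      using Cons.prems Cons by (intro prime_chain.step[of P R Q]) auto
    then show ?thesis using Cons by simp
  qed
qed simp

lemma list_of_prime_chain:
  "prime_chain R n Q P \<Longrightarrow> \<exists>Ps. length Ps = Suc n \<and> sorted_wrt (\<subset>) Ps \<and> (\<forall>P\<in>set Ps. primeideal P R \<and> Q \<subseteq> P)"
proof (induction rule: prime_chain.induct)
  case (refl P)
  then show ?case by (intro exI[of _ "[P]"]) auto
next
  case (step Q Q' n P)
  then obtain Ps where Ps: "length Ps = Suc n" "sorted_wrt (\<subset>) Ps" "\<forall>P\<in>set Ps. primeideal P R \<and> Q' \<subseteq> P"
    by blast
  have "\<forall>P\<in>set Ps. Q \<subset> P" using Ps(3) step.hyps(2) by blast
  then show ?case using Ps step.hyps by (intro exI[of _ "Q # Ps"]) auto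
qed

lemma (in cring) prime_pow:
  assumes "primeideal P R" "y \<in> carrier R" "y [^] (n::nat) \<in> P" shows "y \<in> P"
  using assms(3)
proof (induction n)
  case 0
  then show ?case using prime_one[OF assms(1)] by simp
next
  case (Suc n)
  then show ?case using prime_mult[OF assms(1), of "y [^] n" y] assms(2) by auto
qed

text \<open>An ideal \<open>Q\<close> maximal among those disjoint from \<open>T\<close> is prime:
  for \<open>a\<close> and \<open>b\<close> outside \<open>Q\<close>, both \<open>Q + Ra\<close> and
  \<open>Q + Rb\<close> meet \<open>T\<close>, and the product of two such elements would lie in
  \<open>Q\<close> if \<open>ab\<close> did.\<close>

lemma (in cring) prime_disjoint:
  assumes noeth: "noetherian_ring R" and J: "ideal J R"
    and T: "T \<subseteq> carrier R" "\<one> \<in> T" "\<And>s t. s \<in> T \<Longrightarrow> t \<in> T \<Longrightarrow> s \<otimes> t \<in> T" and dis: "J \<inter> T = {}"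
  shows "\<exists>Q. primeideal Q R \<and> J \<subseteq> Q \<and> Q \<inter> T = {}"
proof -
  define A where "A = {I. ideal I R \<and> J \<subseteq> I \<and> I \<inter> T = {}}"
  have "J \<in> A" using J dis by (simp add: A_def)
  then obtain Q where Q: "Q \<in> A" "\<And>y. (y, Q) \<in> {(I, J). ideal I R \<and> ideal J R \<and> J \<subset> I} \<Longrightarrow> y \<notin> A"
    by (rule wfE_min[OF noetherian_ring.wf_ideals[OF noeth]]) blast
  have Qi: "ideal Q R" "J \<subseteq> Q" "Q \<inter> T = {}" using Q(1) by (auto simp: A_def)
  have QR: "Q \<subseteq> carrier R" using ideal_subset[OF Qi(1)] .
  have meets: "\<exists>q\<in>Q. \<exists>r\<in>carrier R. q \<oplus> r \<otimes> a \<in> T" if a: "a \<in> carrier R" "a \<notin> Q" for a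
  proof -
    have I: "ideal (Q <+>\<^bsub>R\<^esub> PIdl a) R" using add_ideals[OF Qi(1) cgenideal_ideal[OF a(1)]] .
    have "q \<in> Q <+>\<^bsub>R\<^esub> PIdl a" if "q \<in> Q" for q
    proof -
      have "q = q \<oplus> \<zero> \<otimes> a" using that QR a(1) by auto
      then show ?thesis using that unfolding set_add_def' cgenideal_def by blast
    qed
    moreover have "a \<in> Q <+>\<^bsub>R\<^esub> PIdl a"
    proof -
      have "a = \<zero> \<oplus> \<one> \<otimes> a" using a(1) by simp
      then show ?thesis using ideal_zero[OF Qi(1)] unfolding set_add_def' cgenideal_def by blast
    qed
    ultimately have "Q \<subset> Q <+>\<^bsub>R\<^esub> PIdl a" using a(2) by blast
    then have "Q <+>\<^bsub>R\<^esub> PIdl a \<notin> A" using Q(2) I Qi(1) by blast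
    moreover have "J \<subseteq> Q <+>\<^bsub>R\<^esub> PIdl a" using \<open>Q \<subset> Q <+>\<^bsub>R\<^esub> PIdl a\<close> Qi(2) by blast
    ultimately obtain t where "t \<in> Q <+>\<^bsub>R\<^esub> PIdl a" "t \<in> T" using I by (auto simp: A_def)
    then show ?thesis unfolding set_add_def' cgenideal_def by blast
  qed
  have "primeideal Q R"
  proof (rule primeidealI_cring[OF Qi(1)])
    show "\<one> \<notin> Q" using Qi(3) T(2) by auto
    show "b \<in> Q" if ab: "a \<in> carrier R" "b \<in> carrier R" "a \<otimes> b \<in> Q" "a \<notin> Q" for a b
    proof (rule ccontr)
      assume "b \<notin> Q"
      obtain q r where q: "q \<in> Q" "r \<in> carrier R" "q \<oplus> r \<otimes> a \<in> T" using meets[OF ab(1,4)] by blast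
      obtain q' r' where q': "q' \<in> Q" "r' \<in> carrier R" "q' \<oplus> r' \<otimes> b \<in> T" using meets[OF ab(2) \<open>b \<notin> Q\<close>] by blast
      have carr: "q \<in> carrier R" "q' \<in> carrier R" using q q' QR by auto
      have "(q \<oplus> r \<otimes> a) \<otimes> (q' \<oplus> r' \<otimes> b) = q \<otimes> (q' \<oplus> r' \<otimes> b) \<oplus> ((r \<otimes> a) \<otimes> q' \<oplus> (r \<otimes> r') \<otimes> (a \<otimes> b))"
        using carr q(2) q'(2) ab(1,2) by (simp add: l_distr r_distr m_ac a_ac)
      also have "\<dots> \<in> Q"
        using ideal_rmult[OF Qi(1) q(1), of "q' \<oplus> r' \<otimes> b"] ideal_lmult[OF Qi(1) q'(1), of "r \<otimes> a"]
          ideal_lmult[OF Qi(1) ab(3), of "r \<otimes> r'"] carr q(2) q'(2) ab(1,2)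
        by (simp add: ideal_add[OF Qi(1)])
      finally show False using T(3)[OF q(3) q'(3)] Qi(3) by blast
    qed
  qed
  then show ?thesis using Qi by blast
qed

section \<open>Saturation and bounded chains of submodules\<close>

text \<open>The preimage in \<open>M\<close> of the localization of \<open>N\<close>; it allows
  statements about a localized quotient to be made inside \<open>M\<close>.\<close>

definition sat :: "('a, 'b, 'm) module_scheme \<Rightarrow> 'a set \<Rightarrow> 'b set \<Rightarrow> 'b set"
  where "sat M S N = {x \<in> carrier M. \<exists>s\<in>S. s \<odot>\<^bsub>M\<^esub> x \<in> N}"

text \<open>An elementary form of \<open>K/N\<close> having finite length. The bound counts the
  members of a chain and not its steps.\<close>

definition chain_bounded ::
  "('a, 'r) ring_scheme \<Rightarrow> ('a, 'b, 'm) module_scheme \<Rightarrow> 'b set \<Rightarrow> 'b set \<Rightarrow> nat \<Rightarrow> bool"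
  where "chain_bounded R M N K k \<longleftrightarrow>
    (\<forall>C. finite C \<longrightarrow> subset.chain {L. submodule L R M \<and> N \<subseteq> L \<and> L \<subseteq> K} C \<longrightarrow> card C \<le> k)"

context module begin

lemma submodule_sat:
  assumes N: "submodule N R M" and S: "S \<subseteq> carrier R" "\<one> \<in> S" "\<And>s t. s \<in> S \<Longrightarrow> t \<in> S \<Longrightarrow> s \<otimes> t \<in> S"
  shows "submodule (sat M S N) R M"
proof (rule submoduleI_smult)
  show "\<zero>\<^bsub>M\<^esub> \<in> sat M S N"
    using S(2) submodule_zero[OF N] by (auto simp: sat_def intro!: bexI[of _ \<one>])
  show "x \<oplus>\<^bsub>M\<^esub> y \<in> sat M S N" if xy: "x \<in> sat M S N" "y \<in> sat M S N" for x y
  proof -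
    obtain s t where st: "s \<in> S" "s \<odot>\<^bsub>M\<^esub> x \<in> N" "t \<in> S" "t \<odot>\<^bsub>M\<^esub> y \<in> N"
      using xy by (auto simp: sat_def)
    have carr: "x \<in> carrier M" "y \<in> carrier M" "s \<in> carrier R" "t \<in> carrier R"
      using xy st S by (auto simp: sat_def)
    have "(s \<otimes> t) \<odot>\<^bsub>M\<^esub> (x \<oplus>\<^bsub>M\<^esub> y) = t \<odot>\<^bsub>M\<^esub> (s \<odot>\<^bsub>M\<^esub> x) \<oplus>\<^bsub>M\<^esub> s \<odot>\<^bsub>M\<^esub> (t \<odot>\<^bsub>M\<^esub> y)"
      using carr by (simp add: smult_r_distr smult_assoc1 smult_commute[of s t])
    also have "\<dots> \<in> N"
      by (rule submodule_add[OF N submodule_smult[OF N carr(4) st(2)] submodule_smult[OF N carr(3) st(4)]])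
    finally show ?thesis using carr S(3)[OF st(1,3)] by (auto simp: sat_def)
  qed
  show "a \<odot>\<^bsub>M\<^esub> x \<in> sat M S N" if a: "a \<in> carrier R" and x: "x \<in> sat M S N" for a x
  proof -
    obtain s where s: "s \<in> S" "s \<odot>\<^bsub>M\<^esub> x \<in> N" using x by (auto simp: sat_def)
    have carr: "x \<in> carrier M" "s \<in> carrier R" using x s S by (auto simp: sat_def)
    have "s \<odot>\<^bsub>M\<^esub> (a \<odot>\<^bsub>M\<^esub> x) \<in> N"
      using submodule_smult[OF N a s(2)] smult_commute[OF a carr(2,1)] by simp
    then show ?thesis using a carr s(1) by (auto simp: sat_def)
  qed
qed (auto simp: sat_def)

lemma sat_upper: "N \<subseteq> carrier M \<Longrightarrow> \<one> \<in> S \<Longrightarrow> N \<subseteq> sat M S N"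
  using smult_one unfolding sat_def by force

lemma sat_sat:
  assumes "S \<subseteq> carrier R" "\<And>s t. s \<in> S \<Longrightarrow> t \<in> S \<Longrightarrow> s \<otimes> t \<in> S" "s \<in> S" "x \<in> carrier M" "s \<odot>\<^bsub>M\<^esub> x \<in> sat M S N"
  shows "x \<in> sat M S N"
proof -
  obtain t where t: "t \<in> S" "t \<odot>\<^bsub>M\<^esub> (s \<odot>\<^bsub>M\<^esub> x) \<in> N" using assms(5) by (auto simp: sat_def)
  then have "(t \<otimes> s) \<odot>\<^bsub>M\<^esub> x \<in> N" using assms by (subst smult_assoc1) auto
  then show ?thesis using assms t by (auto simp: sat_def)
qed

text \<open>By the modular law a member \<open>X\<close> of a chain is determined by
  \<open>X \<inter> K\<close> and \<open>X + K\<close>. The product is a crude bound, but only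
  finiteness matters.\<close>

lemma chain_bounded_add:
  assumes N: "submodule N R M" and K: "submodule K R M" and NK: "N \<subseteq> K"
    and L: "submodule L R M" and KL: "K \<subseteq> L"
    and a: "chain_bounded R M N K a" and b: "chain_bounded R M K L b"
  shows "chain_bounded R M N L (a * b)"
  unfolding chain_bounded_def
proof (intro allI impI)
  fix C assume fin: "finite C" and C: "subset.chain {X. submodule X R M \<and> N \<subseteq> X \<and> X \<subseteq> L} C"
  have sub: "submodule X R M" "N \<subseteq> X" "X \<subseteq> L" if "X \<in> C" for X
    using C that by (auto simp: subset_chain_def)
  have tot: "X \<subseteq> Y \<or> Y \<subseteq> X" if "X \<in> C" "Y \<in> C" for X Y
    using C that by (auto simp: subset_chain_def)
  let ?f = "\<lambda>X. X \<inter> K" and ?g = "\<lambda>X. X <+>\<^bsub>M\<^esub> K"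
  have "subset.chain {X. submodule X R M \<and> N \<subseteq> X \<and> X \<subseteq> K} (?f ` C)"
    unfolding subset_chain_def
  proof (intro conjI ballI subsetI)
    fix X assume "X \<in> ?f ` C"
    then show "X \<in> {X. submodule X R M \<and> N \<subseteq> X \<and> X \<subseteq> K}"
      using sub NK submodule_Int[OF _ K] by auto
  next
    fix X Y assume "X \<in> ?f ` C" "Y \<in> ?f ` C"
    then obtain X' Y' where "X' \<in> C" "Y' \<in> C" "X = X' \<inter> K" "Y = Y' \<inter> K" by blast
    then show "X \<subseteq> Y \<or> Y \<subseteq> X" using tot[of X' Y'] by blast
  qed
  then have A: "card (?f ` C) \<le> a" using a fin by (auto simp: chain_bounded_def)
  have "subset.chain {X. submodule X R M \<and> K \<subseteq> X \<and> X \<subseteq> L} (?g ` C)"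
    unfolding subset_chain_def
  proof (intro conjI ballI subsetI)
    fix X assume "X \<in> ?g ` C"
    then obtain X' where X': "X' \<in> C" "X = ?g X'" by blast
    then show "X \<in> {X. submodule X R M \<and> K \<subseteq> X \<and> X \<subseteq> L}"
      using submodule_set_add[OF sub(1)[OF X'(1)] K] set_add_upper2[OF sub(1)[OF X'(1)] K]
        set_add_least[OF L sub(3)[OF X'(1)] KL] by simp
  next
    fix X Y assume "X \<in> ?g ` C" "Y \<in> ?g ` C"
    then obtain X' Y' where "X' \<in> C" "Y' \<in> C" "X = ?g X'" "Y = ?g Y'" by blast
    then show "X \<subseteq> Y \<or> Y \<subseteq> X" using tot[of X' Y'] set_add_mono[of X' Y' K K] set_add_mono[of Y' X' K K] by blast
  qed
  then have B: "card (?g ` C) \<le> b" using b fin by (auto simp: chain_bounded_def)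
  have modular: "X = Y" if XY: "X \<in> C" "Y \<in> C" "X \<subseteq> Y" "?f X = ?f Y" "?g X = ?g Y" for X Y
  proof
    show "Y \<subseteq> X"
    proof
      fix y assume y: "y \<in> Y"
      have X: "submodule X R M" and Y: "submodule Y R M" using sub XY by auto
      have "y \<in> X <+>\<^bsub>M\<^esub> K" using y set_add_upper1[OF Y K] XY(5) by auto
      then obtain x k where xk: "x \<in> X" "k \<in> K" "y = x \<oplus>\<^bsub>M\<^esub> k" by (auto simp: mem_set_add_iff)
      then have "k \<in> Y" using submodule_cancel[OF Y, of x k] XY(3) y submodule_carr[OF K] by auto
      then have "k \<in> X" using XY(4) xk(2) by auto
      then show "y \<in> X" using xk submodule_add[OF X] by simp
    qed
  qed (use XY in auto)
  have "inj_on (\<lambda>X. (?f X, ?g X)) C"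
  proof (rule inj_onI)
    fix X Y assume "X \<in> C" "Y \<in> C" "(?f X, ?g X) = (?f Y, ?g Y)"
    then show "X = Y" using modular[of X Y] modular[of Y X] tot[of X Y] by auto
  qed
  moreover have "(\<lambda>X. (?f X, ?g X)) ` C \<subseteq> ?f ` C \<times> ?g ` C" by blast
  ultimately have "card C \<le> card (?f ` C \<times> ?g ` C)"
    using fin by (intro card_inj_on_le) auto
  also have "\<dots> \<le> a * b" using A B by (simp add: card_cartesian_product mult_le_mono)
  finally show "card C \<le> a * b" .
qed

text \<open>A submodule strictly above \<open>K\<close> contains some \<open>k + au\<close> with
  \<open>a\<close> outside \<open>m\<close>; as \<open>a\<close> is a unit, it contains
  \<open>u\<close>. So only the two ends remain.\<close>

lemma chain_bounded_step:
  assumes K: "submodule K R M" and u: "u \<in> carrier M" "colon R M K u = m"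
    and units: "\<And>a. a \<in> carrier R \<Longrightarrow> a \<notin> m \<Longrightarrow> a \<in> Units R"
  shows "chain_bounded R M K (K <+>\<^bsub>M\<^esub> line R M u) 2"
  unfolding chain_bounded_def
proof (intro allI impI)
  let ?L = "K <+>\<^bsub>M\<^esub> line R M u"
  fix C assume "finite C" and C: "subset.chain {X. submodule X R M \<and> K \<subseteq> X \<and> X \<subseteq> ?L} C"
  have "X = K \<or> X = ?L" if "X \<in> C" for X
  proof (rule disjCI)
    assume neq: "X \<noteq> ?L"
    have X: "submodule X R M" "K \<subseteq> X" "X \<subseteq> ?L" using C that by (auto simp: subset_chain_def)
    have "u \<notin> X"
    proof
      assume "u \<in> X"
      then have "?L \<subseteq> X" using X by (intro set_add_least line_least) auto
      then show False using X neq by auto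
    qed
    have "X \<subseteq> K"
    proof
      fix y assume y: "y \<in> X"
      then obtain k a where ka: "k \<in> K" "a \<in> carrier R" "y = k \<oplus>\<^bsub>M\<^esub> a \<odot>\<^bsub>M\<^esub> u"
        using subsetD[OF X(3) y] unfolding mem_set_add_iff line_def by blast
      have "a \<in> m"
      proof (rule ccontr)
        assume "a \<notin> m"
        then have au: "a \<in> Units R" using units ka by auto
        have "a \<odot>\<^bsub>M\<^esub> u \<in> X" using submodule_cancel[OF X(1), of k "a \<odot>\<^bsub>M\<^esub> u"] ka X(2) y u(1) by auto
        then have "inv a \<odot>\<^bsub>M\<^esub> (a \<odot>\<^bsub>M\<^esub> u) \<in> X" using submodule_smult[OF X(1)] au by simp
        then have "u \<in> X" using au u(1) by (simp add: smult_assoc1[symmetric] ka(2))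
        then show False using \<open>u \<notin> X\<close> by simp
      qed
      then show "y \<in> K" using ka u(2) submodule_add[OF K] by (auto simp: colon_def)
    qed
    then show "X = K" using X by auto
  qed
  then have "C \<subseteq> {K, ?L}" by blast
  then have "card C \<le> card {K, ?L}" by (intro card_mono) auto
  then show "card C \<le> 2" using card_insert_le_m1[of 2 "{?L}" K] by (simp split: if_splits)
qed

lemma bounded_decreasing_stable:
  assumes b: "chain_bounded R M N (carrier M) k"
    and f: "\<And>n. submodule (f n) R M" "\<And>n. N \<subseteq> f n" "\<And>n. f (Suc n) \<subseteq> f n"
  shows "\<exists>n. f (Suc n) = f n"
proof (rule ccontr)
  assume "\<not> ?thesis"
  then have lt: "f (Suc n) \<subset> f n" for n using f(3) by blast
  have less: "f j \<subset> f i" if "i < j" for i j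
    using that by (induction j) (use lt less_Suc_eq in blast)+
  then have inj: "inj_on f {..k}" by (intro linorder_inj_onI) auto
  have "subset.chain {X. submodule X R M \<and> N \<subseteq> X \<and> X \<subseteq> carrier M} (f ` {..k})"
    unfolding subset_chain_def
  proof (intro conjI ballI subsetI)
    fix X assume "X \<in> f ` {..k}"
    then obtain i where "X = f i" by blast
    then show "X \<in> {X. submodule X R M \<and> N \<subseteq> X \<and> X \<subseteq> carrier M}"
      using f(1,2)[of i] submodule_subset[OF f(1)] by simp
  next
    fix X Y assume "X \<in> f ` {..k}" "Y \<in> f ` {..k}"
    then obtain i j where "X = f i" "Y = f j" by blast
    then show "X \<subseteq> Y \<or> Y \<subseteq> X" using less[of i j] less[of j i] by (cases i j rule: linorder_cases) auto
  qed
  then have "card (f ` {..k}) \<le> k" using b by (auto simp: chain_bounded_def)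
  then show False using card_image[OF inj] by simp
qed

lemma mem_ann_quot_adj:
  assumes "submodule N R M" "x \<in> carrier R" shows "x \<in> ann_quot R M (N <+>\<^bsub>M\<^esub> mult_image M x)"
  using assms adj_upper2 by (auto simp: ann_quot_def)

end

section \<open>Nonzerodivisors and primes of the support\<close>

context noetherian_module begin

text \<open>The products of elements outside \<open>P\<close> with powers of \<open>x\<close> form a
  multiplicative set. It misses the annihilator of \<open>M/N\<close>, because powers of
  \<open>x\<close> cancel and the annihilator lies in \<open>P\<close>. A prime disjoint from it
  lies inside \<open>P\<close> and omits \<open>x\<close>.\<close>

lemma nzd_prime_below:
  assumes N: "submodule N R M" and x: "x \<in> carrier R" "nzd M N x"
    and P: "primeideal P R" "ann_quot R M N \<subseteq> P"
  shows "\<exists>Q. primeideal Q R \<and> ann_quot R M N \<subseteq> Q \<and> Q \<subseteq> P \<and> x \<notin> Q"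
proof -
  let ?T = "{s \<otimes> x [^] k | s k. s \<in> carrier R - P \<and> k \<in> (UNIV :: nat set)}"
  have nz: "m \<in> N" if "m \<in> carrier M" "x [^] (k::nat) \<odot>\<^bsub>M\<^esub> m \<in> N" for k m
    using that
  proof (induction k)
    case (Suc k)
    have "x [^] Suc k \<odot>\<^bsub>M\<^esub> m = x \<odot>\<^bsub>M\<^esub> (x [^] k \<odot>\<^bsub>M\<^esub> m)"
      using x(1) Suc.prems(1) by (simp add: smult_assoc1 smult_commute[of _ x])
    then have "x [^] k \<odot>\<^bsub>M\<^esub> m \<in> N" using Suc.prems x unfolding nzd_def by simp
    then show ?case using Suc by simp
  qed simp
  have "\<exists>Q. primeideal Q R \<and> ann_quot R M N \<subseteq> Q \<and> Q \<inter> ?T = {}"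
  proof (rule R.prime_disjoint[OF noetherian ann_quot_ideal[OF N]])
    show "?T \<subseteq> carrier R" using x by auto
    show "\<one> \<in> ?T"
    proof -
      have "\<one> = \<one> \<otimes> x [^] (0::nat)" by simp
      then show ?thesis using prime_one[OF P(1)] by blast
    qed
    show "a \<otimes> b \<in> ?T" if ab: "a \<in> ?T" "b \<in> ?T" for a b
    proof -
      obtain s k where s: "s \<in> carrier R" "s \<notin> P" "a = s \<otimes> x [^] (k::nat)" using ab(1) by blast
      obtain t l where t: "t \<in> carrier R" "t \<notin> P" "b = t \<otimes> x [^] (l::nat)" using ab(2) by blast
      have "a \<otimes> b = (s \<otimes> t) \<otimes> x [^] (k + l)"
        unfolding s(3) t(3) using s t x(1) by (simp add: R.m_ac flip: R.nat_pow_mult)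
      moreover have "s \<otimes> t \<in> carrier R - P" using s t prime_mult[OF P(1)] by auto
      ultimately show ?thesis by blast
    qed
    show "ann_quot R M N \<inter> ?T = {}"
    proof (rule ccontr)
      assume "\<not> ?thesis"
      then obtain s k where s: "s \<in> carrier R" "s \<notin> P" "s \<otimes> x [^] (k::nat) \<in> ann_quot R M N" by blast
      have "s \<odot>\<^bsub>M\<^esub> m \<in> N" if m: "m \<in> carrier M" for m
      proof (rule nz)
        have "x [^] k \<odot>\<^bsub>M\<^esub> (s \<odot>\<^bsub>M\<^esub> m) = (s \<otimes> x [^] k) \<odot>\<^bsub>M\<^esub> m"
          using s m x(1) by (simp add: smult_assoc1 smult_commute[of s])
        then show "x [^] k \<odot>\<^bsub>M\<^esub> (s \<odot>\<^bsub>M\<^esub> m) \<in> N" using s(3) m by (simp add: ann_quot_def)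
      qed (use s m in auto)
      then have "s \<in> ann_quot R M N" using s(1) by (simp add: ann_quot_def)
      then show False using P(2) s(2) by blast
    qed
  qed
  then obtain Q where Q: "primeideal Q R" "ann_quot R M N \<subseteq> Q" "Q \<inter> ?T = {}" by blast
  have "Q \<subseteq> P"
  proof
    fix a assume a: "a \<in> Q"
    then have aR: "a \<in> carrier R" using prime_subset[OF Q(1)] by auto
    show "a \<in> P"
    proof (rule ccontr)
      assume "a \<notin> P"
      moreover have "a = a \<otimes> x [^] (0::nat)" using aR by simp
      ultimately have "a \<in> ?T" using aR by blast
      then show False using Q(3) a by blast
    qed
  qed
  moreover have "x \<notin> Q"
  proof -
    have "x = \<one> \<otimes> x [^] (1::nat)" using x(1) by simp
    then have "x \<in> ?T" using prime_one[OF P(1)] by blast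
    then show ?thesis using Q(3) by blast
  qed
  ultimately show ?thesis using Q by blast
qed

text \<open>The source of all lower bounds for dimensions. The chain found modulo
  \<open>N + xM\<close> starts at a prime containing \<open>x\<close>, and
  \<open>nzd_prime_below\<close> puts a prime without \<open>x\<close> strictly beneath it.\<close>

lemma regular_prime_chain:
  "submodule N R M \<Longrightarrow> set xs \<subseteq> carrier R \<Longrightarrow> regular M N xs \<Longrightarrow> primeideal P R \<Longrightarrow>
    ann_quot R M (quot_by M N xs) \<subseteq> P \<Longrightarrow> \<exists>Q. ann_quot R M N \<subseteq> Q \<and> prime_chain R (length xs) Q P"
proof (induction xs arbitrary: N)
  case Nil
  then show ?case using prime_chain.refl by auto
next
  case (Cons x xs)
  have x: "x \<in> carrier R" "nzd M N x" using Cons.prems by auto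
  let ?N = "N <+>\<^bsub>M\<^esub> mult_image M x"
  obtain Q where Q: "ann_quot R M ?N \<subseteq> Q" "prime_chain R (length xs) Q P"
    using Cons.IH[OF submodule_adj[OF Cons.prems(1) x(1)]] Cons.prems by auto
  have Qp: "primeideal Q R" using Q prime_chain_facts by blast
  have "ann_quot R M N \<subseteq> Q" using Q(1) ann_quot_mono[OF adj_upper[OF Cons.prems(1) x(1)]] by blast
  then obtain Q' where Q': "primeideal Q' R" "ann_quot R M N \<subseteq> Q'" "Q' \<subseteq> Q" "x \<notin> Q'"
    using nzd_prime_below[OF Cons.prems(1) x Qp] by blast
  have "x \<in> Q" using Q(1) mem_ann_quot_adj[OF Cons.prems(1) x(1)] by blast
  then have "Q' \<subset> Q" using Q' by blast
  then have "prime_chain R (length (x # xs)) Q' P" using prime_chain.step[OF Q'(1) _ Q(2)] by simp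
  then show ?case using Q'(2) by blast
qed

text \<open>If \<open>a\<close> outside \<open>P\<close> killed the new quotient, then
  \<open>aM\<close> would lie in \<open>N + PM\<close>, and Nakayama's lemma at \<open>P\<close>
  would give a \<open>t\<close> outside \<open>P\<close> with \<open>tM\<close> inside
  \<open>N\<close>.\<close>

lemma ann_quot_adj_subset_prime:
  assumes N: "submodule N R M" and P: "primeideal P R" "ann_quot R M N \<subseteq> P" and y: "y \<in> P"
  shows "ann_quot R M (N <+>\<^bsub>M\<^esub> mult_image M y) \<subseteq> P"
proof
  fix a assume a: "a \<in> ann_quot R M (N <+>\<^bsub>M\<^esub> mult_image M y)"
  have PR: "P \<subseteq> carrier R" using prime_subset[OF P(1)] .
  have aR: "a \<in> carrier R" using a by (simp add: ann_quot_def)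
  have sub: "submodule (ideal_mult R M P (carrier M)) R M" using PR by (intro submodule_ideal_mult) auto
  show "a \<in> P"
  proof (rule ccontr)
    assume "a \<notin> P"
    have "\<exists>t\<in>carrier R - P. \<forall>x\<in>carrier M. t \<odot>\<^bsub>M\<^esub> x \<in> N"
    proof (rule Nakayama_prime[OF P(1) N carrier_is_submodule aR \<open>a \<notin> P\<close>])
      fix x assume x: "x \<in> carrier M"
      have "N <+>\<^bsub>M\<^esub> mult_image M y \<subseteq> N <+>\<^bsub>M\<^esub> ideal_mult R M P (carrier M)"
        using y by (intro set_add_mono) (auto simp: mult_image_def intro: ideal_mult_mem)
      then show "a \<odot>\<^bsub>M\<^esub> x \<in> N <+>\<^bsub>M\<^esub> ideal_mult R M P (carrier M)"
        using a x by (auto simp: ann_quot_def)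
    qed
    then obtain t where "t \<in> carrier R" "t \<notin> P" "t \<in> ann_quot R M N" by (auto simp: ann_quot_def)
    then show False using P(2) by blast
  qed
qed

end

section \<open>Modules over a local ring\<close>

text \<open>Locality is stated in the form that a localization delivers directly: a prime whose
  complement consists of units.\<close>

locale noetherian_local_module = noetherian_module +
  fixes m
  assumes m_prime: "primeideal m R" and m_units: "\<And>a. a \<in> carrier R \<Longrightarrow> a \<notin> m \<Longrightarrow> a \<in> Units R"
begin

lemma proper_ideal_subset:
  assumes "ideal I R" "\<one> \<notin> I" shows "I \<subseteq> m"
proof
  fix a assume a: "a \<in> I"
  then have aR: "a \<in> carrier R" using ideal_subset[OF assms(1)] by auto
  show "a \<in> m"
  proof (rule ccontr)
    assume "a \<notin> m"
    then have u: "a \<in> Units R" using m_units aR by auto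
    then show False using ideal_lmult[OF assms(1) a, of "inv a"] assms(2) by simp
  qed
qed

lemma prime_subset_m: "primeideal P R \<Longrightarrow> P \<subseteq> m"
  using proper_ideal_subset prime_ideal prime_one by blast

lemma ann_quot_subset_m:
  assumes "submodule N R M" "N \<noteq> carrier M"
  shows "ann_quot R M N \<subseteq> m"
proof (rule proper_ideal_subset[OF ann_quot_ideal[OF assms(1)]])
  show "\<one> \<notin> ann_quot R M N"
  proof
    assume "\<one> \<in> ann_quot R M N"
    then have "carrier M \<subseteq> N" by (auto simp: ann_quot_def)
    then show False using assms submodule_subset by blast
  qed
qed

lemma Nakayama_local:
  assumes N0: "submodule N0 R M" and N: "submodule N R M"
    and le: "N \<subseteq> N0 <+>\<^bsub>M\<^esub> ideal_mult R M m N"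
  shows "N \<subseteq> N0"
proof -
  have "\<exists>t\<in>carrier R - m. \<forall>x\<in>N. t \<odot>\<^bsub>M\<^esub> x \<in> N0"
  proof (rule Nakayama_prime[OF m_prime N0 N R.one_closed prime_one[OF m_prime]])
    show "\<one> \<odot>\<^bsub>M\<^esub> x \<in> N0 <+>\<^bsub>M\<^esub> ideal_mult R M m N" if "x \<in> N" for x
      using that le submodule_carr[OF N that] by auto
  qed
  then obtain t where t: "t \<in> carrier R" "t \<notin> m" "\<forall>x\<in>N. t \<odot>\<^bsub>M\<^esub> x \<in> N0" by auto
  have tu: "t \<in> Units R" using t m_units by auto
  show ?thesis
  proof
    fix x assume x: "x \<in> N"
    then have "inv t \<odot>\<^bsub>M\<^esub> (t \<odot>\<^bsub>M\<^esub> x) \<in> N0" using t(3) tu submodule_smult[OF N0] by simp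
    then show "x \<in> N0" using tu t(1) submodule_carr[OF N x] by (simp add: smult_assoc1[symmetric])
  qed
qed

text \<open>Take \<open>K\<close> maximal with chains between \<open>N\<close> and \<open>K\<close>
  bounded. Were \<open>K\<close> not \<open>M\<close>, some class modulo \<open>K\<close> would have
  a prime annihilator; this contains the annihilator of \<open>M/N\<close>, hence is
  \<open>m\<close>, and adjoining the class adds only a simple factor.\<close>

lemma chain_bounded_exists:
  assumes N: "submodule N R M" and only: "\<And>P. primeideal P R \<Longrightarrow> ann_quot R M N \<subseteq> P \<Longrightarrow> P = m"
  shows "\<exists>k. chain_bounded R M N (carrier M) k"
proof -
  define Q where "Q K \<longleftrightarrow> N \<subseteq> K \<and> (\<exists>k. chain_bounded R M N K k)" for K
  have "chain_bounded R M N N 1"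
    unfolding chain_bounded_def
  proof (intro allI impI)
    fix C assume "subset.chain {L. submodule L R M \<and> N \<subseteq> L \<and> L \<subseteq> N} C"
    then have "C \<subseteq> {N}" by (auto simp: subset_chain_def)
    then show "card C \<le> 1" using card_mono[of "{N}" C] by simp
  qed
  then have "Q N" unfolding Q_def by blast
  then obtain K where K: "submodule K R M" "Q K" "\<And>L. submodule L R M \<Longrightarrow> Q L \<Longrightarrow> K \<subseteq> L \<Longrightarrow> L = K"
    using maximal_submodule_pred[of N Q, OF N] by auto
  obtain k where k: "N \<subseteq> K" "chain_bounded R M N K k" using K(2) by (auto simp: Q_def)
  have "carrier M \<subseteq> K"
  proof (rule ccontr)
    assume "\<not> ?thesis"
    then obtain u where "u \<in> carrier M - K" by blast
    then obtain v where v: "max_colon R M K v" using max_colon_exists[OF K(1)] by blast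
    have vM: "v \<in> carrier M" "v \<notin> K" using v by (auto simp: max_colon_def)
    have "ann_quot R M N \<subseteq> colon R M K v"
      using ann_quot_mono[OF k(1)] ann_quot_subset_colon[OF vM(1)] by blast
    then have "colon R M K v = m" using only max_colon_prime[OF K(1) v] by simp
    then have b: "chain_bounded R M K (K <+>\<^bsub>M\<^esub> line R M v) 2"
      by (intro chain_bounded_step[OF K(1) vM(1)] m_units)
    have L: "submodule (K <+>\<^bsub>M\<^esub> line R M v) R M" "K \<subseteq> K <+>\<^bsub>M\<^esub> line R M v" "v \<in> K <+>\<^bsub>M\<^esub> line R M v"
      using submodule_set_add[OF K(1) submodule_line[OF vM(1)]] set_add_upper1[OF K(1) submodule_line[OF vM(1)]]
        set_add_upper2[OF K(1) submodule_line[OF vM(1)]] line_self[OF vM(1)] by auto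
    have "Q (K <+>\<^bsub>M\<^esub> line R M v)"
      unfolding Q_def using chain_bounded_add[OF N K(1) k(1) L(1,2) k(2) b] k(1) L(2) by blast
    then show False using K(3)[OF L(1) _ L(2)] L(3) vM(2) by auto
  qed
  then show ?thesis using k submodule_subset[OF K(1)] by auto
qed

end

section \<open>The principal ideal theorem over a local ring\<close>

text \<open>Its submodules are the ideals of \<open>R\<close>, so the results about \<open>M\<close>
  become available for ideals.\<close>

definition self_module :: "('a, 'r) ring_scheme \<Rightarrow> ('a, 'a) module"
  where "self_module R = \<lparr>carrier = carrier R, mult = mult R, one = one R, zero = zero R,
    add = add R, smult = mult R\<rparr>"

lemma self_module_simps [simp]:
  "carrier (self_module R) = carrier R" "zero (self_module R) = zero R"
  "add (self_module R) = add R" "smult (self_module R) = mult R"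
  by (simp_all add: self_module_def)

context cring begin

lemma self_module: "module R (self_module R)"
proof (rule moduleI)
  show "cring R" by (rule is_cring)
  show "abelian_group (self_module R)"
  proof (rule abelian_groupI)
    fix x assume "x \<in> carrier (self_module R)"
    then show "\<exists>y\<in>carrier (self_module R). y \<oplus>\<^bsub>self_module R\<^esub> x = \<zero>\<^bsub>self_module R\<^esub>"
      by (auto intro!: bexI[of _ "\<ominus> x"] simp: l_neg)
  qed (auto simp: a_ac)
qed (auto simp: l_distr r_distr m_assoc)

lemma submodule_self_iff: "submodule I R (self_module R) \<longleftrightarrow> ideal I R"
proof
  interpret S: module R "self_module R" by (rule self_module)
  show "ideal I R" if I: "submodule I R (self_module R)"
  proof (rule idealI_cring)
    show "I \<subseteq> carrier R" using S.submodule_subset[OF I] by simp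
    show "\<zero> \<in> I" using S.submodule_zero[OF I] by simp
    show "a \<oplus> b \<in> I" if "a \<in> I" "b \<in> I" for a b using S.submodule_add[OF I that] by simp
    show "r \<otimes> a \<in> I" if "a \<in> I" "r \<in> carrier R" for a r using S.submodule_smult[OF I that(2,1)] by simp
  qed
  show "submodule I R (self_module R)" if I: "ideal I R"
  proof (rule S.submoduleI_smult)
    show "I \<subseteq> carrier (self_module R)" using ideal_subset[OF I] by simp
    show "\<zero>\<^bsub>self_module R\<^esub> \<in> I" using ideal_zero[OF I] by simp
    show "a \<oplus>\<^bsub>self_module R\<^esub> b \<in> I" if "a \<in> I" "b \<in> I" for a b
      using ideal_add[OF I that] by simp
    show "r \<odot>\<^bsub>self_module R\<^esub> a \<in> I" if "r \<in> carrier R" "a \<in> I" for a r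
      using ideal_lmult[OF I that(2,1)] by simp
  qed
qed

lemma noetherian_self_module:
  assumes "noetherian_ring R" shows "noetherian_module R (self_module R)"
proof (intro noetherian_module.intro self_module noetherian_module_axioms.intro assms)
  interpret S: module R "self_module R" by (rule self_module)
  have sub: "submodule (module_span R (self_module R) {\<one>}) R (self_module R)"
    by (rule S.module_span_submodule) simp
  have "x \<in> module_span R (self_module R) {\<one>}" if "x \<in> carrier R" for x
    using S.submodule_smult[OF sub that, of \<one>] S.module_span_incl[of "{\<one>}"] that by auto
  then have "module_span R (self_module R) {\<one>} = carrier (self_module R)"
    using S.submodule_subset[OF sub] by auto
  then show "finitely_generated R (self_module R)"
    unfolding finitely_generated_def by (intro exI[of _ "{\<one>}"]) auto
qed

lemma ann_quot_self: "ideal I R \<Longrightarrow> ann_quot R (self_module R) I = I"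
proof -
  assume I: "ideal I R"
  have "a \<in> I" if "a \<in> carrier R" "\<forall>x\<in>carrier R. a \<otimes> x \<in> I" for a
    using that(2)[rule_format, OF one_closed] that(1) by simp
  then show ?thesis using ideal_subset[OF I] ideal_rmult[OF I] by (auto simp: ann_quot_def)
qed

lemma prime_complement:
  assumes "primeideal P R"
  shows "carrier R - P \<subseteq> carrier R" "\<one> \<in> carrier R - P"
    "\<And>s t. s \<in> carrier R - P \<Longrightarrow> t \<in> carrier R - P \<Longrightarrow> s \<otimes> t \<in> carrier R - P"
  using prime_one[OF assms] prime_mult[OF assms] by auto

end

text \<open>For an ideal \<open>J\<close> inside the prime \<open>Q\<close> this is the preimage in
  \<open>R\<close> of the \<open>n\<close>-th symbolic power of \<open>Q/J\<close>. Saturating at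
  every step replaces ordinary powers.\<close>

primrec symbolic_power :: "('a, 'r) ring_scheme \<Rightarrow> 'a set \<Rightarrow> 'a set \<Rightarrow> nat \<Rightarrow> 'a set" where
  "symbolic_power R Q J 0 = carrier R"
| "symbolic_power R Q J (Suc n) = sat (self_module R) (carrier R - Q)
    (J <+>\<^bsub>self_module R\<^esub> ideal_mult R (self_module R) Q (symbolic_power R Q J n))"

text \<open>Krull's principal ideal theorem over a local ring: the symbolic powers \<open>P1\<^sup>(\<^sup>n\<^sup>) + P0\<close>
  stabilise because the quotient by \<open>P0 + (x)\<close> has finite length; Nakayama's lemma, first at
  \<open>m\<close> and then at \<open>P1\<close>, pushes them into \<open>P0\<close>.\<close>

lemma (in cring) principal_ideal_theorem_local:
  assumes noeth: "noetherian_ring R" and m: "primeideal m R" "\<And>a. a \<in> carrier R \<Longrightarrow> a \<notin> m \<Longrightarrow> a \<in> Units R"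
    and P0: "primeideal P0 R" and P1: "primeideal P1 R" and lt: "P0 \<subset> P1" "P1 \<subset> m" and x: "x \<in> m"
    and only: "\<And>Q. primeideal Q R \<Longrightarrow> P0 \<subseteq> Q \<Longrightarrow> x \<in> Q \<Longrightarrow> Q = m"
  shows False
proof -
  let ?S = "self_module R"
  interpret S: noetherian_local_module R "self_module R" m
    by (intro noetherian_local_module.intro noetherian_self_module noetherian_local_module_axioms.intro noeth m)
  have xR: "x \<in> carrier R" using x prime_subset[OF m(1)] by auto
  have xP1: "x \<notin> P1" using only[OF P1] lt by auto
  have sP0: "submodule P0 R ?S" using prime_ideal[OF P0] submodule_self_iff by simp
  have sline: "submodule (line R ?S x) R ?S" using S.submodule_line xR by simp
  define J where "J = P0 <+>\<^bsub>?S\<^esub> line R ?S x"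
  have sJ: "submodule J R ?S" unfolding J_def by (rule S.submodule_set_add[OF sP0 sline])
  have P0J: "P0 \<subseteq> J" and xJ: "x \<in> J"
    unfolding J_def using S.set_add_upper1[OF sP0 sline] S.set_add_upper2[OF sP0 sline] S.line_self[of x] xR
    by auto
  have "\<exists>k. chain_bounded R ?S J (carrier ?S) k"
  proof (rule S.chain_bounded_exists[OF sJ])
    fix P assume P: "primeideal P R" "ann_quot R ?S J \<subseteq> P"
    then have "J \<subseteq> P" using ann_quot_self sJ submodule_self_iff by simp
    then show "P = m" using only[OF P(1)] P0J xJ by blast
  qed
  then obtain k where k: "chain_bounded R ?S J (carrier ?S) k" by blast
  note T = prime_complement[OF P1]
  let ?f = "symbolic_power R P1 P0"
  let ?h = "\<lambda>n. P0 <+>\<^bsub>?S\<^esub> ideal_mult R ?S P1 (?f n)"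
  have f: "submodule (?f n) R ?S" for n
  proof (induction n)
    case 0
    then show ?case using S.carrier_is_submodule by simp
  next
    case (Suc n)
    have "submodule (ideal_mult R ?S P1 (?f n)) R ?S"
      using S.submodule_subset[OF Suc] prime_subset[OF P1] by (intro S.submodule_ideal_mult)
    then show ?case using S.submodule_sat[OF S.submodule_set_add[OF sP0] T] by simp
  qed
  have im: "submodule (ideal_mult R ?S P1 (?f n)) R ?S" for n
    using S.submodule_subset[OF f] prime_subset[OF P1] by (intro S.submodule_ideal_mult)
  have h: "submodule (?h n) R ?S" for n using S.submodule_set_add[OF sP0 im] .
  have hf: "?h n \<subseteq> ?f (Suc n)" for n
    using S.sat_upper[OF S.submodule_subset[OF h] T(2)] by simp
  have P0f: "P0 \<subseteq> ?f n" for n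
  proof (cases n)
    case 0
    then show ?thesis using prime_subset[OF P0] by simp
  next
    case (Suc j)
    then show ?thesis using hf[of j] S.set_add_upper1[OF sP0 im[of j]] by blast
  qed
  have fsat: "a \<in> ?f n" if s: "s \<in> carrier R" "s \<notin> P1" and a: "a \<in> carrier R" "s \<otimes> a \<in> ?f n" for s a n
  proof (cases n)
    case (Suc j)
    then show ?thesis using S.sat_sat[OF T(1,3), of s a "?h j"] s a by simp
  qed (use a in simp)
  have dec: "?f (Suc n) \<subseteq> ?f n" for n
  proof (induction n)
    case 0
    then show ?case using S.submodule_subset[OF f[of 1]] by simp
  next
    case (Suc n)
    have "ideal_mult R ?S P1 (?f (Suc n)) \<subseteq> ideal_mult R ?S P1 (?f n)"
      by (intro S.ideal_mult_least[OF im] S.ideal_mult_mem subsetD[OF Suc])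
    then have "?h (Suc n) \<subseteq> ?h n" by (intro S.set_add_mono) auto
    then show ?case by (auto simp: sat_def)
  qed
  \<comment> \<open>The symbolic powers themselves need not lie above \<open>J\<close>; adding
    \<open>J\<close> moves them into the quotient of finite length.\<close>
  let ?g = "\<lambda>n. ?f n <+>\<^bsub>?S\<^esub> J"
  have "\<exists>n. ?g (Suc n) = ?g n"
    by (rule S.bounded_decreasing_stable[OF k])
      (use S.submodule_set_add[OF f sJ] S.set_add_upper2[OF f sJ] S.set_add_mono[OF dec] in auto)
  then obtain n where n: "?g (Suc n) = ?g n" by blast
  have mf: "submodule (ideal_mult R ?S m (?f n)) R ?S"
    using S.submodule_subset[OF f] prime_subset[OF m(1)] by (intro S.submodule_ideal_mult)
  have "?f n \<subseteq> ?f (Suc n) <+>\<^bsub>?S\<^esub> ideal_mult R ?S m (?f n)"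
  proof
    fix a assume a: "a \<in> ?f n"
    then have "a \<in> ?g (Suc n)" using S.set_add_upper1[OF f[of n] sJ] n by auto
    then obtain b j where j: "b \<in> ?f (Suc n)" "j \<in> J" "a = b \<oplus> j"
      unfolding S.mem_set_add_iff by auto
    obtain p r where "p \<in> P0" "r \<in> carrier R" "j = p \<oplus> r \<otimes> x"
      using j(2) unfolding J_def S.mem_set_add_iff line_def by auto
    with j have b: "b \<in> ?f (Suc n)" "p \<in> P0" "r \<in> carrier R" "a = b \<oplus> (p \<oplus> r \<otimes> x)" by auto
    have bp: "b \<oplus> p \<in> ?f (Suc n)" using S.submodule_add[OF f b(1) subsetD[OF P0f b(2)]] by simp
    have carr: "b \<in> carrier R" "p \<in> carrier R"
      using b(2) prime_subset[OF P0] S.submodule_carr[OF f b(1)] by auto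
    have eq: "a = (b \<oplus> p) \<oplus> r \<otimes> x" using b carr xR by (simp add: a_assoc)
    then have "r \<otimes> x \<in> ?f n"
      using S.submodule_cancel[OF f[of n] subsetD[OF dec bp], of "r \<otimes> x"] a b(3) xR by simp
    \<comment> \<open>The element \<open>x\<close> lies outside \<open>P1\<close> and
      \<open>?f n\<close> is saturated there, so \<open>x\<close> cancels. This is what replaces the
      summand \<open>J\<close> by \<open>m\<close> times \<open>?f n\<close>.\<close>
    then have "r \<in> ?f n" using fsat[OF xR xP1 b(3)] b(3) xR by (simp add: m_comm)
    then have "r \<otimes> x \<in> ideal_mult R ?S m (?f n)"
      using S.ideal_mult_mem[OF x, of r "?f n"] b(3) xR by (simp add: m_comm)
    then show "a \<in> ?f (Suc n) <+>\<^bsub>?S\<^esub> ideal_mult R ?S m (?f n)"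
      unfolding S.mem_set_add_iff using bp eq by auto
  qed
  then have "?f n \<subseteq> ?f (Suc n)" by (rule S.Nakayama_local[OF f f])
  \<comment> \<open>Unfolding the saturation in \<open>?f (Suc n)\<close> gives each element its own
    multiplier. A common one is the \<open>s\<close> that Nakayama's lemma at \<open>P1\<close>
    expects.\<close>
  then have "\<exists>s\<in>carrier R - P1. s \<odot>\<^bsub>?S\<^esub> a \<in> ?h n" if "a \<in> ?f n" for a
    using that by (auto simp: sat_def)
  then obtain s where s: "s \<in> carrier R" "s \<notin> P1" "\<forall>a\<in>?f n. s \<odot>\<^bsub>?S\<^esub> a \<in> ?h n"
    using S.uniform_multiplier[OF h[of n] f[of n] T] by blast
  then obtain t where t: "t \<in> carrier R" "t \<notin> P1" "\<forall>a\<in>?f n. t \<otimes> a \<in> P0"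
    using S.Nakayama_prime[OF P1 sP0 f[of n] s(1,2)] by auto
  have fP0: "?f n \<subseteq> P0"
  proof
    fix a assume a: "a \<in> ?f n"
    then have "a \<in> carrier R" using S.submodule_carr[OF f] by auto
    then show "a \<in> P0" using t a lt(1) prime_mult[OF P0, of t a] by auto
  qed
  \<comment> \<open>Powers of \<open>y\<close> lie in the symbolic powers, so \<open>y [^] n\<close>
    would lie in the prime \<open>P0\<close>.\<close>
  obtain y where y: "y \<in> P1" "y \<notin> P0" using lt by auto
  have yR: "y \<in> carrier R" using y prime_subset[OF P1] by auto
  have "y [^] j \<in> ?f j" for j :: nat
  proof (induction j)
    case (Suc j)
    have "y \<otimes> y [^] j \<in> ideal_mult R ?S P1 (?f j)"
      using S.ideal_mult_mem[OF y(1) Suc] by simp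
    then have "y \<otimes> y [^] j \<in> ?h j" using S.set_add_upper2[OF sP0 im] by blast
    then have "y \<otimes> y [^] j \<in> ?f (Suc j)" using hf by blast
    then show ?case using yR by (simp add: m_comm)
  qed simp
  then show False using prime_pow[OF P0 yR] fP0 y(2) by blast
qed

section \<open>Localization\<close>

locale mult_set = cring +
  fixes S
  assumes S_subset: "S \<subseteq> carrier R" and S_one: "\<one> \<in> S"
    and S_mult: "\<And>s t. s \<in> S \<Longrightarrow> t \<in> S \<Longrightarrow> s \<otimes> t \<in> S"
begin

abbreviation rf where "rf \<equiv> ring_fraction R S"
abbreviation L where "L \<equiv> ring_localization R S"

lemma S_carr [simp]: "s \<in> S \<Longrightarrow> s \<in> carrier R"
  using S_subset by auto

end

section \<open>Fractions of a module\<close>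

locale module_mult_set = module R M + mult_set R S
  for R (structure) and M (structure) and S
begin

abbreviation mf where "mf \<equiv> module_fraction M S"
abbreviation LM where "LM \<equiv> module_localization R S M"

lemma mem_mf_iff:
  "(y, t) \<in> mf x s \<longleftrightarrow> y \<in> carrier M \<and> t \<in> S \<and> (\<exists>u\<in>S. u \<odot>\<^bsub>M\<^esub> (t \<odot>\<^bsub>M\<^esub> x) = u \<odot>\<^bsub>M\<^esub> (s \<odot>\<^bsub>M\<^esub> y))"
  by (simp add: module_fraction_def)

lemma mf_self: "x \<in> carrier M \<Longrightarrow> s \<in> S \<Longrightarrow> (x, s) \<in> mf x s"
  using S_one by (auto simp: mem_mf_iff)

lemma mf_subset:
  assumes x: "x \<in> carrier M" "s \<in> S" and y: "y \<in> carrier M" "t \<in> S"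
    and u: "u \<in> S" "u \<odot>\<^bsub>M\<^esub> (t \<odot>\<^bsub>M\<^esub> x) = u \<odot>\<^bsub>M\<^esub> (s \<odot>\<^bsub>M\<^esub> y)"
  shows "mf x s \<subseteq> mf y t"
proof (rule subrelI)
  fix z r assume "(z, r) \<in> mf x s"
  then obtain v where z: "z \<in> carrier M" "r \<in> S" "v \<in> S" "v \<odot>\<^bsub>M\<^esub> (r \<odot>\<^bsub>M\<^esub> x) = v \<odot>\<^bsub>M\<^esub> (s \<odot>\<^bsub>M\<^esub> z)"
    by (auto simp: mem_mf_iff)
  \<comment> \<open>Besides the two given multipliers the denominator \<open>s\<close> appears,
    because the middle fraction \<open>x/s\<close> is eliminated.\<close>
  let ?w = "(u \<otimes> v) \<otimes> s"
  have c: "s \<in> carrier R" "t \<in> carrier R" "u \<in> carrier R" "v \<in> carrier R" "r \<in> carrier R"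
    using x y u z by auto
  have "?w \<odot>\<^bsub>M\<^esub> (r \<odot>\<^bsub>M\<^esub> y) = (v \<otimes> r) \<odot>\<^bsub>M\<^esub> (u \<odot>\<^bsub>M\<^esub> (s \<odot>\<^bsub>M\<^esub> y))"
    using c y(1) by (simp add: R.m_ac smult_assoc1[symmetric])
  also have "\<dots> = (u \<otimes> t) \<odot>\<^bsub>M\<^esub> (v \<odot>\<^bsub>M\<^esub> (r \<odot>\<^bsub>M\<^esub> x))"
    unfolding u(2)[symmetric] using c x(1) by (simp add: R.m_ac smult_assoc1[symmetric])
  also have "\<dots> = ?w \<odot>\<^bsub>M\<^esub> (t \<odot>\<^bsub>M\<^esub> z)"
    unfolding z(4) using c z(1) by (simp add: R.m_ac smult_assoc1[symmetric])
  finally show "(z, r) \<in> mf y t"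
    using z(1,2) S_mult[OF S_mult[OF u(1) z(3)] x(2)] by (auto simp: mem_mf_iff)
qed

lemma mf_eq_iff:
  assumes x: "x \<in> carrier M" "s \<in> S" and y: "y \<in> carrier M" "t \<in> S"
  shows "mf x s = mf y t \<longleftrightarrow> (\<exists>u\<in>S. u \<odot>\<^bsub>M\<^esub> (t \<odot>\<^bsub>M\<^esub> x) = u \<odot>\<^bsub>M\<^esub> (s \<odot>\<^bsub>M\<^esub> y))"
proof
  assume "mf x s = mf y t"
  then have "(y, t) \<in> mf x s" using mf_self[OF y] by simp
  then show "\<exists>u\<in>S. u \<odot>\<^bsub>M\<^esub> (t \<odot>\<^bsub>M\<^esub> x) = u \<odot>\<^bsub>M\<^esub> (s \<odot>\<^bsub>M\<^esub> y)" by (simp add: mem_mf_iff)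
next
  assume "\<exists>u\<in>S. u \<odot>\<^bsub>M\<^esub> (t \<odot>\<^bsub>M\<^esub> x) = u \<odot>\<^bsub>M\<^esub> (s \<odot>\<^bsub>M\<^esub> y)"
  then obtain u where u: "u \<in> S" "u \<odot>\<^bsub>M\<^esub> (t \<odot>\<^bsub>M\<^esub> x) = u \<odot>\<^bsub>M\<^esub> (s \<odot>\<^bsub>M\<^esub> y)" by auto
  show "mf x s = mf y t"
    using mf_subset[OF x y u] mf_subset[OF y x u(1) u(2)[symmetric]] by auto
qed

lemma mf_eqI:
  assumes "x \<in> carrier M" "s \<in> S" "y \<in> carrier M" "t \<in> S" "t \<odot>\<^bsub>M\<^esub> x = s \<odot>\<^bsub>M\<^esub> y"
  shows "mf x s = mf y t"
  using mf_eq_iff[OF assms(1-4)] assms(5) S_one by auto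

lemma mf_mem_eq: "x \<in> carrier M \<Longrightarrow> s \<in> S \<Longrightarrow> (y, t) \<in> mf x s \<Longrightarrow> mf y t = mf x s \<and> y \<in> carrier M \<and> t \<in> S"
  using mf_eq_iff[of x s y t] by (auto simp: mem_mf_iff)

lemma mf_cancel: "x \<in> carrier M \<Longrightarrow> s \<in> S \<Longrightarrow> t \<in> S \<Longrightarrow> mf (t \<odot>\<^bsub>M\<^esub> x) (t \<otimes> s) = mf x s"
  by (rule mf_eqI) (auto simp: S_mult smult_assoc1 smult_commute)

lemma LM_carrier: "carrier LM = {mf x s | x s. x \<in> carrier M \<and> s \<in> S}"
  by (simp add: module_localization_def)

lemma mf_closed [simp]: "x \<in> carrier M \<Longrightarrow> s \<in> S \<Longrightarrow> mf x s \<in> carrier LM"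
  by (auto simp: LM_carrier)

lemma LM_cases:
  assumes "X \<in> carrier LM" obtains x s where "x \<in> carrier M" "s \<in> S" "X = mf x s"
  using assms by (auto simp: LM_carrier)

lemma LM_zero: "\<zero>\<^bsub>LM\<^esub> = mf \<zero>\<^bsub>M\<^esub> \<one>"
  by (simp add: module_localization_def)

text \<open>Operations on fractions are unions over all representatives; this collapses them once
  independence of the representatives is known.\<close>

lemma UN_const_on: "A \<noteq> {} \<Longrightarrow> (\<And>a. a \<in> A \<Longrightarrow> f a = c) \<Longrightarrow> (\<Union>a\<in>A. f a) = c"
  by auto

lemma mf_add_cong:
  assumes x: "x \<in> carrier M" "s \<in> S" and y: "y \<in> carrier M" "t \<in> S"
    and x': "x' \<in> carrier M" "s' \<in> S" "mf x' s' = mf x s"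
    and y': "y' \<in> carrier M" "t' \<in> S" "mf y' t' = mf y t"
  shows "mf ((t' \<odot>\<^bsub>M\<^esub> x') \<oplus>\<^bsub>M\<^esub> (s' \<odot>\<^bsub>M\<^esub> y')) (s' \<otimes> t') = mf ((t \<odot>\<^bsub>M\<^esub> x) \<oplus>\<^bsub>M\<^esub> (s \<odot>\<^bsub>M\<^esub> y)) (s \<otimes> t)"
proof -
  obtain u where u: "u \<in> S" "u \<odot>\<^bsub>M\<^esub> (s \<odot>\<^bsub>M\<^esub> x') = u \<odot>\<^bsub>M\<^esub> (s' \<odot>\<^bsub>M\<^esub> x)"
    using mf_eq_iff[OF x'(1,2) x] x'(3) by auto
  obtain v where v: "v \<in> S" "v \<odot>\<^bsub>M\<^esub> (t \<odot>\<^bsub>M\<^esub> y') = v \<odot>\<^bsub>M\<^esub> (t' \<odot>\<^bsub>M\<^esub> y)"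
    using mf_eq_iff[OF y'(1,2) y] y'(3) by auto
  have c: "s \<in> carrier R" "t \<in> carrier R" "s' \<in> carrier R" "t' \<in> carrier R" "u \<in> carrier R" "v \<in> carrier R"
    using x y x' y' u v by auto
  have "(u \<otimes> v) \<odot>\<^bsub>M\<^esub> ((s \<otimes> t) \<odot>\<^bsub>M\<^esub> ((t' \<odot>\<^bsub>M\<^esub> x') \<oplus>\<^bsub>M\<^esub> (s' \<odot>\<^bsub>M\<^esub> y')))
    = (v \<otimes> t \<otimes> t') \<odot>\<^bsub>M\<^esub> (u \<odot>\<^bsub>M\<^esub> (s \<odot>\<^bsub>M\<^esub> x')) \<oplus>\<^bsub>M\<^esub> (u \<otimes> s \<otimes> s') \<odot>\<^bsub>M\<^esub> (v \<odot>\<^bsub>M\<^esub> (t \<odot>\<^bsub>M\<^esub> y'))"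
    using c x'(1) y'(1) by (simp add: smult_r_distr R.m_ac smult_assoc1[symmetric])
  also have "\<dots> = (v \<otimes> t \<otimes> t') \<odot>\<^bsub>M\<^esub> (u \<odot>\<^bsub>M\<^esub> (s' \<odot>\<^bsub>M\<^esub> x)) \<oplus>\<^bsub>M\<^esub> (u \<otimes> s \<otimes> s') \<odot>\<^bsub>M\<^esub> (v \<odot>\<^bsub>M\<^esub> (t' \<odot>\<^bsub>M\<^esub> y))"
    unfolding u(2) v(2) ..
  also have "\<dots> = (u \<otimes> v) \<odot>\<^bsub>M\<^esub> ((s' \<otimes> t') \<odot>\<^bsub>M\<^esub> ((t \<odot>\<^bsub>M\<^esub> x) \<oplus>\<^bsub>M\<^esub> (s \<odot>\<^bsub>M\<^esub> y)))"
    using c x(1) y(1) by (simp add: smult_r_distr R.m_ac smult_assoc1[symmetric])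
  finally show ?thesis
    using c x y x' y' S_mult[OF u(1) v(1)]
    by (subst mf_eq_iff) (auto intro: S_mult)
qed

lemma LM_add:
  assumes x: "x \<in> carrier M" "s \<in> S" and y: "y \<in> carrier M" "t \<in> S"
  shows "mf x s \<oplus>\<^bsub>LM\<^esub> mf y t = mf ((t \<odot>\<^bsub>M\<^esub> x) \<oplus>\<^bsub>M\<^esub> (s \<odot>\<^bsub>M\<^esub> y)) (s \<otimes> t)" (is "_ = ?c")
proof -
  have "mf x s \<oplus>\<^bsub>LM\<^esub> mf y t = (\<Union>a\<in>mf x s. \<Union>b\<in>mf y t.
      mf ((snd b \<odot>\<^bsub>M\<^esub> fst a) \<oplus>\<^bsub>M\<^esub> (snd a \<odot>\<^bsub>M\<^esub> fst b)) (snd a \<otimes> snd b))"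
    by (simp add: module_localization_def split_def)
  also have "\<dots> = ?c"
  proof (intro UN_const_on)
    show "mf x s \<noteq> {}" "mf y t \<noteq> {}" using mf_self[OF x] mf_self[OF y] by auto
    fix a b assume a: "a \<in> mf x s" and b: "b \<in> mf y t"
    have "mf (fst a) (snd a) = mf x s \<and> fst a \<in> carrier M \<and> snd a \<in> S"
      using a mf_mem_eq[OF x, of "fst a" "snd a"] by simp
    moreover have "mf (fst b) (snd b) = mf y t \<and> fst b \<in> carrier M \<and> snd b \<in> S"
      using b mf_mem_eq[OF y, of "fst b" "snd b"] by simp
    ultimately show "mf ((snd b \<odot>\<^bsub>M\<^esub> fst a) \<oplus>\<^bsub>M\<^esub> (snd a \<odot>\<^bsub>M\<^esub> fst b)) (snd a \<otimes> snd b) = ?c"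
      using mf_add_cong[OF x y] by blast
  qed
  finally show ?thesis .
qed

lemma LM_add_same:
  assumes x: "x \<in> carrier M" and y: "y \<in> carrier M" and s: "s \<in> S"
  shows "mf x s \<oplus>\<^bsub>LM\<^esub> mf y s = mf (x \<oplus>\<^bsub>M\<^esub> y) s"
  using x y s by (simp add: LM_add smult_r_distr[symmetric] mf_cancel)

lemma LM_common_denominator:
  assumes "X \<in> carrier LM" "Y \<in> carrier LM"
  obtains x y s where "x \<in> carrier M" "y \<in> carrier M" "s \<in> S" "X = mf x s" "Y = mf y s"
proof -
  obtain x s where x: "x \<in> carrier M" "s \<in> S" "X = mf x s" using LM_cases[OF assms(1)] .
  obtain y t where y: "y \<in> carrier M" "t \<in> S" "Y = mf y t" using LM_cases[OF assms(2)] .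
  show thesis
  proof (rule that[of "t \<odot>\<^bsub>M\<^esub> x" "s \<odot>\<^bsub>M\<^esub> y" "s \<otimes> t"])
    show "X = mf (t \<odot>\<^bsub>M\<^esub> x) (s \<otimes> t)" "Y = mf (s \<odot>\<^bsub>M\<^esub> y) (s \<otimes> t)"
      using x y mf_cancel[OF x(1,2) y(2)] mf_cancel[OF y(1,2) x(2)] by (simp_all add: R.m_comm)
  qed (use x y in \<open>auto intro: S_mult\<close>)
qed

lemma mf_zero: "s \<in> S \<Longrightarrow> mf \<zero>\<^bsub>M\<^esub> s = \<zero>\<^bsub>LM\<^esub>"
  unfolding LM_zero by (rule mf_eqI) (auto simp: S_one)

lemma abelian_group_LM: "abelian_group LM"
proof (rule abelian_groupI)
  show "\<zero>\<^bsub>LM\<^esub> \<in> carrier LM" unfolding LM_zero by (simp add: S_one)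
  fix X Y assume X: "X \<in> carrier LM" and Y: "Y \<in> carrier LM"
  obtain x y s where xy: "x \<in> carrier M" "y \<in> carrier M" "s \<in> S" "X = mf x s" "Y = mf y s"
    using LM_common_denominator[OF X Y] .
  show "X \<oplus>\<^bsub>LM\<^esub> Y \<in> carrier LM" using xy by (simp add: LM_add_same)
  show "X \<oplus>\<^bsub>LM\<^esub> Y = Y \<oplus>\<^bsub>LM\<^esub> X" using xy by (simp add: LM_add_same M.a_comm)
  show "\<zero>\<^bsub>LM\<^esub> \<oplus>\<^bsub>LM\<^esub> X = X" using xy mf_zero[of s] LM_add_same[of "\<zero>\<^bsub>M\<^esub>" x s] by simp
  show "\<exists>Z\<in>carrier LM. Z \<oplus>\<^bsub>LM\<^esub> X = \<zero>\<^bsub>LM\<^esub>"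
    using xy by (intro bexI[of _ "mf (\<ominus>\<^bsub>M\<^esub> x) s"]) (auto simp: LM_add_same M.l_neg mf_zero)
  fix Z assume "Z \<in> carrier LM"
  then obtain z t where z: "z \<in> carrier M" "t \<in> S" "Z = mf z t" by (rule LM_cases)
  have c: "s \<in> carrier R" "t \<in> carrier R" using xy z by auto
  show "X \<oplus>\<^bsub>LM\<^esub> Y \<oplus>\<^bsub>LM\<^esub> Z = X \<oplus>\<^bsub>LM\<^esub> (Y \<oplus>\<^bsub>LM\<^esub> Z)"
    unfolding xy(4,5) z(3) using xy(1-3) z(1,2) c
    by (simp add: LM_add S_mult) (intro mf_eqI, auto simp: S_mult smult_r_distr M.a_ac R.m_ac smult_assoc1[symmetric])
qed

end

section \<open>Fractions of the ring\<close>

context mult_set begin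

lemma self_mult_set: "module_mult_set R (self_module R) S"
  by (intro module_mult_set.intro self_module) (rule mult_set_axioms)

text \<open>Through this identity the laws for ring fractions follow from those of
  \<open>self_module R\<close>, with multiplication as the scalar action.\<close>

lemma ring_fraction_eq: "ring_fraction R S = module_fraction (self_module R) S"
  by (intro ext) (simp add: ring_fraction_def module_fraction_def)

lemma carrier_L: "carrier L = carrier (module_localization R S (self_module R))"
  and add_L: "add L = add (module_localization R S (self_module R))"
  and zero_L: "zero L = zero (module_localization R S (self_module R))"
  and mult_L: "mult L = smult (module_localization R S (self_module R))"
  by (simp_all add: ring_localization_def module_localization_def ring_fraction_eq)

lemma rf_eq_iff:
  assumes "a \<in> carrier R" "s \<in> S" "b \<in> carrier R" "t \<in> S"
  shows "rf a s = rf b t \<longleftrightarrow> (\<exists>u\<in>S. u \<otimes> (t \<otimes> a) = u \<otimes> (s \<otimes> b))"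
  using module_mult_set.mf_eq_iff[OF self_mult_set, of a s b t] assms by (simp add: ring_fraction_eq)

lemma rf_closed [simp]: "a \<in> carrier R \<Longrightarrow> s \<in> S \<Longrightarrow> rf a s \<in> carrier L"
  by (auto simp: ring_localization_def)

lemma L_cases:
  assumes "X \<in> carrier L" obtains x s where "x \<in> carrier R" "s \<in> S" "X = rf x s"
  using assms by (auto simp: ring_localization_def)

lemma rf_cancel: "a \<in> carrier R \<Longrightarrow> s \<in> S \<Longrightarrow> t \<in> S \<Longrightarrow> rf (t \<otimes> a) (t \<otimes> s) = rf a s"
  using module_mult_set.mf_cancel[OF self_mult_set, of a s t] by (simp add: ring_fraction_eq)

lemma rf_eqI:
  "a \<in> carrier R \<Longrightarrow> s \<in> S \<Longrightarrow> b \<in> carrier R \<Longrightarrow> t \<in> S \<Longrightarrow> t \<otimes> a = s \<otimes> b \<Longrightarrow> rf a s = rf b t"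
  using module_mult_set.mf_eqI[OF self_mult_set, of a s b t] by (simp add: ring_fraction_eq)

end

context module_mult_set begin

lemma mf_smult_cong:
  assumes a: "a \<in> carrier R" "s \<in> S" and x: "x \<in> carrier M" "t \<in> S"
    and a': "a' \<in> carrier R" "s' \<in> S" "rf a' s' = rf a s"
    and x': "x' \<in> carrier M" "t' \<in> S" "mf x' t' = mf x t"
  shows "mf (a' \<odot>\<^bsub>M\<^esub> x') (s' \<otimes> t') = mf (a \<odot>\<^bsub>M\<^esub> x) (s \<otimes> t)"
proof -
  obtain u where u: "u \<in> S" "u \<otimes> (s \<otimes> a') = u \<otimes> (s' \<otimes> a)"
    using rf_eq_iff[OF a'(1,2) a] a'(3) by auto
  obtain v where v: "v \<in> S" "v \<odot>\<^bsub>M\<^esub> (t \<odot>\<^bsub>M\<^esub> x') = v \<odot>\<^bsub>M\<^esub> (t' \<odot>\<^bsub>M\<^esub> x)"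
    using mf_eq_iff[OF x'(1,2) x] x'(3) by auto
  have c: "s \<in> carrier R" "t \<in> carrier R" "s' \<in> carrier R" "t' \<in> carrier R" "u \<in> carrier R" "v \<in> carrier R"
    using a x a' x' u v by auto
  have "(u \<otimes> v) \<odot>\<^bsub>M\<^esub> ((s \<otimes> t) \<odot>\<^bsub>M\<^esub> (a' \<odot>\<^bsub>M\<^esub> x')) = (u \<otimes> (s \<otimes> a')) \<odot>\<^bsub>M\<^esub> (v \<odot>\<^bsub>M\<^esub> (t \<odot>\<^bsub>M\<^esub> x'))"
    using c a'(1) x'(1) by (simp add: R.m_ac smult_assoc1[symmetric])
  also have "\<dots> = (u \<otimes> (s' \<otimes> a)) \<odot>\<^bsub>M\<^esub> (v \<odot>\<^bsub>M\<^esub> (t' \<odot>\<^bsub>M\<^esub> x))" unfolding u(2) v(2) ..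
  also have "\<dots> = (u \<otimes> v) \<odot>\<^bsub>M\<^esub> ((s' \<otimes> t') \<odot>\<^bsub>M\<^esub> (a \<odot>\<^bsub>M\<^esub> x))"
    using c a(1) x(1) by (simp add: R.m_ac smult_assoc1[symmetric])
  finally show ?thesis
    using c a x a' x' S_mult[OF u(1) v(1)]
    by (subst mf_eq_iff) (auto intro: S_mult)
qed

lemma LM_smult:
  assumes a: "a \<in> carrier R" "s \<in> S" and x: "x \<in> carrier M" "t \<in> S"
  shows "rf a s \<odot>\<^bsub>LM\<^esub> mf x t = mf (a \<odot>\<^bsub>M\<^esub> x) (s \<otimes> t)" (is "_ = ?c")
proof -
  interpret F: module_mult_set R "self_module R" S by (rule self_mult_set)
  have "rf a s \<odot>\<^bsub>LM\<^esub> mf x t = (\<Union>p\<in>rf a s. \<Union>q\<in>mf x t. mf (fst p \<odot>\<^bsub>M\<^esub> fst q) (snd p \<otimes> snd q))"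
    by (simp add: module_localization_def split_def)
  also have "\<dots> = ?c"
  proof (intro UN_const_on)
    show "rf a s \<noteq> {}" "mf x t \<noteq> {}"
      using F.mf_self[of a s] mf_self[OF x] a by (auto simp: ring_fraction_eq)
    fix p q assume p: "p \<in> rf a s" and q: "q \<in> mf x t"
    have "rf (fst p) (snd p) = rf a s \<and> fst p \<in> carrier R \<and> snd p \<in> S"
      using p F.mf_mem_eq[of a s "fst p" "snd p"] a by (simp add: ring_fraction_eq)
    moreover have "mf (fst q) (snd q) = mf x t \<and> fst q \<in> carrier M \<and> snd q \<in> S"
      using q mf_mem_eq[OF x, of "fst q" "snd q"] by simp
    ultimately show "mf (fst p \<odot>\<^bsub>M\<^esub> fst q) (snd p \<otimes> snd q) = ?c"
      using mf_smult_cong[OF a x] by blast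
  qed
  finally show ?thesis .
qed

end

context mult_set begin

lemma L_add_same:
  assumes "a \<in> carrier R" "b \<in> carrier R" "s \<in> S"
  shows "rf a s \<oplus>\<^bsub>L\<^esub> rf b s = rf (a \<oplus> b) s"
  using module_mult_set.LM_add_same[OF self_mult_set, of a b s] assms by (simp add: ring_fraction_eq add_L)

lemma L_mult:
  assumes "a \<in> carrier R" "s \<in> S" "b \<in> carrier R" "t \<in> S"
  shows "rf a s \<otimes>\<^bsub>L\<^esub> rf b t = rf (a \<otimes> b) (s \<otimes> t)"
  using module_mult_set.LM_smult[OF self_mult_set, of a s b t] assms by (simp add: ring_fraction_eq mult_L)

lemma L_one: "\<one>\<^bsub>L\<^esub> = rf \<one> \<one>"
  by (simp add: ring_localization_def)

lemma L_zero: "\<zero>\<^bsub>L\<^esub> = rf \<zero> \<one>"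
  by (simp add: ring_localization_def)

lemma L_common_denominator:
  assumes "X \<in> carrier L" "Y \<in> carrier L"
  obtains x y s where "x \<in> carrier R" "y \<in> carrier R" "s \<in> S" "X = rf x s" "Y = rf y s"
  using module_mult_set.LM_common_denominator[OF self_mult_set, of X Y] assms
  by (auto simp: ring_fraction_eq carrier_L)

lemma cring_L: "cring L"
proof (rule cringI)
  interpret A: abelian_group "module_localization R S (self_module R)"
    using module_mult_set.abelian_group_LM[OF self_mult_set] .
  show "abelian_group L"
  proof (rule abelian_groupI)
    show "\<exists>y\<in>carrier L. y \<oplus>\<^bsub>L\<^esub> x = \<zero>\<^bsub>L\<^esub>" if "x \<in> carrier L" for x
      using that A.l_neg[of x] A.a_inv_closed[of x] unfolding carrier_L add_L zero_L by blast
  qed (auto simp: carrier_L add_L zero_L A.a_ac)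
  show "comm_monoid L"
  proof (rule comm_monoidI)
    show "\<one>\<^bsub>L\<^esub> \<in> carrier L" by (simp add: L_one S_one)
    fix x y assume x: "x \<in> carrier L" and y: "y \<in> carrier L"
    obtain a s where a: "a \<in> carrier R" "s \<in> S" "x = rf a s" using L_cases[OF x] .
    obtain b t where b: "b \<in> carrier R" "t \<in> S" "y = rf b t" using L_cases[OF y] .
    show "x \<otimes>\<^bsub>L\<^esub> y \<in> carrier L" using a b by (simp add: L_mult S_mult)
    show "x \<otimes>\<^bsub>L\<^esub> y = y \<otimes>\<^bsub>L\<^esub> x" using a b by (simp add: L_mult m_comm)
    show "\<one>\<^bsub>L\<^esub> \<otimes>\<^bsub>L\<^esub> x = x" using a by (simp add: L_mult L_one S_one)
    fix z assume "z \<in> carrier L"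
    then obtain c r where "c \<in> carrier R" "r \<in> S" "z = rf c r" by (rule L_cases)
    then show "x \<otimes>\<^bsub>L\<^esub> y \<otimes>\<^bsub>L\<^esub> z = x \<otimes>\<^bsub>L\<^esub> (y \<otimes>\<^bsub>L\<^esub> z)"
      using a b by (simp add: L_mult S_mult m_assoc)
  qed
  fix x y z assume x: "x \<in> carrier L" and y: "y \<in> carrier L" and z: "z \<in> carrier L"
  obtain a b s where a: "a \<in> carrier R" "b \<in> carrier R" "s \<in> S" "x = rf a s" "y = rf b s"
    using L_common_denominator[OF x y] .
  obtain c t where c: "c \<in> carrier R" "t \<in> S" "z = rf c t" using L_cases[OF z] .
  show "(x \<oplus>\<^bsub>L\<^esub> y) \<otimes>\<^bsub>L\<^esub> z = x \<otimes>\<^bsub>L\<^esub> z \<oplus>\<^bsub>L\<^esub> y \<otimes>\<^bsub>L\<^esub> z"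
    using a c by (simp add: L_mult L_add_same S_mult l_distr)
qed

end

lemma (in module_mult_set) module_LM: "module L LM"
proof (rule moduleI)
  show "cring L" by (rule cring_L)
  show "abelian_group LM" by (rule abelian_group_LM)
  fix A X assume A: "A \<in> carrier L" and X: "X \<in> carrier LM"
  obtain a s where a: "a \<in> carrier R" "s \<in> S" "A = rf a s" using L_cases[OF A] .
  obtain x t where x: "x \<in> carrier M" "t \<in> S" "X = mf x t" using LM_cases[OF X] .
  show "A \<odot>\<^bsub>LM\<^esub> X \<in> carrier LM" using a x by (simp add: LM_smult S_mult)
  {
    fix B assume B: "B \<in> carrier L"
    obtain a b s where a: "a \<in> carrier R" "b \<in> carrier R" "s \<in> S" "A = rf a s" "B = rf b s"
      using L_common_denominator[OF A B] .
    show "(A \<oplus>\<^bsub>L\<^esub> B) \<odot>\<^bsub>LM\<^esub> X = A \<odot>\<^bsub>LM\<^esub> X \<oplus>\<^bsub>LM\<^esub> B \<odot>\<^bsub>LM\<^esub> X"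
      using a x by (simp add: LM_smult L_add_same LM_add_same S_mult smult_l_distr)
    show "(A \<otimes>\<^bsub>L\<^esub> B) \<odot>\<^bsub>LM\<^esub> X = A \<odot>\<^bsub>LM\<^esub> (B \<odot>\<^bsub>LM\<^esub> X)"
      using a x by (simp add: LM_smult L_mult S_mult smult_assoc1 R.m_assoc)
  }
  fix Y assume Y: "Y \<in> carrier LM"
  obtain x y t where x: "x \<in> carrier M" "y \<in> carrier M" "t \<in> S" "X = mf x t" "Y = mf y t"
    using LM_common_denominator[OF X Y] .
  show "A \<odot>\<^bsub>LM\<^esub> (X \<oplus>\<^bsub>LM\<^esub> Y) = A \<odot>\<^bsub>LM\<^esub> X \<oplus>\<^bsub>LM\<^esub> A \<odot>\<^bsub>LM\<^esub> Y"
    using a x by (simp add: LM_smult LM_add_same S_mult smult_r_distr)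
next
  fix X assume "X \<in> carrier LM"
  then obtain x t where x: "x \<in> carrier M" "t \<in> S" "X = mf x t" by (rule LM_cases)
  then show "\<one>\<^bsub>L\<^esub> \<odot>\<^bsub>LM\<^esub> X = X" by (simp add: LM_smult L_one S_one)
qed

section \<open>Primes of a localization and the height theorem\<close>

definition contraction :: "('a, 'r) ring_scheme \<Rightarrow> 'a set \<Rightarrow> ('a \<times> 'a) set set \<Rightarrow> 'a set"
  where "contraction R S I = {a \<in> carrier R. ring_fraction R S a \<one>\<^bsub>R\<^esub> \<in> I}"

definition extension :: "('a, 'r) ring_scheme \<Rightarrow> 'a set \<Rightarrow> 'a set \<Rightarrow> ('a \<times> 'a) set set"
  where "extension R S P = {ring_fraction R S a s | a s. a \<in> P \<and> s \<in> S}"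

definition loc_ext :: "('a, 'b, 'm) module_scheme \<Rightarrow> 'a set \<Rightarrow> 'b set \<Rightarrow> ('b \<times> 'a) set set"
  where "loc_ext M S N = {module_fraction M S x s | x s. x \<in> N \<and> s \<in> S}"

lemma (in cring) local_ring_max_ideal:
  assumes m: "ideal m R" "\<one> \<notin> m" and units: "\<And>a. a \<in> carrier R \<Longrightarrow> a \<notin> m \<Longrightarrow> a \<in> Units R"
  shows "local_ring R \<and> max_ideal R = m"
proof -
  have le: "I \<subseteq> m" if I: "ideal I R" "I \<noteq> carrier R" for I
  proof
    fix a assume a: "a \<in> I"
    show "a \<in> m"
    proof (rule ccontr)
      assume "a \<notin> m"
      then have "a \<in> Units R" using units a ideal_subset[OF I(1)] by auto
      then have "\<one> \<in> I" using ideal_lmult[OF I(1) a, of "inv a"] by simp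
      then show False using ideal.one_imp_carrier[OF I(1)] I(2) by auto
    qed
  qed
  have mm: "maximalideal m R"
    by (rule maximalidealI[OF m(1)]) (use m le in auto)
  have eq: "I = m" if I: "maximalideal I R" for I
  proof -
    have "ideal I R" "I \<noteq> carrier R" using I by (auto simp: maximalideal_def maximalideal_axioms_def)
    then have "I \<subseteq> m" by (rule le)
    then show ?thesis using maximalideal.I_maximal[OF I m(1)] ideal_subset[OF m(1)] m(2) by auto
  qed
  have "\<exists>!m. maximalideal m R" using mm eq by (rule ex1I)
  moreover have "max_ideal R = m" unfolding max_ideal_def using mm eq by (rule the_equality)
  ultimately show ?thesis unfolding local_ring_def using is_cring by simp
qed

lemma prime_chain_SucD:
  "prime_chain R (Suc n) Q P \<Longrightarrow> \<exists>Q'. primeideal Q R \<and> Q \<subset> Q' \<and> prime_chain R n Q' P"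
  by (erule prime_chain.cases) auto

lemma prime_chain_0D: "prime_chain R 0 Q P \<Longrightarrow> Q = P"
  by (erule prime_chain.cases) auto

context mult_set begin

lemma rf_add1: "a \<in> carrier R \<Longrightarrow> b \<in> carrier R \<Longrightarrow> rf (a \<oplus> b) \<one> = rf a \<one> \<oplus>\<^bsub>L\<^esub> rf b \<one>"
  by (simp add: L_add_same S_one)

lemma rf_mult1: "a \<in> carrier R \<Longrightarrow> b \<in> carrier R \<Longrightarrow> rf (a \<otimes> b) \<one> = rf a \<one> \<otimes>\<^bsub>L\<^esub> rf b \<one>"
  by (simp add: L_mult S_one)

text \<open>The fractions \<open>a/s\<close> and \<open>a/1\<close> differ by the unit
  \<open>s/1\<close>. Hence an ideal of the localization is determined by its contraction.\<close>

lemma rf_mem_ideal_iff: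
  assumes I: "ideal I L" and a: "a \<in> carrier R" "s \<in> S"
  shows "rf a s \<in> I \<longleftrightarrow> rf a \<one> \<in> I"
proof
  assume "rf a s \<in> I"
  then have "rf s \<one> \<otimes>\<^bsub>L\<^esub> rf a s \<in> I" using ideal_lmult[OF I] a S_one by simp
  moreover have "rf s \<one> \<otimes>\<^bsub>L\<^esub> rf a s = rf a \<one>"
    using a S_one S_mult rf_cancel[of a \<one> s] by (simp add: L_mult)
  ultimately show "rf a \<one> \<in> I" by simp
next
  assume "rf a \<one> \<in> I"
  then have "rf \<one> s \<otimes>\<^bsub>L\<^esub> rf a \<one> \<in> I" using ideal_lmult[OF I] a by simp
  moreover have "rf \<one> s \<otimes>\<^bsub>L\<^esub> rf a \<one> = rf a s" using a S_one by (simp add: L_mult)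
  ultimately show "rf a s \<in> I" by simp
qed

lemma contraction_ideal:
  assumes I: "ideal I L" shows "ideal (contraction R S I) R"
proof (rule idealI_cring)
  show "\<zero> \<in> contraction R S I" using ideal_zero[OF I] by (simp add: contraction_def L_zero)
  show "a \<oplus> b \<in> contraction R S I" if "a \<in> contraction R S I" "b \<in> contraction R S I" for a b
    using that ideal_add[OF I] by (auto simp: contraction_def rf_add1)
  show "r \<otimes> a \<in> contraction R S I" if "a \<in> contraction R S I" "r \<in> carrier R" for a r
    using that ideal_lmult[OF I] S_one by (auto simp: contraction_def rf_mult1)
qed (auto simp: contraction_def)

lemma contraction_mono_iff:
  assumes I: "ideal I L" and J: "ideal J L"
  shows "contraction R S I \<subseteq> contraction R S J \<longleftrightarrow> I \<subseteq> J"
proof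
  assume le: "contraction R S I \<subseteq> contraction R S J"
  show "I \<subseteq> J"
  proof
    fix X assume X: "X \<in> I"
    then obtain a s where a: "a \<in> carrier R" "s \<in> S" "X = rf a s"
      using ideal_subset[OF I] L_cases by blast
    then show "X \<in> J" using X le rf_mem_ideal_iff[OF I a(1,2)] rf_mem_ideal_iff[OF J a(1,2)]
      by (auto simp: contraction_def)
  qed
qed (auto simp: contraction_def)

lemma contraction_prime:
  assumes P: "primeideal P L"
  shows "primeideal (contraction R S P) R" and "contraction R S P \<inter> S = {}"
proof -
  show "primeideal (contraction R S P) R"
  proof (rule primeidealI_cring[OF contraction_ideal[OF prime_ideal[OF P]]])
    show "\<one> \<notin> contraction R S P" using prime_one[OF P] by (simp add: contraction_def L_one)
    show "b \<in> contraction R S P"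
      if "a \<in> carrier R" "b \<in> carrier R" "a \<otimes> b \<in> contraction R S P" "a \<notin> contraction R S P" for a b
      using that prime_mult[OF P, of "rf a \<one>" "rf b \<one>"] S_one by (auto simp: contraction_def rf_mult1)
  qed
  show "contraction R S P \<inter> S = {}"
  proof (rule ccontr)
    assume "\<not> ?thesis"
    then obtain s where s: "s \<in> S" "rf s \<one> \<in> P" by (auto simp: contraction_def)
    then have "rf s s \<in> P" using rf_mem_ideal_iff[OF prime_ideal[OF P], of s s] by simp
    moreover have "rf s s = rf \<one> \<one>" using s S_one by (intro rf_eqI) auto
    ultimately show False using prime_one[OF P] by (simp add: L_one)
  qed
qed

text \<open>Membership does not depend on the representative: two representations of a fraction are
  related by factors from \<open>S\<close>, and these can be cancelled modulo the prime
  \<open>P\<close>.\<close>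

lemma rf_mem_extension_iff:
  assumes P: "primeideal P R" "P \<inter> S = {}" and a: "a \<in> carrier R" "s \<in> S"
  shows "rf a s \<in> extension R S P \<longleftrightarrow> a \<in> P"
proof
  assume "rf a s \<in> extension R S P"
  then obtain b t where b: "b \<in> P" "t \<in> S" "rf a s = rf b t" by (auto simp: extension_def)
  have bR: "b \<in> carrier R" using b prime_subset[OF P(1)] by auto
  obtain u where u: "u \<in> S" "u \<otimes> (t \<otimes> a) = u \<otimes> (s \<otimes> b)"
    using rf_eq_iff[OF a bR b(2)] b(3) by auto
  have "u \<otimes> (s \<otimes> b) \<in> P" using b(1) u(1) a(2) by (intro ideal_lmult[OF prime_ideal[OF P(1)]]) auto
  then have "(u \<otimes> t) \<otimes> a \<in> P" using u a(1) b(2) by (simp add: m_assoc)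
  then show "a \<in> P" using prime_mult[OF P(1), of "u \<otimes> t" a] a(1) S_mult[OF u(1) b(2)] P(2) by auto
qed (use a in \<open>auto simp: extension_def\<close>)

lemma extension_prime:
  assumes P: "primeideal P R" "P \<inter> S = {}"
  shows "primeideal (extension R S P) L"
proof -
  interpret L: cring L by (rule cring_L)
  note Pi = prime_ideal[OF P(1)]
  note mem = rf_mem_extension_iff[OF P]
  show ?thesis
  proof (rule L.primeidealI_cring[OF L.idealI_cring])
    show sub: "extension R S P \<subseteq> carrier L"
      using prime_subset[OF P(1)] by (auto simp: extension_def)
    show "\<zero>\<^bsub>L\<^esub> \<in> extension R S P" using mem[of \<zero> \<one>] ideal_zero[OF Pi] S_one by (simp add: L_zero)
    show "\<one>\<^bsub>L\<^esub> \<notin> extension R S P" using mem[of \<one> \<one>] prime_one[OF P(1)] S_one by (simp add: L_one)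
    show "X \<oplus>\<^bsub>L\<^esub> Y \<in> extension R S P" if XY: "X \<in> extension R S P" "Y \<in> extension R S P" for X Y
    proof -
      obtain x y s where x: "x \<in> carrier R" "y \<in> carrier R" "s \<in> S" "X = rf x s" "Y = rf y s"
        using L_common_denominator[of X Y] XY sub by blast
      then show ?thesis using XY ideal_add[OF Pi] by (simp add: L_add_same mem)
    qed
    show "A \<otimes>\<^bsub>L\<^esub> X \<in> extension R S P" if AX: "X \<in> extension R S P" "A \<in> carrier L" for X A
    proof -
      obtain x s where x: "x \<in> carrier R" "s \<in> S" "X = rf x s" using L_cases[of X] AX sub by blast
      obtain a t where a: "a \<in> carrier R" "t \<in> S" "A = rf a t" using L_cases[OF AX(2)] .
      show ?thesis using AX(1) x a ideal_lmult[OF Pi] by (simp add: L_mult mem S_mult)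
    qed
    show "B \<in> extension R S P"
      if AB: "A \<in> carrier L" "B \<in> carrier L" "A \<otimes>\<^bsub>L\<^esub> B \<in> extension R S P" "A \<notin> extension R S P" for A B
    proof -
      obtain a t where a: "a \<in> carrier R" "t \<in> S" "A = rf a t" using L_cases[OF AB(1)] .
      obtain b s where b: "b \<in> carrier R" "s \<in> S" "B = rf b s" using L_cases[OF AB(2)] .
      show ?thesis using AB(3,4) a b prime_mult[OF P(1), of a b] by (simp add: L_mult mem S_mult)
    qed
  qed
qed

lemma contraction_extension:
  assumes P: "primeideal P R" "P \<inter> S = {}"
  shows "contraction R S (extension R S P) = P"
  using rf_mem_extension_iff[OF P] S_one prime_subset[OF P(1)] by (auto simp: contraction_def)

lemma extension_contraction:
  assumes "primeideal P L" shows "extension R S (contraction R S P) = P"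
proof -
  note c = contraction_prime[OF assms]
  have "contraction R S (extension R S (contraction R S P)) = contraction R S P"
    by (rule contraction_extension[OF c])
  then show ?thesis
    using contraction_mono_iff[OF prime_ideal[OF extension_prime[OF c]] prime_ideal[OF assms]]
      contraction_mono_iff[OF prime_ideal[OF assms] prime_ideal[OF extension_prime[OF c]]] by auto
qed

lemma contraction_strict_mono:
  assumes "primeideal P L" "primeideal Q L" "P \<subset> Q"
  shows "contraction R S P \<subset> contraction R S Q"
  using assms contraction_mono_iff[of P Q] contraction_mono_iff[of Q P] prime_ideal by blast

lemma extension_mono: "P \<subseteq> Q \<Longrightarrow> extension R S P \<subseteq> extension R S Q"
  by (auto simp: extension_def)

lemma extension_strict_mono:
  assumes "primeideal P R" "primeideal Q R" "P \<subset> Q" "Q \<inter> S = {}"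
  shows "extension R S P \<subset> extension R S Q"
proof -
  have "P \<inter> S = {}" using assms by auto
  then have "contraction R S (extension R S P) \<noteq> contraction R S (extension R S Q)"
    unfolding contraction_extension[OF assms(1) \<open>P \<inter> S = {}\<close>] contraction_extension[OF assms(2,4)]
    using assms(3) by blast
  then have "extension R S P \<noteq> extension R S Q" by metis
  then show ?thesis using extension_mono[OF psubset_imp_subset[OF assms(3)]] by blast
qed

lemma prime_chain_contraction:
  "prime_chain L n Q P \<Longrightarrow> prime_chain R n (contraction R S Q) (contraction R S P)"
proof (induction rule: prime_chain.induct)
  case (refl P)
  then show ?case using contraction_prime prime_chain.refl by blast
next
  case (step Q Q' n P)
  have "primeideal Q' L" using step.hyps(3) prime_chain_facts by blast
  then show ?case
    using prime_chain.step[OF contraction_prime(1)[OF step.hyps(1)] contraction_strict_mono[OF step.hyps(1) _ step.hyps(2)] step.IH]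
    by blast
qed

lemma prime_chain_extension:
  "prime_chain R n Q P \<Longrightarrow> P \<inter> S = {} \<Longrightarrow> prime_chain L n (extension R S Q) (extension R S P)"
proof (induction rule: prime_chain.induct)
  case (refl P)
  then show ?case using extension_prime prime_chain.refl by blast
next
  case (step Q Q' n P)
  have Q': "primeideal Q' R" "Q' \<subseteq> P" using step.hyps(3) prime_chain_facts by blast+
  then have dis: "Q \<inter> S = {}" "Q' \<inter> S = {}" using step.hyps(2) step.prems by auto
  show ?case
    using prime_chain.step[OF extension_prime[OF step.hyps(1) dis(1)]
        extension_strict_mono[OF step.hyps(1) Q'(1) step.hyps(2) dis(2)] step.IH[OF step.prems]] .
qed

text \<open>Inclusions of ideals can be tested after contraction, so the images of generators of the
  contraction generate the ideal.\<close>

lemma noetherian_L: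
  assumes noeth: "noetherian_ring R" shows "noetherian_ring L"
proof -
  interpret L: cring L by (rule cring_L)
  show ?thesis
  proof (rule L.noetherian_ringI)
    fix I assume I: "ideal I L"
    obtain A where A: "A \<subseteq> carrier R" "finite A" "contraction R S I = Idl A"
      using noetherian_ring.finetely_gen[OF noeth contraction_ideal[OF I]] by auto
    let ?A = "(\<lambda>a. rf a \<one>) ` A"
    have sub: "?A \<subseteq> carrier L" using A(1) S_one by auto
    have idl: "ideal (Idl\<^bsub>L\<^esub> ?A) L" by (rule L.genideal_ideal[OF sub])
    have "A \<subseteq> contraction R S (Idl\<^bsub>L\<^esub> ?A)"
      using A(1) L.genideal_self[OF sub] by (auto simp: contraction_def)
    then have "contraction R S I \<subseteq> contraction R S (Idl\<^bsub>L\<^esub> ?A)"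
      unfolding A(3) by (rule genideal_minimal[OF contraction_ideal[OF idl]])
    then have "I \<subseteq> Idl\<^bsub>L\<^esub> ?A" using contraction_mono_iff[OF I idl] by simp
    moreover have "?A \<subseteq> I" using genideal_self[OF A(1)] A(3) by (auto simp: contraction_def)
    then have "Idl\<^bsub>L\<^esub> ?A \<subseteq> I" by (rule L.genideal_minimal[OF I])
    ultimately show "\<exists>A\<subseteq>carrier L. finite A \<and> I = Idl\<^bsub>L\<^esub> A" using sub A(2) by blast
  qed
qed

end

lemma (in cring) mult_set_prime: "primeideal P R \<Longrightarrow> mult_set R (carrier R - P)"
  by (intro mult_set.intro mult_set_axioms.intro is_cring) (use prime_complement[of P] in auto)

lemma (in cring) localization_units:
  assumes P: "primeideal P R" and X: "X \<in> carrier (ring_localization R (carrier R - P))"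
    "X \<notin> extension R (carrier R - P) P"
  shows "X \<in> Units (ring_localization R (carrier R - P))"
proof -
  interpret mult_set R "carrier R - P" by (rule mult_set_prime[OF P])
  obtain a s where a: "a \<in> carrier R" "s \<in> carrier R - P" "X = rf a s" using L_cases[OF X(1)] .
  have "a \<notin> P" using X(2) a rf_mem_extension_iff[OF P _ a(1,2)] by auto
  then have aS: "a \<in> carrier R - P" using a by simp
  interpret L: cring L by (rule cring_L)
  have "X \<otimes>\<^bsub>L\<^esub> rf s a = \<one>\<^bsub>L\<^esub>"
  proof -
    have "rf a s \<otimes>\<^bsub>L\<^esub> rf s a = rf (a \<otimes> s) (a \<otimes> s)" using a aS by (simp add: L_mult m_comm)
    also have "\<dots> = rf \<one> \<one>"
      using a(1,2) S_mult[OF aS a(2)] S_one by (intro rf_eqI) auto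
    finally show ?thesis unfolding a(3) L_one .
  qed
  moreover have "rf s a \<in> carrier L" using a aS by auto
  ultimately show ?thesis using X(1) L.m_comm[of X "rf s a"] unfolding Units_def by auto
qed

lemma (in cring) local_ring_localization:
  assumes P: "primeideal P R"
  shows "local_ring (ring_localization R (carrier R - P)) \<and>
    max_ideal (ring_localization R (carrier R - P)) = extension R (carrier R - P) P"
proof -
  interpret mult_set R "carrier R - P" by (rule mult_set_prime[OF P])
  have E: "primeideal (extension R (carrier R - P) P) L" by (rule extension_prime[OF P]) auto
  show ?thesis
    by (rule cring.local_ring_max_ideal[OF cring_L prime_ideal[OF E] prime_one[OF E] localization_units[OF P]])
qed

section \<open>Krull's height theorem\<close>

text \<open>The form in which Krull's theorem is used: \<open>P2\<close> is not minimal over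
  \<open>P0 + (x)\<close> if some prime lies strictly between \<open>P0\<close> and
  \<open>P2\<close>. Localizing at \<open>P2\<close> keeps exactly the primes inside
  \<open>P2\<close>, which reduces it to the local case.\<close>

lemma (in cring) principal_ideal_theorem:
  assumes noeth: "noetherian_ring R" and P0: "primeideal P0 R" and P1: "primeideal P1 R" and P2: "primeideal P2 R"
    and lt: "P0 \<subset> P1" "P1 \<subset> P2" and x: "x \<in> P2"
  shows "\<exists>Q. primeideal Q R \<and> P0 \<subseteq> Q \<and> x \<in> Q \<and> Q \<subset> P2"
proof (rule ccontr)
  assume neg: "\<not> ?thesis"
  let ?S = "carrier R - P2"
  interpret mult_set R ?S by (rule mult_set_prime[OF P2])
  interpret L: cring L by (rule cring_L)
  have xR: "x \<in> carrier R" using x prime_subset[OF P2] by auto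
  have dis: "P0 \<inter> ?S = {}" "P1 \<inter> ?S = {}" "P2 \<inter> ?S = {}" using lt by auto
  show False
  proof (rule L.principal_ideal_theorem_local[OF noetherian_L[OF noeth] extension_prime[OF P2 dis(3)] _
        extension_prime[OF P0 dis(1)] extension_prime[OF P1 dis(2)] extension_strict_mono[OF P0 P1 lt(1) dis(2)]
        extension_strict_mono[OF P1 P2 lt(2) dis(3)], of "rf x \<one>"])
    show "a \<in> Units L" if "a \<in> carrier L" "a \<notin> extension R ?S P2" for a
      using localization_units[OF P2 that] .
    show "rf x \<one> \<in> extension R ?S P2" using rf_mem_extension_iff[OF P2 dis(3) xR S_one] x by simp
    fix Q assume Q: "primeideal Q L" "extension R ?S P0 \<subseteq> Q" "rf x \<one> \<in> Q"
    note c = contraction_prime[OF Q(1)]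
    have "P0 \<subseteq> contraction R ?S Q"
      using Q(2) prime_subset[OF P0] S_one by (auto simp: contraction_def extension_def)
    moreover have "x \<in> contraction R ?S Q" using Q(3) xR by (simp add: contraction_def)
    moreover have "contraction R ?S Q \<subseteq> P2" using c(2) prime_subset[OF c(1)] by auto
    ultimately have "contraction R ?S Q = P2" using neg c(1) by blast
    then show "Q = extension R ?S P2" using extension_contraction[OF Q(1)] by simp
  qed
qed

text \<open>Reroutes a chain above primes containing \<open>x\<close> at the cost of one step. By
  induction the part above \<open>P1\<close> starts anew at some \<open>Q\<close> containing
  \<open>x\<close>; between \<open>P0\<close> and \<open>Q\<close> the principal ideal theorem then
  replaces \<open>P1\<close> by a prime that contains \<open>x\<close>.\<close>

lemma (in cring) prime_chain_through:
  assumes noeth: "noetherian_ring R" and x: "x \<in> P"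
  shows "prime_chain R (Suc n) P0 P \<Longrightarrow> \<exists>Q. P0 \<subset> Q \<and> x \<in> Q \<and> prime_chain R n Q P"
proof (induction n arbitrary: P0)
  case 0
  obtain Q where "P0 \<subset> Q" "prime_chain R 0 Q P" using prime_chain_SucD[OF 0] by blast
  then show ?case using x prime_chain_0D by blast
next
  case (Suc n)
  obtain P1 where P1: "primeideal P0 R" "P0 \<subset> P1" "prime_chain R (Suc n) P1 P"
    using prime_chain_SucD[OF Suc.prems] by blast
  obtain Q where Q: "P1 \<subset> Q" "x \<in> Q" "prime_chain R n Q P" using Suc.IH[OF P1(3)] by blast
  have p: "primeideal P1 R" "primeideal Q R" using P1(3) Q(3) prime_chain_facts by blast+
  obtain Q1 where Q1: "primeideal Q1 R" "P0 \<subseteq> Q1" "x \<in> Q1" "Q1 \<subset> Q"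
    using principal_ideal_theorem[OF noeth P1(1) p P1(2) Q(1,2)] by blast
  show ?case
  proof (cases "x \<in> P0")
    case True
    then show ?thesis using P1 by blast
  next
    case False
    then have "P0 \<subset> Q1" using Q1 by blast
    then show ?thesis using Q1 prime_chain.step[OF Q1(1,4) Q(3)] by blast
  qed
qed

text \<open>The hypothesis says that \<open>P\<close> is minimal over \<open>P0\<close> and
  \<open>xs\<close>. Each generator is absorbed into the bottom of the chain and shortens it by one;
  when none is left, minimality leaves only the trivial chain.\<close>

lemma (in cring) height_le_generators:
  assumes noeth: "noetherian_ring R"
  shows "prime_chain R n P0 P \<Longrightarrow> set xs \<subseteq> P \<Longrightarrow>
    (\<And>Q. primeideal Q R \<Longrightarrow> P0 \<subseteq> Q \<Longrightarrow> set xs \<subseteq> Q \<Longrightarrow> Q \<subseteq> P \<Longrightarrow> Q = P) \<Longrightarrow> n \<le> length xs"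
proof (induction xs arbitrary: n P0)
  case Nil
  have "P0 = P" using Nil(3)[of P0] prime_chain_facts[OF Nil(1)] by simp
  have "n = 0"
  proof (cases n)
    case (Suc k)
    then have "prime_chain R (Suc k) P0 P" using Nil(1) by simp
    then obtain Q where Q: "P0 \<subset> Q" "prime_chain R k Q P" using prime_chain_SucD[of R k P0 P] by auto
    then show ?thesis using prime_chain_facts[OF Q(2)] \<open>P0 = P\<close> by auto
  qed simp
  then show ?case by simp
next
  case (Cons x xs)
  show ?case
  proof (cases n)
    case (Suc k)
    obtain Q where Q: "P0 \<subset> Q" "x \<in> Q" "prime_chain R k Q P"
      using prime_chain_through[OF noeth, of x P k P0] Cons.prems(1,2) Suc by auto
    have "k \<le> length xs"
    proof (rule Cons.IH[OF Q(3)])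
      show "set xs \<subseteq> P" using Cons.prems(2) by simp
      show "Q' = P" if "primeideal Q' R" "Q \<subseteq> Q'" "set xs \<subseteq> Q'" "Q' \<subseteq> P" for Q'
        using Cons.prems(3)[of Q'] that Q by auto
    qed
    then show ?thesis using Suc by simp
  qed simp
qed

lemma (in cring) finite_height:
  assumes noeth: "noetherian_ring R" and P: "primeideal P R"
  shows "\<exists>d. \<forall>n Q. prime_chain R n Q P \<longrightarrow> n \<le> d"
proof -
  obtain A where A: "A \<subseteq> carrier R" "finite A" "P = Idl A"
    using noetherian_ring.finetely_gen[OF noeth prime_ideal[OF P]] by auto
  obtain xs where xs: "set xs = A" using finite_list[OF A(2)] by blast
  have "n \<le> length xs" if "prime_chain R n Q P" for n Q
  proof (rule height_le_generators[OF noeth that])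
    show "set xs \<subseteq> P" using xs A genideal_self by auto
    show "Q' = P" if "primeideal Q' R" "set xs \<subseteq> Q'" "Q' \<subseteq> P" for Q'
      using genideal_minimal[OF prime_ideal[OF that(1)], of A] that xs A(3) by auto
  qed
  then show ?thesis by blast
qed

section \<open>Regular sequences in the primes of a Cohen Macaulay module\<close>

context noetherian_local_module begin

lemma set_add_ideal_mult_proper:
  assumes N: "submodule N R M" "N \<noteq> carrier M"
  shows "submodule (N <+>\<^bsub>M\<^esub> ideal_mult R M m (carrier M)) R M"
    and "N <+>\<^bsub>M\<^esub> ideal_mult R M m (carrier M) \<noteq> carrier M"
proof -
  have im: "submodule (ideal_mult R M m (carrier M)) R M"
    using prime_subset[OF m_prime] by (intro submodule_ideal_mult) auto
  show "submodule (N <+>\<^bsub>M\<^esub> ideal_mult R M m (carrier M)) R M"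
    by (rule submodule_set_add[OF N(1) im])
  show "N <+>\<^bsub>M\<^esub> ideal_mult R M m (carrier M) \<noteq> carrier M"
  proof
    assume "N <+>\<^bsub>M\<^esub> ideal_mult R M m (carrier M) = carrier M"
    then have "carrier M \<subseteq> N" by (intro Nakayama_local[OF N(1) carrier_is_submodule]) auto
    then show False using N submodule_subset by blast
  qed
qed

lemma quot_by_proper:
  assumes N: "submodule N R M" "N \<noteq> carrier M" and xs: "set xs \<subseteq> m"
  shows "quot_by M N xs \<noteq> carrier M"
proof
  assume eq: "quot_by M N xs = carrier M"
  have im: "submodule (ideal_mult R M m (carrier M)) R M"
    using prime_subset[OF m_prime] by (intro submodule_ideal_mult) auto
  have "quot_by M N xs \<subseteq> N <+>\<^bsub>M\<^esub> ideal_mult R M m (carrier M)"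
  proof (rule quot_by_least[OF set_add_ideal_mult_proper(1)[OF N] set_add_upper1[OF N(1) im]])
    show "x \<odot>\<^bsub>M\<^esub> u \<in> N <+>\<^bsub>M\<^esub> ideal_mult R M m (carrier M)" if "x \<in> set xs" "u \<in> carrier M" for x u
      using ideal_mult_mem[of x m u "carrier M"] that xs set_add_upper2[OF N(1) im] by blast
  qed
  then show False
    using eq set_add_ideal_mult_proper[OF N] submodule_subset by blast
qed

text \<open>The inequality \<open>depth M/N \<le> dim R/P\<close> for a prime \<open>P\<close> that
  annihilates a nonzero class. Dividing by \<open>x\<close> leaves a nonzero class killed by
  \<open>P\<close> and by \<open>x\<close>, so a strictly larger prime takes over.\<close>

lemma killed_prime_chain:
  "submodule N R M \<Longrightarrow> set xs \<subseteq> m \<Longrightarrow> regular M N xs \<Longrightarrow> primeideal P R \<Longrightarrow> u \<in> carrier M - N \<Longrightarrow>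
    P \<subseteq> colon R M N u \<Longrightarrow> \<exists>k\<ge>length xs. prime_chain R k P m"
proof (induction xs arbitrary: N P u)
  case Nil
  then show ?case using prime_chain_le[OF Nil(4) m_prime prime_subset_m[OF Nil(4)]] by auto
next
  case (Cons x xs)
  note N = Cons.prems(1) and P = Cons.prems(4)
  have mR: "m \<subseteq> carrier R" using prime_subset[OF m_prime] .
  have x: "x \<in> m" "x \<in> carrier R" "nzd M N x" using Cons.prems mR by auto
  have PR: "P \<subseteq> carrier R" using prime_subset[OF P] .
  let ?N = "N <+>\<^bsub>M\<^esub> mult_image M x"
  have N': "submodule ?N R M" by (rule submodule_adj[OF N x(2)])
  have xP: "x \<notin> P" using Cons.prems(5,6) x(3) by (auto simp: colon_def nzd_def)
  \<comment> \<open>All classes killed by \<open>P\<close>, not just that of \<open>u\<close>, so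
    that Nakayama's lemma applies: if \<open>K\<close> lay in \<open>N + xM\<close>, cancelling
    \<open>x\<close> would give \<open>K\<close> inside \<open>N + xK\<close>, hence inside
    \<open>N\<close>.\<close>
  define K where "K = {v \<in> carrier M. \<forall>a\<in>P. a \<odot>\<^bsub>M\<^esub> v \<in> N}"
  have K: "submodule K R M" unfolding K_def by (rule submodule_killed[OF N PR])
  have uK: "u \<in> K" using Cons.prems(5,6) by (auto simp: K_def colon_def)
  have "\<not> K \<subseteq> ?N"
  proof
    assume le: "K \<subseteq> ?N"
    have "K \<subseteq> N <+>\<^bsub>M\<^esub> ideal_mult R M m K"
    proof
      fix v assume v: "v \<in> K"
      then obtain n w where nw: "n \<in> N" "w \<in> carrier M" "v = n \<oplus>\<^bsub>M\<^esub> x \<odot>\<^bsub>M\<^esub> w"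
        using subsetD[OF le v] unfolding mem_adj_iff by blast
      have nM: "n \<in> carrier M" using submodule_carr[OF N nw(1)] .
      have "a \<odot>\<^bsub>M\<^esub> w \<in> N" if a: "a \<in> P" for a
      proof -
        have aR: "a \<in> carrier R" using a PR by auto
        have "a \<odot>\<^bsub>M\<^esub> v = a \<odot>\<^bsub>M\<^esub> n \<oplus>\<^bsub>M\<^esub> x \<odot>\<^bsub>M\<^esub> (a \<odot>\<^bsub>M\<^esub> w)"
          unfolding nw(3) using aR nM nw(2) x(2) by (simp add: smult_r_distr smult_commute[of a x])
        moreover have "a \<odot>\<^bsub>M\<^esub> v \<in> N" using v a by (simp add: K_def)
        ultimately have "x \<odot>\<^bsub>M\<^esub> (a \<odot>\<^bsub>M\<^esub> w) \<in> N"
          using submodule_cancel[OF N submodule_smult[OF N aR nw(1)], of "x \<odot>\<^bsub>M\<^esub> (a \<odot>\<^bsub>M\<^esub> w)"] aR x(2) nw(2) by simp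
        then show ?thesis using x(3) aR nw(2) by (simp add: nzd_def)
      qed
      then have "w \<in> K" using nw(2) by (simp add: K_def)
      then have "x \<odot>\<^bsub>M\<^esub> w \<in> ideal_mult R M m K" by (rule ideal_mult_mem[OF x(1)])
      then show "v \<in> N <+>\<^bsub>M\<^esub> ideal_mult R M m K" unfolding mem_set_add_iff using nw by blast
    qed
    then have "K \<subseteq> N" by (rule Nakayama_local[OF N K])
    then show False using uK Cons.prems(5) by blast
  qed
  then obtain v where v: "v \<in> K" "v \<notin> ?N" by auto
  have vM: "v \<in> carrier M - ?N" using v submodule_carr[OF K] by auto
  obtain w where w: "max_colon R M ?N w" "colon R M ?N v \<subseteq> colon R M ?N w"
    using max_colon_exists[OF N' vM] .
  have wM: "w \<in> carrier M - ?N" using w(1) by (simp add: max_colon_def)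
  have "P \<subseteq> colon R M ?N v"
    using v(1) PR adj_upper[OF N x(2)] by (auto simp: K_def colon_def)
  then have "P \<subseteq> colon R M ?N w" using w(2) by blast
  moreover have "x \<in> colon R M ?N w" using x(2) wM adj_upper2[OF N x(2)] by (simp add: colon_def)
  ultimately have lt: "P \<subset> colon R M ?N w" using xP by blast
  have "\<exists>k\<ge>length xs. prime_chain R k (colon R M ?N w) m"
    using Cons.IH[OF N' _ _ max_colon_prime[OF N' w(1)] wM] Cons.prems(2,3) by auto
  then obtain k where k: "k \<ge> length xs" "prime_chain R k (colon R M ?N w) m" by blast
  have "prime_chain R (Suc k) P m" by (rule prime_chain.step[OF P lt k(2)])
  then show ?case using k(1) by (intro exI[of _ "Suc k"]) auto
qed

lemma regular_maximal_extension:
  assumes N: "submodule N R M" "N \<noteq> carrier M"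
  shows "\<exists>zs. set zs \<subseteq> m \<and> regular M N zs \<and> killed R M (quot_by M N zs) m"
proof (rule regular_extend[OF prime_ideal[OF m_prime] set_add_ideal_mult_proper[OF N] _ N(1)])
  have im: "submodule (ideal_mult R M m (carrier M)) R M"
    using prime_subset[OF m_prime] by (intro submodule_ideal_mult) auto
  show "N \<subseteq> N <+>\<^bsub>M\<^esub> ideal_mult R M m (carrier M)" by (rule set_add_upper1[OF N(1) im])
  show "a \<odot>\<^bsub>M\<^esub> u \<in> N <+>\<^bsub>M\<^esub> ideal_mult R M m (carrier M)" if "a \<in> m" "u \<in> carrier M" for a u
    using ideal_mult_mem[OF that] set_add_upper2[OF N(1) im] by blast
qed

text \<open>If \<open>q\<close> kills an element of \<open>M/N\<close>, then the chains below \<open>q\<close> are trivial, because a chain from \<open>q\<close>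
  to \<open>m\<close> already has the maximal length; otherwise divide by a nonzerodivisor in \<open>q\<close>.\<close>

lemma cohen_macaulay_regular_in_prime:
  "submodule N R M \<Longrightarrow> N \<noteq> carrier M \<Longrightarrow> set xs \<subseteq> m \<Longrightarrow> regular M N xs \<Longrightarrow>
    (\<And>n Q. prime_chain R n Q m \<Longrightarrow> ann_quot R M N \<subseteq> Q \<Longrightarrow> n \<le> length xs) \<Longrightarrow>
    primeideal q R \<Longrightarrow> ann_quot R M N \<subseteq> q \<Longrightarrow>
    \<exists>ys. set ys \<subseteq> q \<and> regular M N ys \<and> (\<forall>n Q. prime_chain R n Q q \<longrightarrow> ann_quot R M N \<subseteq> Q \<longrightarrow> n \<le> length ys)"
proof (induction "length xs" arbitrary: N xs rule: less_induct)
  case less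
  note N = less.prems(1,2) and q = less.prems(6,7)
  have mR: "m \<subseteq> carrier R" using prime_subset[OF m_prime] .
  have qm: "q \<subseteq> m" by (rule prime_subset_m[OF q(1)])
  show ?case
  proof (cases "killed R M N q")
    case True
    then obtain u where u: "u \<in> carrier M - N" "q \<subseteq> colon R M N u" by (auto simp: killed_def)
    obtain k where k: "k \<ge> length xs" "prime_chain R k q m"
      using killed_prime_chain[OF N(1) less.prems(3,4) q(1) u] by blast
    have "n = 0" if "prime_chain R n Q q" "ann_quot R M N \<subseteq> Q" for n Q
      using less.prems(5)[OF prime_chain_trans[OF that(1) k(2)] that(2)] k(1) by simp
    then show ?thesis by (intro exI[of _ "[]"]) auto
  next
    case False
    then obtain y where y: "y \<in> q" "nzd M N y" using nzd_exists[OF prime_ideal[OF q(1)] N(1)] by auto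
    have ym: "y \<in> m" "y \<in> carrier R" using y qm mR by auto
    let ?N = "N <+>\<^bsub>M\<^esub> mult_image M y"
    have N': "submodule ?N R M" "?N \<noteq> carrier M"
      using submodule_adj[OF N(1) ym(2)] quot_by_proper[OF N, of "[y]"] ym by auto
    \<comment> \<open>By Rees' theorem \<open>y # zs\<close> is at least as long as
      \<open>xs\<close>, and by the chain bound at most as long. So \<open>M/(N + yM)\<close>
      satisfies the hypotheses with \<open>zs\<close>, which is shorter by one.\<close>
    obtain zs where zs: "set zs \<subseteq> m" "regular M ?N zs" "killed R M (quot_by M ?N zs) m"
      using regular_maximal_extension[OF N'] by blast
    have yzs: "set (y # zs) \<subseteq> m" "regular M N (y # zs)" "killed R M (quot_by M N (y # zs)) m"
      using zs y ym by auto
    have le1: "length xs \<le> length (y # zs)"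
      by (rule regular_length_le[OF prime_ideal[OF m_prime] N(1) yzs less.prems(3,4)])
    have "ann_quot R M (quot_by M N (y # zs)) \<subseteq> m"
      using yzs(1) mR by (intro ann_quot_subset_m submodule_quot_by quot_by_proper N) auto
    then obtain Q where "ann_quot R M N \<subseteq> Q" "prime_chain R (length (y # zs)) Q m"
      using regular_prime_chain[OF N(1) _ yzs(2) m_prime] yzs(1) mR by blast
    then have le2: "length (y # zs) \<le> length xs" using less.prems(5) by blast
    have "\<exists>ys. set ys \<subseteq> q \<and> regular M ?N ys \<and>
        (\<forall>n Q. prime_chain R n Q q \<longrightarrow> ann_quot R M ?N \<subseteq> Q \<longrightarrow> n \<le> length ys)"
    proof (rule less.hyps[OF _ N' zs(1,2) _ q(1) ann_quot_adj_subset_prime[OF N(1) q y(1)]])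
      show "length zs < length xs" using le2 by simp
      \<comment> \<open>A chain in the support of \<open>M/(N + yM)\<close> starts at a prime
        containing \<open>y\<close>; a prime of the support of \<open>M/N\<close> beneath it omits
        \<open>y\<close> and lengthens the chain by one.\<close>
      fix n Q assume Q: "prime_chain R n Q m" "ann_quot R M ?N \<subseteq> Q"
      have Qp: "primeideal Q R" using prime_chain_facts[OF Q(1)] by simp
      have "ann_quot R M N \<subseteq> Q" using Q(2) ann_quot_mono[OF adj_upper[OF N(1) ym(2)]] by blast
      then obtain Q' where Q': "primeideal Q' R" "ann_quot R M N \<subseteq> Q'" "Q' \<subseteq> Q" "y \<notin> Q'"
        using nzd_prime_below[OF N(1) ym(2) y(2) Qp] by blast
      have "y \<in> Q" using Q(2) mem_ann_quot_adj[OF N(1) ym(2)] by blast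
      then have "Q' \<subset> Q" using Q' by blast
      then have "Suc n \<le> length xs" using less.prems(5)[OF prime_chain.step[OF Q'(1) _ Q(1)] Q'(2)] by simp
      then show "n \<le> length zs" using le1 by simp
    qed
    then obtain ys where ys: "set ys \<subseteq> q" "regular M ?N ys"
      "\<And>n Q. prime_chain R n Q q \<Longrightarrow> ann_quot R M ?N \<subseteq> Q \<Longrightarrow> n \<le> length ys" by blast
    have "n \<le> length (y # ys)" if Q: "prime_chain R n Q q" "ann_quot R M N \<subseteq> Q" for n Q
    proof (cases n)
      case (Suc k)
      \<comment> \<open>The chain is traded for one shorter by one that starts at a prime containing
        \<open>y\<close>, hence in the support of \<open>M/(N + yM)\<close>, where the bound for
        \<open>ys\<close> applies.\<close>
      obtain Q1 where Q1: "Q \<subset> Q1" "y \<in> Q1" "prime_chain R k Q1 q"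
        using R.prime_chain_through[OF noetherian y(1), of k Q] Q(1) Suc by auto
      have "ann_quot R M ?N \<subseteq> Q1"
        using ann_quot_adj_subset_prime[OF N(1) _ _ Q1(2)] prime_chain_facts[OF Q1(3)] Q(2) Q1(1) by blast
      then show ?thesis using ys(3)[OF Q1(3)] Suc by simp
    qed simp
    then show ?thesis using ys(1,2) y by (intro exI[of _ "y # ys"]) auto
  qed
qed

end

section \<open>Submodules of a localized module\<close>

lemma regular_iff_nth:
  "regular M N xs \<longleftrightarrow> (\<forall>i<length xs. nzd M (quot_by M N (take i xs)) (xs ! i))"
proof (induction xs arbitrary: N)
  case (Cons x xs)
  show ?case unfolding regular.simps Cons.IH by (simp add: All_less_Suc2)
qed simp

context module_mult_set begin

lemma mf_mem_submodule_iff: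
  assumes N: "submodule N L LM" and x: "x \<in> carrier M" "s \<in> S"
  shows "mf x s \<in> N \<longleftrightarrow> mf x \<one> \<in> N"
proof -
  interpret LM: module L LM by (rule module_LM)
  show ?thesis
  proof
    assume "mf x s \<in> N"
    then have "rf s \<one> \<odot>\<^bsub>LM\<^esub> mf x s \<in> N" using LM.submodule_smult[OF N] x S_one by simp
    moreover have "rf s \<one> \<odot>\<^bsub>LM\<^esub> mf x s = mf x \<one>"
      using x S_one mf_cancel[of x \<one> s] by (simp add: LM_smult)
    ultimately show "mf x \<one> \<in> N" by simp
  next
    assume "mf x \<one> \<in> N"
    then have "rf \<one> s \<odot>\<^bsub>LM\<^esub> mf x \<one> \<in> N" using LM.submodule_smult[OF N] x by simp
    then show "mf x s \<in> N" using x S_one by (simp add: LM_smult)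
  qed
qed

lemma mf_mem_loc_ext_iff:
  assumes N: "submodule N R M" and x: "x \<in> carrier M" "s \<in> S"
  shows "mf x s \<in> loc_ext M S N \<longleftrightarrow> x \<in> sat M S N"
proof
  assume "mf x s \<in> loc_ext M S N"
  then obtain n t where n: "n \<in> N" "t \<in> S" "mf x s = mf n t" by (auto simp: loc_ext_def)
  have nM: "n \<in> carrier M" using submodule_carr[OF N n(1)] .
  obtain u where u: "u \<in> S" "u \<odot>\<^bsub>M\<^esub> (t \<odot>\<^bsub>M\<^esub> x) = u \<odot>\<^bsub>M\<^esub> (s \<odot>\<^bsub>M\<^esub> n)"
    using mf_eq_iff[OF x nM n(2)] n(3) by auto
  then have "(u \<otimes> t) \<odot>\<^bsub>M\<^esub> x \<in> N"
    using x n submodule_smult[OF N] by (simp add: smult_assoc1)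
  then show "x \<in> sat M S N" using x(1) S_mult[OF u(1) n(2)] by (auto simp: sat_def)
next
  assume "x \<in> sat M S N"
  then obtain u where u: "u \<in> S" "u \<odot>\<^bsub>M\<^esub> x \<in> N" by (auto simp: sat_def)
  then have "mf x s = mf (u \<odot>\<^bsub>M\<^esub> x) (u \<otimes> s)" using mf_cancel[OF x u(1)] by simp
  then show "mf x s \<in> loc_ext M S N" using u S_mult[OF u(1) x(2)] by (auto simp: loc_ext_def)
qed

lemma submodule_loc_ext:
  assumes N: "submodule N R M" shows "submodule (loc_ext M S N) L LM"
proof -
  interpret LM: module L LM by (rule module_LM)
  note mem = mf_mem_loc_ext_iff[OF N]
  have sat: "submodule (sat M S N) R M" by (rule submodule_sat[OF N S_subset S_one S_mult])
  show ?thesis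
  proof (rule LM.submoduleI_smult)
    show sub: "loc_ext M S N \<subseteq> carrier LM"
      using submodule_carr[OF N] by (auto simp: loc_ext_def)
    show "\<zero>\<^bsub>LM\<^esub> \<in> loc_ext M S N" unfolding LM_zero using submodule_zero[OF sat] S_one mem by simp
    show "X \<oplus>\<^bsub>LM\<^esub> Y \<in> loc_ext M S N" if XY: "X \<in> loc_ext M S N" "Y \<in> loc_ext M S N" for X Y
    proof -
      obtain x y s where x: "x \<in> carrier M" "y \<in> carrier M" "s \<in> S" "X = mf x s" "Y = mf y s"
        using LM_common_denominator[of X Y] XY sub by blast
      then show ?thesis using XY submodule_add[OF sat] by (simp add: LM_add_same mem)
    qed
    show "A \<odot>\<^bsub>LM\<^esub> X \<in> loc_ext M S N" if AX: "A \<in> carrier L" "X \<in> loc_ext M S N" for A X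
    proof -
      obtain x s where x: "x \<in> carrier M" "s \<in> S" "X = mf x s" using LM_cases[of X] AX sub by blast
      obtain a t where a: "a \<in> carrier R" "t \<in> S" "A = rf a t" using L_cases[OF AX(1)] .
      show ?thesis using AX(2) x a submodule_smult[OF sat] by (simp add: LM_smult mem S_mult)
    qed
  qed
qed

lemma loc_ext_zero: "loc_ext M S {\<zero>\<^bsub>M\<^esub>} = {\<zero>\<^bsub>LM\<^esub>}"
  using S_one by (auto simp: loc_ext_def mf_zero intro!: exI[of _ \<one>])

lemma loc_ext_adj:
  assumes N: "submodule N R M" and x: "x \<in> carrier R"
  shows "loc_ext M S (N <+>\<^bsub>M\<^esub> mult_image M x) = loc_ext M S N <+>\<^bsub>LM\<^esub> mult_image LM (rf x \<one>)"
proof -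
  interpret LM: module L LM by (rule module_LM)
  have xL: "rf x \<one> \<in> carrier L" using x S_one by simp
  have adj: "submodule (N <+>\<^bsub>M\<^esub> mult_image M x) R M" by (rule submodule_adj[OF N x])
  show ?thesis
  proof
    show "loc_ext M S (N <+>\<^bsub>M\<^esub> mult_image M x) \<subseteq> loc_ext M S N <+>\<^bsub>LM\<^esub> mult_image LM (rf x \<one>)"
    proof
      fix X assume "X \<in> loc_ext M S (N <+>\<^bsub>M\<^esub> mult_image M x)"
      then obtain y s where y: "y \<in> N <+>\<^bsub>M\<^esub> mult_image M x" "s \<in> S" "X = mf y s"
        unfolding loc_ext_def by blast
      obtain n u where n: "n \<in> N" "u \<in> carrier M" "y = n \<oplus>\<^bsub>M\<^esub> x \<odot>\<^bsub>M\<^esub> u" using y(1) unfolding mem_adj_iff by blast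
      have "X = mf n s \<oplus>\<^bsub>LM\<^esub> rf x \<one> \<odot>\<^bsub>LM\<^esub> mf u s"
        using y n x S_one submodule_carr[OF N n(1)] by (simp add: LM_smult LM_add_same)
      moreover have "mf n s \<in> loc_ext M S N" using n y(2) unfolding loc_ext_def by blast
      moreover have "mf u s \<in> carrier LM" using n y(2) by simp
      ultimately show "X \<in> loc_ext M S N <+>\<^bsub>LM\<^esub> mult_image LM (rf x \<one>)" unfolding LM.mem_adj_iff by blast
    qed
    show "loc_ext M S N <+>\<^bsub>LM\<^esub> mult_image LM (rf x \<one>) \<subseteq> loc_ext M S (N <+>\<^bsub>M\<^esub> mult_image M x)"
    proof (rule LM.adj_least[OF submodule_loc_ext[OF adj]])
      show "loc_ext M S N \<subseteq> loc_ext M S (N <+>\<^bsub>M\<^esub> mult_image M x)"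
        using adj_upper[OF N x] unfolding loc_ext_def by blast
      fix X assume "X \<in> carrier LM"
      then obtain u s where u: "u \<in> carrier M" "s \<in> S" "X = mf u s" by (rule LM_cases)
      then have "rf x \<one> \<odot>\<^bsub>LM\<^esub> X = mf (x \<odot>\<^bsub>M\<^esub> u) s" using x S_one by (simp add: LM_smult)
      then show "rf x \<one> \<odot>\<^bsub>LM\<^esub> X \<in> loc_ext M S (N <+>\<^bsub>M\<^esub> mult_image M x)"
        using adj_upper2[OF N x u(1)] u(2) unfolding loc_ext_def by blast
    qed
  qed
qed

lemma loc_ext_quot_by:
  "submodule N R M \<Longrightarrow> set xs \<subseteq> carrier R \<Longrightarrow>
    loc_ext M S (quot_by M N xs) = quot_by LM (loc_ext M S N) (map (\<lambda>x. rf x \<one>) xs)"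
proof (induction xs arbitrary: N)
  case (Cons x xs)
  then show ?case
    using Cons.IH[OF submodule_adj[OF Cons.prems(1), of x]] loc_ext_adj[OF Cons.prems(1), of x] by simp
qed simp

text \<open>Regularity over a localization becomes a condition on saturated submodules of
  \<open>M\<close>, so that localizations at different primes can be compared inside
  \<open>M\<close>.\<close>

lemma nzd_loc_ext_iff:
  assumes N: "submodule N R M" and x: "x \<in> carrier R"
  shows "nzd LM (loc_ext M S N) (rf x \<one>) \<longleftrightarrow> nzd M (sat M S N) x"
proof
  assume l: "nzd LM (loc_ext M S N) (rf x \<one>)"
  show "nzd M (sat M S N) x"
    unfolding nzd_def
  proof (intro ballI impI)
    fix u assume u: "u \<in> carrier M" "x \<odot>\<^bsub>M\<^esub> u \<in> sat M S N"
    then have "rf x \<one> \<odot>\<^bsub>LM\<^esub> mf u \<one> \<in> loc_ext M S N"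
      using x S_one mf_mem_loc_ext_iff[OF N] by (simp add: LM_smult)
    then have "mf u \<one> \<in> loc_ext M S N" using l u(1) S_one unfolding nzd_def by simp
    then show "u \<in> sat M S N" using mf_mem_loc_ext_iff[OF N u(1) S_one] by simp
  qed
next
  assume r: "nzd M (sat M S N) x"
  show "nzd LM (loc_ext M S N) (rf x \<one>)"
    unfolding nzd_def
  proof (intro ballI impI)
    fix X assume "X \<in> carrier LM" and mem: "rf x \<one> \<odot>\<^bsub>LM\<^esub> X \<in> loc_ext M S N"
    then obtain u s where u: "u \<in> carrier M" "s \<in> S" "X = mf u s" using LM_cases by blast
    have "x \<odot>\<^bsub>M\<^esub> u \<in> sat M S N"
      using mem u x S_one mf_mem_loc_ext_iff[OF N] by (simp add: LM_smult)
    then have "u \<in> sat M S N" using r u(1) unfolding nzd_def by simp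
    then show "X \<in> loc_ext M S N" using u mf_mem_loc_ext_iff[OF N u(1,2)] by simp
  qed
qed

lemma regular_loc_ext_iff:
  assumes N: "submodule N R M" and xs: "set xs \<subseteq> carrier R"
  shows "regular LM (loc_ext M S N) (map (\<lambda>x. rf x \<one>) xs) \<longleftrightarrow>
    (\<forall>i<length xs. nzd M (sat M S (quot_by M N (take i xs))) (xs ! i))"
proof -
  have "nzd LM (quot_by LM (loc_ext M S N) (take i (map (\<lambda>x. rf x \<one>) xs))) (map (\<lambda>x. rf x \<one>) xs ! i)
      \<longleftrightarrow> nzd M (sat M S (quot_by M N (take i xs))) (xs ! i)" if i: "i < length xs" for i
  proof -
    have sub: "set (take i xs) \<subseteq> carrier R" using xs set_take_subset[of i xs] by blast
    have "xs ! i \<in> carrier R" using xs i nth_mem by blast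
    then show ?thesis
      using nzd_loc_ext_iff[OF submodule_quot_by[OF N sub]] loc_ext_quot_by[OF N sub] i by (simp add: take_map)
  qed
  then show ?thesis unfolding regular_iff_nth by simp
qed

text \<open>Localizing further keeps nonzerodivisors. It is applied with \<open>S'\<close> equal to
  \<open>{1}\<close>, to pass from \<open>M\<close> to \<open>M_p\<close>, and with the complement
  of \<open>p\<close>, to pass from \<open>M_p\<close> to \<open>M_q\<close>.\<close>

lemma nzd_sat:
  assumes N: "submodule N R M" and S': "S' \<subseteq> S" and x: "x \<in> carrier R" "nzd M (sat M S' N) x"
    and one: "\<one> \<in> S'"
  shows "nzd M (sat M S N) x"
  unfolding nzd_def
proof (intro ballI impI)
  fix u assume u: "u \<in> carrier M" "x \<odot>\<^bsub>M\<^esub> u \<in> sat M S N"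
  then obtain s where s: "s \<in> S" "s \<odot>\<^bsub>M\<^esub> (x \<odot>\<^bsub>M\<^esub> u) \<in> N" by (auto simp: sat_def)
  then have "x \<odot>\<^bsub>M\<^esub> (s \<odot>\<^bsub>M\<^esub> u) \<in> N" using u(1) x(1) smult_commute[of s x u] by simp
  then have "x \<odot>\<^bsub>M\<^esub> (s \<odot>\<^bsub>M\<^esub> u) \<in> sat M S' N" using sat_upper[OF submodule_subset[OF N] one] by blast
  then have "s \<odot>\<^bsub>M\<^esub> u \<in> sat M S' N" using x(2) s(1) u(1) unfolding nzd_def by simp
  then have "s \<odot>\<^bsub>M\<^esub> u \<in> sat M S N" using S' by (auto simp: sat_def)
  then show "u \<in> sat M S N" using sat_sat[OF S_subset S_mult s(1) u(1)] by simp
qed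

lemma regular_loc_ext:
  assumes N: "submodule N R M" and xs: "set xs \<subseteq> carrier R" "regular M N xs"
  shows "regular LM (loc_ext M S N) (map (\<lambda>x. rf x \<one>) xs)"
  unfolding regular_loc_ext_iff[OF N xs(1)]
proof (intro allI impI)
  fix i assume i: "i < length xs"
  let ?K = "quot_by M N (take i xs)"
  have sub: "set (take i xs) \<subseteq> carrier R" using xs set_take_subset[of i xs] by blast
  have K: "submodule ?K R M" by (rule submodule_quot_by[OF N sub])
  have "sat M {\<one>} ?K = ?K" using submodule_carr[OF K] by (auto simp: sat_def)
  then have "nzd M (sat M {\<one>} ?K) (xs ! i)" using regular_nth[OF xs(2) i] by simp
  moreover have "xs ! i \<in> carrier R" using xs i nth_mem by blast
  ultimately show "nzd M (sat M S ?K) (xs ! i)" using nzd_sat[OF K, of "{\<one>}"] S_one by simp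
qed

lemma fin_gen_LM:
  assumes "finitely_generated R M" shows "finitely_generated L LM"
proof -
  interpret LM: module L LM by (rule module_LM)
  obtain G where G: "finite G" "G \<subseteq> carrier M" "module_span R M G = carrier M"
    using assms unfolding finitely_generated_def by auto
  let ?G = "(\<lambda>x. mf x \<one>) ` G"
  have sub: "?G \<subseteq> carrier LM" using G(2) S_one by auto
  let ?N = "module_span L LM ?G"
  have N: "submodule ?N L LM" by (rule LM.module_span_submodule[OF sub])
  have "submodule {x \<in> carrier M. mf x \<one> \<in> ?N} R M"
  proof (rule submoduleI_smult)
    show "\<zero>\<^bsub>M\<^esub> \<in> {x \<in> carrier M. mf x \<one> \<in> ?N}" using LM.submodule_zero[OF N] by (simp add: LM_zero)
    show "x \<oplus>\<^bsub>M\<^esub> y \<in> {x \<in> carrier M. mf x \<one> \<in> ?N}"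
      if "x \<in> {x \<in> carrier M. mf x \<one> \<in> ?N}" "y \<in> {x \<in> carrier M. mf x \<one> \<in> ?N}" for x y
      using that LM.submodule_add[OF N, of "mf x \<one>" "mf y \<one>"] S_one by (simp add: LM_add_same)
    show "a \<odot>\<^bsub>M\<^esub> x \<in> {x \<in> carrier M. mf x \<one> \<in> ?N}"
      if "a \<in> carrier R" "x \<in> {x \<in> carrier M. mf x \<one> \<in> ?N}" for a x
      using that LM.submodule_smult[OF N, of "rf a \<one>" "mf x \<one>"] S_one by (simp add: LM_smult)
  qed simp
  moreover have "G \<subseteq> {x \<in> carrier M. mf x \<one> \<in> ?N}" using G(2) LM.module_span_incl[of ?G] by auto
  ultimately have "carrier M \<subseteq> {x \<in> carrier M. mf x \<one> \<in> ?N}"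
    using module_span_least G(3) by blast
  then have "mf x s \<in> ?N" if "x \<in> carrier M" "s \<in> S" for x s
    using mf_mem_submodule_iff[OF N that] that by blast
  then have "?N = carrier LM" using LM.submodule_subset[OF N] LM_cases by blast
  then show ?thesis unfolding finitely_generated_def using G(1) sub by blast
qed

lemma noetherian_module_LM:
  assumes "noetherian_module R M" shows "noetherian_module L LM"
proof -
  interpret N: noetherian_module R M by fact
  show ?thesis
    by (intro noetherian_module.intro noetherian_module_axioms.intro module_LM
        noetherian_L[OF N.noetherian] fin_gen_LM[OF N.fin_gen])
qed

text \<open>The support commutes with localization. From right to left, a fraction
  \<open>a/s\<close> that kills the localized quotient gives each element of \<open>aM\<close> its
  own multiplier into \<open>N\<close>; the Noetherian property supplies a common \<open>u\<close>,
  and \<open>ua\<close> annihilates \<open>M/N\<close>.\<close>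

lemma ann_quot_loc_ext_subset_iff:
  assumes noeth: "noetherian_module R M" and N: "submodule N R M" and P: "primeideal P L"
  shows "ann_quot L LM (loc_ext M S N) \<subseteq> P \<longleftrightarrow> ann_quot R M N \<subseteq> contraction R S P"
proof
  assume le: "ann_quot L LM (loc_ext M S N) \<subseteq> P"
  show "ann_quot R M N \<subseteq> contraction R S P"
  proof
    fix a assume a: "a \<in> ann_quot R M N"
    then have aR: "a \<in> carrier R" by (simp add: ann_quot_def)
    have "rf a \<one> \<in> ann_quot L LM (loc_ext M S N)"
      unfolding ann_quot_def
    proof (intro CollectI conjI ballI)
      show "rf a \<one> \<in> carrier L" using aR S_one by simp
      fix X assume "X \<in> carrier LM"
      then obtain u s where u: "u \<in> carrier M" "s \<in> S" "X = mf u s" by (rule LM_cases)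
      then have "rf a \<one> \<odot>\<^bsub>LM\<^esub> X = mf (a \<odot>\<^bsub>M\<^esub> u) s" using aR S_one by (simp add: LM_smult)
      then show "rf a \<one> \<odot>\<^bsub>LM\<^esub> X \<in> loc_ext M S N"
        using a u unfolding loc_ext_def ann_quot_def by blast
    qed
    then show "a \<in> contraction R S P" using le aR by (auto simp: contraction_def)
  qed
next
  interpret N: noetherian_module R M by fact
  assume le: "ann_quot R M N \<subseteq> contraction R S P"
  show "ann_quot L LM (loc_ext M S N) \<subseteq> P"
  proof
    fix A assume A: "A \<in> ann_quot L LM (loc_ext M S N)"
    then obtain a s where a: "a \<in> carrier R" "s \<in> S" "A = rf a s"
      unfolding ann_quot_def using L_cases by blast
    have "\<exists>u\<in>S. u \<odot>\<^bsub>M\<^esub> y \<in> N" if y: "y \<in> mult_image M a" for y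
    proof -
      obtain x where x: "x \<in> carrier M" "y = a \<odot>\<^bsub>M\<^esub> x" using y by (auto simp: mult_image_def)
      have "rf a s \<odot>\<^bsub>LM\<^esub> mf x \<one> \<in> loc_ext M S N" using A a(3) x S_one by (simp add: ann_quot_def)
      then have "y \<in> sat M S N" using a x S_one mf_mem_loc_ext_iff[OF N] by (simp add: LM_smult)
      then show ?thesis by (simp add: sat_def)
    qed
    then obtain u where u: "u \<in> S" "\<forall>y\<in>mult_image M a. u \<odot>\<^bsub>M\<^esub> y \<in> N"
      using N.uniform_multiplier[OF N submodule_mult_image[OF a(1)] S_subset S_one S_mult] by blast
    then have "u \<otimes> a \<in> ann_quot R M N" using a(1) by (auto simp: ann_quot_def mult_image_def smult_assoc1)
    then have "rf (u \<otimes> a) \<one> \<in> P" using le by (auto simp: contraction_def)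
    then have "rf (u \<otimes> a) (u \<otimes> s) \<in> P"
      using rf_mem_ideal_iff[OF prime_ideal[OF P], of "u \<otimes> a" "u \<otimes> s"] u(1) a S_mult by simp
    then show "A \<in> P" using rf_cancel[OF a(1,2) u(1)] a(3) by simp
  qed
qed

end

section \<open>Quotient rings, quotient modules and grade\<close>

context cring begin

lemma coset_mem_image_iff:
  assumes J: "ideal J R" and P: "ideal P R" "J \<subseteq> P" and a: "a \<in> carrier R"
  shows "J +> a \<in> (+>) J ` P \<longleftrightarrow> a \<in> P"
proof
  assume "J +> a \<in> (+>) J ` P"
  then obtain b where b: "b \<in> P" "J +> a = J +> b" by blast
  have "a \<in> J +> a"
    unfolding a_r_coset_def' using ideal_zero[OF J] a by (auto intro!: bexI[of _ \<zero>])
  then have "a \<in> J +> b" using b by simp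
  then obtain j where "j \<in> J" "a = j \<oplus> b" by (auto simp: a_r_coset_def')
  then show "a \<in> P" using b P ideal_add[OF P(1)] by auto
qed auto

lemma Quot_cases:
  assumes "X \<in> carrier (R Quot J)" obtains a where "a \<in> carrier R" "X = J +> a"
  using assms by (auto simp: FactRing_def A_RCOSETS_def')

lemma Quot_mult: "ideal J R \<Longrightarrow> a \<in> carrier R \<Longrightarrow> b \<in> carrier R \<Longrightarrow>
    (J +> a) \<otimes>\<^bsub>R Quot J\<^esub> (J +> b) = J +> (a \<otimes> b)"
  using ideal.rcoset_mult_add[of J R a b] by (simp add: FactRing_def)

lemma Quot_image_prime:
  assumes J: "ideal J R" and P: "primeideal P R" "J \<subseteq> P"
  shows "primeideal ((+>) J ` P) (R Quot J)"
proof -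
  have Pi: "ideal P R" using prime_ideal[OF P(1)] .
  note mem = coset_mem_image_iff[OF J Pi P(2)]
  interpret Q: cring "R Quot J" by (rule ideal.quotient_is_cring[OF J is_cring])
  show ?thesis
  proof (rule Q.primeidealI_cring)
    show "ideal ((+>) J ` P) (R Quot J)" by (rule ring_ideal_imp_quot_ideal[OF J Pi])
    show "\<one>\<^bsub>R Quot J\<^esub> \<notin> (+>) J ` P" using mem[of \<one>] prime_one[OF P(1)] by (simp add: FactRing_def)
    fix X Y assume X: "X \<in> carrier (R Quot J)" and Y: "Y \<in> carrier (R Quot J)"
      and XY: "X \<otimes>\<^bsub>R Quot J\<^esub> Y \<in> (+>) J ` P" "X \<notin> (+>) J ` P"
    obtain a where a: "a \<in> carrier R" "X = J +> a" using Quot_cases[OF X] .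
    obtain b where b: "b \<in> carrier R" "Y = J +> b" using Quot_cases[OF Y] .
    show "Y \<in> (+>) J ` P"
      using XY prime_mult[OF P(1) a(1) b(1)] a b mem[of a] mem[of b] mem[of "a \<otimes> b"] Quot_mult[OF J a(1) b(1)]
      by auto
  qed
qed

text \<open>Together with \<open>krull_dim_Quot_le\<close> this makes \<open>dim R/J\<close> the
  supremum over chains of primes of \<open>R\<close> whose bottom contains \<open>J\<close>, and the
  quotient ring can be left behind.\<close>

lemma krull_dim_Quot_ge:
  assumes J: "ideal J R" and c: "prime_chain R n Q P" "J \<subseteq> Q"
  shows "ereal (real n) \<le> krull_dim (R Quot J)"
proof -
  obtain Ps where Ps: "length Ps = Suc n" "sorted_wrt (\<subset>) Ps" "\<forall>P\<in>set Ps. primeideal P R \<and> Q \<subseteq> P"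
    using list_of_prime_chain[OF c(1)] by blast
  let ?Ps = "map (\<lambda>P. (+>) J ` P) Ps"
  have lt: "(+>) J ` A \<subset> (+>) J ` B" if AB: "A \<in> set Ps" "B \<in> set Ps" "A \<subset> B" for A B
  proof -
    have p: "primeideal A R" "primeideal B R" and JA: "J \<subseteq> A" using Ps(3) AB c(2) by auto
    obtain b where b: "b \<in> B" "b \<notin> A" using AB(3) by auto
    have "b \<in> carrier R" using b(1) prime_subset[OF p(2)] by auto
    then have "J +> b \<notin> (+>) J ` A" using coset_mem_image_iff[OF J prime_ideal[OF p(1)] JA] b(2) by simp
    then show ?thesis using b(1) AB(3) by blast
  qed
  have "sorted_wrt (\<subset>) ?Ps"
    unfolding sorted_wrt_map by (rule sorted_wrt_mono_rel[OF _ Ps(2)]) (rule lt)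
  moreover have "\<forall>P\<in>set ?Ps. primeideal P (R Quot J)" using Quot_image_prime[OF J] Ps(3) c(2) by auto
  moreover have "?Ps \<noteq> []" using Ps(1) by auto
  ultimately have "ereal (real (length ?Ps - 1)) \<le> krull_dim (R Quot J)"
    unfolding krull_dim_def by (intro SUP_upper) blast
  then show ?thesis using Ps(1) by simp
qed

lemma krull_dim_Quot_le:
  assumes J: "ideal J R" and le: "\<And>n Q P. prime_chain R n Q P \<Longrightarrow> J \<subseteq> Q \<Longrightarrow> ereal (real n) \<le> c"
  shows "krull_dim (R Quot J) \<le> c"
  unfolding krull_dim_def
proof (rule SUP_least)
  fix Ps assume "Ps \<in> {Ps. Ps \<noteq> [] \<and> sorted_wrt (\<subset>) Ps \<and> (\<forall>P\<in>set Ps. primeideal P (R Quot J))}"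
  then have Ps: "Ps \<noteq> []" "sorted_wrt (\<subset>) Ps" "\<And>P. P \<in> set Ps \<Longrightarrow> primeideal P (R Quot J)" by auto
  define g where "g P = {r \<in> carrier R. J +> r \<in> P}" for P
  have zero_eq: "\<zero>\<^bsub>R Quot J\<^esub> = J" by (simp add: FactRing_def)
  interpret h: ring_hom_ring R "R Quot J" "(+>) J" by (rule ideal.rcos_ring_hom_ring[OF J])
  have gp: "primeideal (g P) R" if "P \<in> set Ps" for P
    unfolding g_def by (rule h.primeideal_vimage[OF is_cring Ps(3)[OF that]])
  have gJ: "J \<subseteq> g P" if P: "P \<in> set Ps" for P
  proof
    fix j assume j: "j \<in> J"
    have jR: "j \<in> carrier R" using j ideal_subset[OF J] by auto
    have "J +> j = J" by (rule abelian_subgroup.a_rcos_const[OF _ j])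
      (rule ideal.axioms(1)[OF J, THEN abelian_subgroupI3], rule abelian_group_axioms)
    then have "J +> j \<in> P" using ideal_zero[OF prime_ideal[OF Ps(3)[OF P]]] zero_eq by metis
    then show "j \<in> g P" using jR unfolding g_def by blast
  qed
  have lt: "g A \<subset> g B" if AB: "A \<in> set Ps" "B \<in> set Ps" "A \<subset> B" for A B
  proof -
    obtain X where X: "X \<in> B" "X \<notin> A" using AB(3) by auto
    then have "X \<in> carrier (R Quot J)" using prime_subset[OF Ps(3)[OF AB(2)]] by auto
    then obtain a where "a \<in> carrier R" "X = J +> a" by (rule Quot_cases)
    then show ?thesis using X AB(3) by (auto simp: g_def)
  qed
  let ?Ps = "map g Ps"
  have "sorted_wrt (\<subset>) ?Ps"
    unfolding sorted_wrt_map by (rule sorted_wrt_mono_rel[OF _ Ps(2)]) (rule lt)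
  then have "prime_chain R (length ?Ps - 1) (hd ?Ps) (last ?Ps)"
    using Ps(1) gp by (intro prime_chain_of_list) auto
  moreover have "J \<subseteq> hd ?Ps" using Ps(1) gJ[of "hd Ps"] by (simp add: hd_map)
  ultimately have "ereal (real (length ?Ps - 1)) \<le> c" by (rule le)
  then show "ereal (real (length Ps - 1)) \<le> c" by simp
qed

end

section \<open>Quotient modules and regular sequences\<close>

context module begin

lemma submodule_abelian_subgroup: "submodule N R M \<Longrightarrow> abelian_subgroup N M"
  by (intro abelian_subgroupI3 additive_subgroup.intro M.abelian_group_axioms)
    (rule submodule.axioms(1))

lemma FactModule_simps [simp]:
  "carrier (FactModule M N) = a_rcosets\<^bsub>M\<^esub> N" "\<zero>\<^bsub>FactModule M N\<^esub> = N"
  "add (FactModule M N) = set_add M"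
  by (simp_all add: FactModule_def)

lemma FactModule_cases:
  assumes "X \<in> carrier (FactModule M N)" obtains x where "x \<in> carrier M" "X = N +>\<^bsub>M\<^esub> x"
  using assms by (auto simp: A_RCOSETS_def')

lemma FactModule_closed: "x \<in> carrier M \<Longrightarrow> N +>\<^bsub>M\<^esub> x \<in> carrier (FactModule M N)"
  by (auto simp: A_RCOSETS_def')

lemma coset_eq_iff:
  assumes N: "submodule N R M" and x: "x \<in> carrier M"
  shows "N +>\<^bsub>M\<^esub> x = N \<longleftrightarrow> x \<in> N"
proof -
  interpret N: abelian_subgroup N M by (rule submodule_abelian_subgroup[OF N])
  show ?thesis using N.a_rcos_const[of x] N.a_rcos_self[OF x] by auto
qed

lemma FactModule_smult:
  assumes N: "submodule N R M" and x: "x \<in> carrier M" and a: "a \<in> carrier R"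
  shows "a \<odot>\<^bsub>FactModule M N\<^esub> (N +>\<^bsub>M\<^esub> x) = N +>\<^bsub>M\<^esub> (a \<odot>\<^bsub>M\<^esub> x)"
proof -
  interpret N: abelian_subgroup N M by (rule submodule_abelian_subgroup[OF N])
  have "N +>\<^bsub>M\<^esub> (a \<odot>\<^bsub>M\<^esub> y) = N +>\<^bsub>M\<^esub> (a \<odot>\<^bsub>M\<^esub> x)" if y: "y \<in> N +>\<^bsub>M\<^esub> x" for y
  proof -
    obtain n where n: "n \<in> N" "y = n \<oplus>\<^bsub>M\<^esub> x" using y by (auto simp: a_r_coset_def')
    have nM: "n \<in> carrier M" using submodule_carr[OF N n(1)] .
    have "a \<odot>\<^bsub>M\<^esub> y = a \<odot>\<^bsub>M\<^esub> n \<oplus>\<^bsub>M\<^esub> a \<odot>\<^bsub>M\<^esub> x" using n(2) nM x a by (simp add: smult_r_distr)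
    then have "a \<odot>\<^bsub>M\<^esub> y \<in> N +>\<^bsub>M\<^esub> (a \<odot>\<^bsub>M\<^esub> x)"
      using submodule_smult[OF N a n(1)] by (auto simp: a_r_coset_def')
    then show ?thesis using N.a_repr_independence'[of "a \<odot>\<^bsub>M\<^esub> y" "a \<odot>\<^bsub>M\<^esub> x"] x a by auto
  qed
  moreover have "N +>\<^bsub>M\<^esub> x \<noteq> {}" using N.a_rcos_self[OF x] by auto
  ultimately show ?thesis unfolding FactModule_def by simp
qed

lemma zero_module_FactModule_iff:
  assumes N: "submodule N R M" shows "zero_module (FactModule M N) \<longleftrightarrow> N = carrier M"
proof
  assume z: "zero_module (FactModule M N)"
  have "x \<in> N" if "x \<in> carrier M" for x
    using z FactModule_closed[OF that, of N] coset_eq_iff[OF N that] unfolding zero_module_def FactModule_simps(2) by auto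
  then show "N = carrier M" using submodule_subset[OF N] by blast
next
  assume eq: "N = carrier M"
  have "X = N" if "X \<in> carrier (FactModule M N)" for X
    using FactModule_cases[OF that] coset_eq_iff[OF N] eq by metis
  moreover have "N \<in> carrier (FactModule M N)"
    using FactModule_closed[OF M.zero_closed, of N] coset_eq_iff[OF N M.zero_closed] submodule_zero[OF N] by simp
  ultimately show "zero_module (FactModule M N)" unfolding zero_module_def FactModule_simps(2) by auto
qed

lemma nonzerodivisor_on_FactModule_iff:
  assumes N: "submodule N R M" and a: "a \<in> carrier R"
  shows "nonzerodivisor_on (FactModule M N) a \<longleftrightarrow> nzd M N a"
proof
  assume l: "nonzerodivisor_on (FactModule M N) a"
  show "nzd M N a"
    unfolding nzd_def
  proof (intro ballI impI)
    fix x assume x: "x \<in> carrier M" "a \<odot>\<^bsub>M\<^esub> x \<in> N"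
    then have "a \<odot>\<^bsub>FactModule M N\<^esub> (N +>\<^bsub>M\<^esub> x) = N"
      using FactModule_smult[OF N x(1) a] coset_eq_iff[OF N, of "a \<odot>\<^bsub>M\<^esub> x"] a by simp
    then have "N +>\<^bsub>M\<^esub> x = N"
      using l FactModule_closed[OF x(1), of N] unfolding nonzerodivisor_on_def FactModule_simps(2) by blast
    then show "x \<in> N" using coset_eq_iff[OF N x(1)] by simp
  qed
next
  assume r: "nzd M N a"
  show "nonzerodivisor_on (FactModule M N) a"
    unfolding nonzerodivisor_on_def FactModule_simps(2)
  proof (intro ballI impI)
    fix X assume "X \<in> carrier (FactModule M N)" and 0: "a \<odot>\<^bsub>FactModule M N\<^esub> X = N"
    then obtain x where x: "x \<in> carrier M" "X = N +>\<^bsub>M\<^esub> x" using FactModule_cases by blast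
    then have "a \<odot>\<^bsub>M\<^esub> x \<in> N"
      using 0 FactModule_smult[OF N x(1) a] coset_eq_iff[OF N, of "a \<odot>\<^bsub>M\<^esub> x"] a by simp
    then show "X = N" using r x coset_eq_iff[OF N x(1)] unfolding nzd_def by simp
  qed
qed

lemma annihilator_FactModule:
  assumes N: "submodule N R M" shows "annihilator R (FactModule M N) = ann_quot R M N"
proof -
  have "(\<forall>X\<in>carrier (FactModule M N). a \<odot>\<^bsub>FactModule M N\<^esub> X = N) \<longleftrightarrow> (\<forall>x\<in>carrier M. a \<odot>\<^bsub>M\<^esub> x \<in> N)"
    if a: "a \<in> carrier R" for a
  proof -
    have *: "a \<odot>\<^bsub>FactModule M N\<^esub> (N +>\<^bsub>M\<^esub> x) = N \<longleftrightarrow> a \<odot>\<^bsub>M\<^esub> x \<in> N" if "x \<in> carrier M" for x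
      using FactModule_smult[OF N that a] coset_eq_iff[OF N, of "a \<odot>\<^bsub>M\<^esub> x"] a that by simp
    show ?thesis
    proof (intro iffI ballI)
      fix x assume "\<forall>X\<in>carrier (FactModule M N). a \<odot>\<^bsub>FactModule M N\<^esub> X = N" "x \<in> carrier M"
      then show "a \<odot>\<^bsub>M\<^esub> x \<in> N" using * FactModule_closed by blast
    next
      fix X assume h: "\<forall>x\<in>carrier M. a \<odot>\<^bsub>M\<^esub> x \<in> N" and "X \<in> carrier (FactModule M N)"
      then obtain x where "x \<in> carrier M" "X = N +>\<^bsub>M\<^esub> x" using FactModule_cases by blast
      then show "a \<odot>\<^bsub>FactModule M N\<^esub> X = N" using * h by simp
    qed
  qed
  then show ?thesis unfolding annihilator_def ann_quot_def FactModule_simps(2) by blast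
qed

lemma annihilator_eq: "annihilator R M = ann_quot R M {\<zero>\<^bsub>M\<^esub>}"
  by (simp add: annihilator_def ann_quot_def)

lemma submodule_ideal_smult: "I \<subseteq> carrier R \<Longrightarrow> submodule (ideal_smult R I M) R M"
  unfolding ideal_smult_def by (rule module_span_submodule) auto

lemma ideal_smult_eq: "ideal_smult R I M = ideal_mult R M I (carrier M)"
  by (simp add: ideal_smult_def ideal_mult_def)

text \<open>The bridge from the quotients in the definition of a regular sequence, taken by
  generated ideals, to the stepwise enlargement in \<open>quot_by\<close>.\<close>

lemma ideal_smult_Idl:
  assumes xs: "set xs \<subseteq> carrier R"
  shows "ideal_smult R (Idl (set xs)) M = quot_by M {\<zero>\<^bsub>M\<^esub>} xs"
proof
  let ?Q = "quot_by M {\<zero>\<^bsub>M\<^esub>} xs"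
  have Q: "submodule ?Q R M" by (rule submodule_quot_by[OF zero_submodule xs])
  have idl: "Idl (set xs) \<subseteq> carrier R" using ideal_subset[OF R.genideal_ideal[OF xs]] .
  have "set xs \<subseteq> ann_quot R M ?Q"
    using xs quot_by_mem[OF zero_submodule xs] by (auto simp: ann_quot_def)
  then have "Idl (set xs) \<subseteq> ann_quot R M ?Q" by (rule R.genideal_minimal[OF ann_quot_ideal[OF Q]])
  then show "ideal_smult R (Idl (set xs)) M \<subseteq> ?Q"
    unfolding ideal_smult_eq by (intro ideal_mult_least[OF Q]) (auto simp: ann_quot_def)
  have I: "submodule (ideal_smult R (Idl (set xs)) M) R M" by (rule submodule_ideal_smult[OF idl])
  show "?Q \<subseteq> ideal_smult R (Idl (set xs)) M"
  proof (rule quot_by_least[OF I])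
    show "{\<zero>\<^bsub>M\<^esub>} \<subseteq> ideal_smult R (Idl (set xs)) M" using submodule_zero[OF I] by simp
    show "x \<odot>\<^bsub>M\<^esub> u \<in> ideal_smult R (Idl (set xs)) M" if "x \<in> set xs" "u \<in> carrier M" for x u
      unfolding ideal_smult_eq using R.genideal_self[OF xs] that by (intro ideal_mult_mem) auto
  qed
qed

lemma regular_sequence_iff:
  "regular_sequence R M xs \<longleftrightarrow>
    set xs \<subseteq> carrier R \<and> regular M {\<zero>\<^bsub>M\<^esub>} xs \<and> quot_by M {\<zero>\<^bsub>M\<^esub>} xs \<noteq> carrier M"
proof (cases "set xs \<subseteq> carrier R")
  case True
  have "nonzerodivisor_on (ideal_quotient R (Idl (set (take i xs))) M) (xs ! i) \<longleftrightarrow>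
      nzd M (quot_by M {\<zero>\<^bsub>M\<^esub>} (take i xs)) (xs ! i)" if i: "i < length xs" for i
  proof -
    have sub: "set (take i xs) \<subseteq> carrier R" using True set_take_subset[of i xs] by blast
    have "xs ! i \<in> carrier R" using True i nth_mem by blast
    then show ?thesis
      using nonzerodivisor_on_FactModule_iff[OF submodule_quot_by[OF zero_submodule sub]]
      by (simp add: ideal_quotient_def ideal_smult_Idl[OF sub])
  qed
  moreover have "zero_module (ideal_quotient R (Idl (set xs)) M) \<longleftrightarrow> quot_by M {\<zero>\<^bsub>M\<^esub>} xs = carrier M"
    using zero_module_FactModule_iff[OF submodule_quot_by[OF zero_submodule True]]
    by (simp add: ideal_quotient_def ideal_smult_Idl[OF True])
  ultimately show ?thesis using True unfolding regular_sequence_def regular_iff_nth by simp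
qed (simp add: regular_sequence_def)

lemma quot_by_subset_ideal_smult:
  assumes I: "I \<subseteq> carrier R" and xs: "set xs \<subseteq> I"
  shows "quot_by M {\<zero>\<^bsub>M\<^esub>} xs \<subseteq> ideal_smult R I M"
proof (rule quot_by_least[OF submodule_ideal_smult[OF I]])
  show "{\<zero>\<^bsub>M\<^esub>} \<subseteq> ideal_smult R I M" using submodule_zero[OF submodule_ideal_smult[OF I]] by simp
  show "x \<odot>\<^bsub>M\<^esub> u \<in> ideal_smult R I M" if "x \<in> set xs" "u \<in> carrier M" for x u
    unfolding ideal_smult_eq using that xs by (intro ideal_mult_mem) auto
qed

lemma quot_by_neq_carrier:
  assumes "I \<subseteq> carrier R" "ideal_smult R I M \<noteq> carrier M" "set xs \<subseteq> I"
  shows "quot_by M {\<zero>\<^bsub>M\<^esub>} xs \<noteq> carrier M"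
  using quot_by_subset_ideal_smult[OF assms(1,3)] submodule_subset[OF submodule_ideal_smult[OF assms(1)]] assms(2)
  by blast

text \<open>Preimages turn a chain of submodules of \<open>M/N\<close> into a chain of equally many
  submodules between \<open>N\<close> and \<open>M\<close>.\<close>

lemma module_length_FactModule_finite:
  assumes N: "submodule N R M" and k: "chain_bounded R M N (carrier M) k"
  shows "module_length R (FactModule M N) < \<infinity>"
proof -
  interpret N: abelian_subgroup N M by (rule submodule_abelian_subgroup[OF N])
  let ?F = "FactModule M N"
  define g where "g K = {x \<in> carrier M. N +>\<^bsub>M\<^esub> x \<in> K}" for K
  have gs: "submodule (g K) R M \<and> N \<subseteq> g K" if K: "submodule K R ?F" for K
  proof -
    have sg: "subgroup K (add_monoid ?F)" by (rule submodule.axioms(1)[OF K])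
    have NK: "N \<in> K" using subgroup.one_closed[OF sg] by simp
    have "submodule (g K) R M"
    proof (rule submoduleI_smult)
      show "g K \<subseteq> carrier M" by (auto simp: g_def)
      show "\<zero>\<^bsub>M\<^esub> \<in> g K" using NK coset_eq_iff[OF N M.zero_closed] submodule_zero[OF N] by (simp add: g_def)
      show "x \<oplus>\<^bsub>M\<^esub> y \<in> g K" if "x \<in> g K" "y \<in> g K" for x y
        using that subgroup.m_closed[OF sg, of "N +>\<^bsub>M\<^esub> x" "N +>\<^bsub>M\<^esub> y"] N.a_rcos_sum[of x y] by (simp add: g_def)
      show "a \<odot>\<^bsub>M\<^esub> x \<in> g K" if "a \<in> carrier R" "x \<in> g K" for a x
        using that submodule.smult_closed[OF K, of a "N +>\<^bsub>M\<^esub> x"] FactModule_smult[OF N, of x a] by (simp add: g_def)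
    qed
    moreover have "N \<subseteq> g K" using NK N.a_rcos_const submodule_subset[OF N] by (auto simp: g_def)
    ultimately show ?thesis by simp
  qed
  have lt: "g A \<subset> g B" if AB: "submodule A R ?F" "submodule B R ?F" "A \<subset> B" for A B
  proof -
    obtain X where X: "X \<in> B" "X \<notin> A" using AB(3) by auto
    have "X \<in> carrier ?F" using subgroup.subset[OF submodule.axioms(1)[OF AB(2)]] X(1) by auto
    then obtain x where "x \<in> carrier M" "X = N +>\<^bsub>M\<^esub> x" by (rule FactModule_cases)
    then show ?thesis using X AB(3) by (auto simp: g_def)
  qed
  have "length Ns - 1 \<le> k" if Ns: "sorted_wrt (\<subset>) Ns" "\<forall>K\<in>set Ns. submodule K R ?F" for Ns
  proof -
    have lt': "g A \<subset> g B" if "A \<in> set Ns" "B \<in> set Ns" "A \<subset> B" for A B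
      by (rule lt[OF bspec[OF Ns(2) that(1)] bspec[OF Ns(2) that(2)] that(3)])
    have s: "sorted_wrt (\<subset>) (map g Ns)"
      unfolding sorted_wrt_map by (rule sorted_wrt_mono_rel[OF _ Ns(1)]) (rule lt')
    have d: "distinct Ls \<and> subset.chain UNIV (set Ls)" if "sorted_wrt (\<subset>) Ls" for Ls :: "'c set list"
      using that
    proof (induction Ls)
      case (Cons L Ls)
      then have "\<forall>K\<in>set Ls. L \<subset> K" and IH: "distinct Ls" "subset.chain UNIV (set Ls)" by simp_all
      then show ?case unfolding subset_chain_def by auto
    qed (simp add: subset_chain_def)
    have "X \<in> {L. submodule L R M \<and> N \<subseteq> L \<and> L \<subseteq> carrier M}" if X: "X \<in> set (map g Ns)" for X
    proof -
      obtain K where "K \<in> set Ns" "X = g K" using X by auto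
      then show ?thesis using gs[OF bspec[OF Ns(2)], of K] submodule_subset[of X] by simp
    qed
    then have sub: "set (map g Ns) \<subseteq> {L. submodule L R M \<and> N \<subseteq> L \<and> L \<subseteq> carrier M}" by (rule subsetI)
    have "\<forall>X\<in>set (map g Ns). \<forall>Y\<in>set (map g Ns). X \<subseteq> Y \<or> Y \<subseteq> X"
      using d[OF s] unfolding subset_chain_def by (elim conjE)
    with sub have "subset.chain {L. submodule L R M \<and> N \<subseteq> L \<and> L \<subseteq> carrier M} (set (map g Ns))"
      unfolding subset_chain_def by (rule conjI)
    then have "card (set (map g Ns)) \<le> k"
      by (rule k[unfolded chain_bounded_def, rule_format, OF finite_set])
    moreover have "card (set (map g Ns)) = length Ns" using d[OF s] distinct_card[of "map g Ns"] by simp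
    ultimately show ?thesis by simp
  qed
  then have "module_length R ?F \<le> enat k"
    unfolding module_length_def by (intro SUP_least) auto
  then show ?thesis by (rule le_less_trans) simp
qed

lemma mult_image_unit:
  assumes u: "u \<in> Units R" and x: "x \<in> carrier R"
  shows "mult_image M (u \<otimes> x) = mult_image M x"
proof -
  have uR: "u \<in> carrier R" "inv u \<in> carrier R" using u by auto
  have eq: "x = inv u \<otimes> (u \<otimes> x)" using u x uR by (simp add: R.m_assoc[symmetric])
  have "mult_image M (a \<otimes> y) \<subseteq> mult_image M y" if "a \<in> carrier R" "y \<in> carrier R" for a y
  proof -
    have "(a \<otimes> y) \<odot>\<^bsub>M\<^esub> m = y \<odot>\<^bsub>M\<^esub> (a \<odot>\<^bsub>M\<^esub> m)" if "m \<in> carrier M" for m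
      using \<open>a \<in> carrier R\<close> \<open>y \<in> carrier R\<close> that by (simp add: smult_assoc1 smult_commute[of a y])
    then show ?thesis using that by (auto simp: mult_image_def)
  qed
  from this[OF uR(1) x] this[OF uR(2), of "u \<otimes> x"] show ?thesis using eq uR x by auto
qed

lemma nzd_unit:
  assumes N: "submodule N R M" and u: "u \<in> Units R" and x: "x \<in> carrier R"
  shows "nzd M N (u \<otimes> x) \<longleftrightarrow> nzd M N x"
proof -
  have uR: "u \<in> carrier R" "inv u \<in> carrier R" using u by auto
  have "(u \<otimes> x) \<odot>\<^bsub>M\<^esub> m \<in> N \<longleftrightarrow> x \<odot>\<^bsub>M\<^esub> m \<in> N" if m: "m \<in> carrier M" for m
  proof
    assume "(u \<otimes> x) \<odot>\<^bsub>M\<^esub> m \<in> N"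
    then have "inv u \<odot>\<^bsub>M\<^esub> ((u \<otimes> x) \<odot>\<^bsub>M\<^esub> m) \<in> N" using submodule_smult[OF N uR(2)] by simp
    then have "(inv u \<otimes> (u \<otimes> x)) \<odot>\<^bsub>M\<^esub> m \<in> N" using uR x m smult_assoc1[of "inv u" "u \<otimes> x" m] by simp
    then show "x \<odot>\<^bsub>M\<^esub> m \<in> N" using u x uR by (simp add: R.m_assoc[symmetric])
  next
    assume "x \<odot>\<^bsub>M\<^esub> m \<in> N"
    then show "(u \<otimes> x) \<odot>\<^bsub>M\<^esub> m \<in> N" using uR x m submodule_smult[OF N uR(1)] by (simp add: smult_assoc1)
  qed
  then show ?thesis by (simp add: nzd_def)
qed

text \<open>Serves to clear denominators: an element of the extension of \<open>q\<close> is a unit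
  times the image of an element of \<open>q\<close>.\<close>

lemma regular_units:
  "submodule N R M \<Longrightarrow> list_all2 (\<lambda>x y. \<exists>u\<in>Units R. x \<in> carrier R \<and> y = u \<otimes> x) xs ys \<Longrightarrow>
    regular M N ys \<longleftrightarrow> regular M N xs"
proof (induction xs arbitrary: N ys)
  case (Cons x xs)
  obtain u zs where u: "u \<in> Units R" "x \<in> carrier R" "ys = (u \<otimes> x) # zs"
    "list_all2 (\<lambda>x y. \<exists>u\<in>Units R. x \<in> carrier R \<and> y = u \<otimes> x) xs zs"
    using Cons.prems(2) by (auto simp: list_all2_Cons1)
  show ?case
    using Cons.IH[OF submodule_adj[OF Cons.prems(1) u(2)] u(4)] nzd_unit[OF Cons.prems(1) u(1,2)]
      mult_image_unit[OF u(1,2)] u(3) by simp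
qed simp

end

section \<open>Maximal regular sequences and grade\<close>

context noetherian_module begin

text \<open>As \<open>IM\<close> is proper, every quotient by a list from \<open>I\<close> is
  nonzero. Hence a sequence can be prolonged exactly if \<open>I\<close> contains a nonzerodivisor
  on its quotient, that is, if \<open>I\<close> kills no nonzero class.\<close>

lemma maximal_regular_sequence_iff:
  assumes I: "ideal I R" and ne: "ideal_smult R I M \<noteq> carrier M"
  shows "maximal_regular_sequence R I M xs \<longleftrightarrow>
    set xs \<subseteq> I \<and> regular M {\<zero>\<^bsub>M\<^esub>} xs \<and> killed R M (quot_by M {\<zero>\<^bsub>M\<^esub>} xs) I"
proof -
  have IR: "I \<subseteq> carrier R" using ideal_subset[OF I] .
  have reg: "regular_sequence R M ys \<longleftrightarrow> regular M {\<zero>\<^bsub>M\<^esub>} ys" if "set ys \<subseteq> I" for ys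
    using regular_sequence_iff[of ys] quot_by_neq_carrier[OF IR ne that] that IR by auto
  show ?thesis
  proof (cases "set xs \<subseteq> I")
    case True
    have Q: "submodule (quot_by M {\<zero>\<^bsub>M\<^esub>} xs) R M"
      using True IR by (intro submodule_quot_by zero_submodule) auto
    have "(\<forall>y\<in>I. \<not> nzd M (quot_by M {\<zero>\<^bsub>M\<^esub>} xs) y) \<longleftrightarrow> killed R M (quot_by M {\<zero>\<^bsub>M\<^esub>} xs) I"
      using nzd_exists[OF I Q] killed_no_nzd by blast
    moreover have "regular_sequence R M (xs @ [y]) \<longleftrightarrow>
        regular M {\<zero>\<^bsub>M\<^esub>} xs \<and> nzd M (quot_by M {\<zero>\<^bsub>M\<^esub>} xs) y" if "y \<in> I" for y
      using reg[of "xs @ [y]"] True that by simp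
    ultimately show ?thesis unfolding maximal_regular_sequence_def using reg[OF True] True by blast
  qed (simp add: maximal_regular_sequence_def)
qed

lemma maximal_regular_sequence_exists:
  assumes I: "ideal I R" and ne: "ideal_smult R I M \<noteq> carrier M"
  shows "\<exists>xs. maximal_regular_sequence R I M xs"
proof -
  have L: "submodule (ideal_smult R I M) R M" by (rule submodule_ideal_smult[OF ideal_subset[OF I]])
  have "\<exists>zs. set zs \<subseteq> I \<and> regular M {\<zero>\<^bsub>M\<^esub>} zs \<and> killed R M (quot_by M {\<zero>\<^bsub>M\<^esub>} zs) I"
  proof (rule regular_extend[OF I L ne _ zero_submodule])
    show "a \<odot>\<^bsub>M\<^esub> u \<in> ideal_smult R I M" if "a \<in> I" "u \<in> carrier M" for a u
      unfolding ideal_smult_eq using that by (intro ideal_mult_mem)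
    show "{\<zero>\<^bsub>M\<^esub>} \<subseteq> ideal_smult R I M" using submodule_zero[OF L] by simp
  qed
  then show ?thesis using maximal_regular_sequence_iff[OF I ne] by blast
qed

text \<open>Rees' theorem in both directions shows that the \<open>THE\<close> in
  \<open>grade\<close> describes a unique number.\<close>

lemma grade_eq:
  assumes I: "ideal I R" and ne: "ideal_smult R I M \<noteq> carrier M" and xs: "maximal_regular_sequence R I M xs"
  shows "grade R I M = enat (length xs)"
proof -
  have "length ys = length xs" if ys: "maximal_regular_sequence R I M ys" for ys
    using xs ys regular_length_le[OF I zero_submodule] unfolding maximal_regular_sequence_iff[OF I ne]
    by (intro le_antisym) auto
  note uniq = this
  have "(THE n. \<exists>xs. maximal_regular_sequence R I M xs \<and> length xs = n) = length xs"
  proof (rule the_equality)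
    show "\<exists>ys. maximal_regular_sequence R I M ys \<and> length ys = length xs"
      by (rule exI[of _ xs]) (simp add: xs)
    fix n assume "\<exists>ys. maximal_regular_sequence R I M ys \<and> length ys = n"
    then obtain ys where "maximal_regular_sequence R I M ys" "length ys = n" by (elim exE conjE)
    then show "n = length xs" using uniq[of ys] by simp
  qed
  then show ?thesis unfolding grade_def using ne by simp
qed

end

text \<open>Every regular sequence in \<open>m\<close> gives a chain of its own length in the
  support ending at \<open>m\<close>. A sequence as long as the longest such chain therefore has
  maximal length, and depth and dimension both equal its length.\<close>

lemma (in noetherian_local_module) cohen_macaulayI:
  assumes loc: "local_ring R" "max_ideal R = m" and nz: "{\<zero>\<^bsub>M\<^esub>} \<noteq> carrier M"
    and ys: "set ys \<subseteq> m" "regular M {\<zero>\<^bsub>M\<^esub>} ys"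
    and le: "\<And>n Q. prime_chain R n Q m \<Longrightarrow> ann_quot R M {\<zero>\<^bsub>M\<^esub>} \<subseteq> Q \<Longrightarrow> n \<le> length ys"
  shows "cohen_macaulay R M" and "module_dim R M = ereal (real (length ys))"
proof -
  note mi = prime_ideal[OF m_prime]
  have mR: "m \<subseteq> carrier R" using ideal_subset[OF mi] .
  have proper: "quot_by M {\<zero>\<^bsub>M\<^esub>} xs \<noteq> carrier M" if "set xs \<subseteq> m" for xs
    by (rule quot_by_proper[OF zero_submodule nz that])
  have len: "length xs \<le> length ys \<and> (\<exists>Q. ann_quot R M {\<zero>\<^bsub>M\<^esub>} \<subseteq> Q \<and> prime_chain R (length xs) Q m)"
    if xs: "set xs \<subseteq> m" "regular M {\<zero>\<^bsub>M\<^esub>} xs" for xs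
  proof -
    have xR: "set xs \<subseteq> carrier R" using xs(1) mR by auto
    have "ann_quot R M (quot_by M {\<zero>\<^bsub>M\<^esub>} xs) \<subseteq> m"
      by (rule ann_quot_subset_m[OF submodule_quot_by[OF zero_submodule xR] proper[OF xs(1)]])
    then show ?thesis using regular_prime_chain[OF zero_submodule xR xs(2) m_prime] le by blast
  qed
  show dim: "module_dim R M = ereal (real (length ys))"
    unfolding module_dim_def annihilator_eq
  proof (rule antisym)
    note J = ann_quot_ideal[OF zero_submodule]
    show "krull_dim (R Quot ann_quot R M {\<zero>\<^bsub>M\<^esub>}) \<le> ereal (real (length ys))"
    proof (rule R.krull_dim_Quot_le[OF J])
      fix n Q P assume c: "prime_chain R n Q P" "ann_quot R M {\<zero>\<^bsub>M\<^esub>} \<subseteq> Q"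
      have "primeideal P R" using prime_chain_facts[OF c(1)] by simp
      then obtain k where "k \<ge> n" "prime_chain R k Q m"
        using prime_chain_extend[OF c(1) m_prime prime_subset_m] by blast
      then have "n \<le> length ys" using le[of k Q] c(2) by simp
      then show "ereal (real n) \<le> ereal (real (length ys))" by simp
    qed
    obtain Q where "ann_quot R M {\<zero>\<^bsub>M\<^esub>} \<subseteq> Q" "prime_chain R (length ys) Q m" using len[OF ys] by blast
    then show "ereal (real (length ys)) \<le> krull_dim (R Quot ann_quot R M {\<zero>\<^bsub>M\<^esub>})"
      using R.krull_dim_Quot_ge[OF J] by blast
  qed
  have im: "submodule (ideal_mult R M m (carrier M)) R M" using mR by (intro submodule_ideal_mult) auto
  have ne: "ideal_smult R m M \<noteq> carrier M"
  proof
    assume "ideal_smult R m M = carrier M"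
    then have "carrier M \<subseteq> {\<zero>\<^bsub>M\<^esub>}"
      using set_add_upper2[OF zero_submodule im] unfolding ideal_smult_eq
      by (intro Nakayama_local[OF zero_submodule carrier_is_submodule]) simp
    then show False using nz by auto
  qed
  obtain xs where xs: "maximal_regular_sequence R m M xs" using maximal_regular_sequence_exists[OF mi ne] by blast
  then have xs': "set xs \<subseteq> m" "regular M {\<zero>\<^bsub>M\<^esub>} xs" "killed R M (quot_by M {\<zero>\<^bsub>M\<^esub>} xs) m"
    unfolding maximal_regular_sequence_iff[OF mi ne] by auto
  have "length xs = length ys"
    using len[OF xs'(1,2)] regular_length_le[OF mi zero_submodule xs' ys] by simp
  then have "depth R M = enat (length ys)" unfolding depth_def loc(2) using grade_eq[OF mi ne xs] by simp
  then show "cohen_macaulay R M"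
    unfolding cohen_macaulay_def using loc(1) noetherian module_axioms fin_gen dim by simp
qed

section \<open>Localization at primes of the support\<close>

text \<open>A nonunit \<open>a\<close> generates a proper ideal, which by the ascending chain
  condition lies in a maximal one; there is only one, so it contains \<open>a\<close>.\<close>

lemma (in noetherian_ring) local_ring_facts:
  assumes "cring R" "local_ring R"
  shows "primeideal (max_ideal R) R" and "\<And>a. a \<in> carrier R \<Longrightarrow> a \<notin> max_ideal R \<Longrightarrow> a \<in> Units R"
proof -
  interpret cring R by fact
  have ex1: "\<exists>!m. maximalideal m R" using assms(2) by (simp add: local_ring_def)
  have mx: "maximalideal (max_ideal R) R" unfolding max_ideal_def by (rule theI'[OF ex1])
  show "primeideal (max_ideal R) R" by (rule maximalideal_prime[OF mx])
  show "a \<in> Units R" if a: "a \<in> carrier R" "a \<notin> max_ideal R" for a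
  proof (rule ccontr)
    assume nu: "a \<notin> Units R"
    have I: "ideal (PIdl a) R" by (rule cgenideal_ideal[OF a(1)])
    have "\<one> \<notin> PIdl a"
    proof
      assume "\<one> \<in> PIdl a"
      then obtain r where "r \<in> carrier R" "\<one> = r \<otimes> a" by (auto simp: cgenideal_def)
      then show False using nu a(1) m_comm[of r a] by (auto simp: Units_def)
    qed
    interpret S: noetherian_module R "self_module R"
      by (rule noetherian_self_module) (rule noetherian_ring_axioms)
    have "\<exists>J. submodule J R (self_module R) \<and> (\<one> \<notin> J \<and> PIdl a \<subseteq> J) \<and>
        (\<forall>K. submodule K R (self_module R) \<longrightarrow> \<one> \<notin> K \<and> PIdl a \<subseteq> K \<longrightarrow> J \<subseteq> K \<longrightarrow> K = J)"
      by (rule S.maximal_submodule_pred[of "PIdl a"]) (use I \<open>\<one> \<notin> PIdl a\<close> in \<open>auto simp: submodule_self_iff\<close>)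
    then obtain J where J: "ideal J R" "\<one> \<notin> J" "PIdl a \<subseteq> J"
      "\<forall>K. ideal K R \<longrightarrow> \<one> \<notin> K \<and> PIdl a \<subseteq> K \<longrightarrow> J \<subseteq> K \<longrightarrow> K = J"
      unfolding submodule_self_iff by (elim exE conjE)
    have "maximalideal J R"
    proof (rule maximalidealI)
      show "ideal J R" "carrier R \<noteq> J" using J(1,2) by auto
      show "K = J \<or> K = carrier R" if K: "ideal K R" "J \<subseteq> K" "K \<subseteq> carrier R" for K
      proof (cases "\<one> \<in> K")
        case True
        then show ?thesis using ideal.one_imp_carrier[OF K(1)] by simp
      next
        case False
        then show ?thesis using J(3,4) K by auto
      qed
    qed
    then have "J = max_ideal R" using ex1 mx by blast
    then show False using J(3) cgenideal_self[OF a(1)] a(2) by blast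
  qed
qed

text \<open>If some \<open>a\<close> outside \<open>P\<close> annihilated \<open>M\<close>, every
  fraction \<open>x/s = ax/as\<close> would vanish.\<close>

lemma (in noetherian_module) Supp_ann_quot_subset:
  assumes "P \<in> Supp R M"
  shows "primeideal P R" and "ann_quot R M {\<zero>\<^bsub>M\<^esub>} \<subseteq> P"
    and "{\<zero>\<^bsub>module_localization_at R P M\<^esub>} \<noteq> carrier (module_localization_at R P M)"
proof -
  show P: "primeideal P R" using assms by (simp add: Supp_def)
  interpret X: module_mult_set R M "carrier R - P"
    by (intro module_mult_set.intro module_axioms R.mult_set_prime P)
  have nz: "carrier X.LM \<noteq> {\<zero>\<^bsub>X.LM\<^esub>}"
    using assms by (simp add: Supp_def module_localization_at_def zero_module_def)
  then show "{\<zero>\<^bsub>module_localization_at R P M\<^esub>} \<noteq> carrier (module_localization_at R P M)"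
    by (simp add: module_localization_at_def)
  show "ann_quot R M {\<zero>\<^bsub>M\<^esub>} \<subseteq> P"
  proof
    fix a assume a: "a \<in> ann_quot R M {\<zero>\<^bsub>M\<^esub>}"
    show "a \<in> P"
    proof (rule ccontr)
      assume "a \<notin> P"
      then have aS: "a \<in> carrier R - P" using a by (simp add: ann_quot_def)
      have "X.mf x s = \<zero>\<^bsub>X.LM\<^esub>" if "x \<in> carrier M" "s \<in> carrier R - P" for x s
      proof -
        have "X.mf x s = X.mf (a \<odot>\<^bsub>M\<^esub> x) (a \<otimes> s)" using X.mf_cancel[OF that aS] by simp
        also have "a \<odot>\<^bsub>M\<^esub> x = \<zero>\<^bsub>M\<^esub>" using a that(1) by (simp add: ann_quot_def)
        finally show ?thesis using X.mf_zero[OF X.S_mult[OF aS that(2)]] by simp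
      qed
      then have "carrier X.LM \<subseteq> {\<zero>\<^bsub>X.LM\<^esub>}" by (auto simp: X.LM_carrier)
      moreover have "\<zero>\<^bsub>X.LM\<^esub> \<in> carrier X.LM" unfolding X.LM_zero using X.S_one by (intro X.mf_closed) auto
      ultimately show False using nz by blast
    qed
  qed
qed

lemma (in noetherian_module) noetherian_local_module_localization:
  assumes P: "primeideal P R"
  shows "noetherian_local_module (ring_localization R (carrier R - P))
    (module_localization R (carrier R - P) M) (extension R (carrier R - P) P)"
proof -
  interpret X: module_mult_set R M "carrier R - P"
    by (intro module_mult_set.intro module_axioms R.mult_set_prime P)
  show ?thesis
    by (intro noetherian_local_module.intro noetherian_local_module_axioms.intro
        X.noetherian_module_LM noetherian_module_axioms X.extension_prime P R.localization_units[OF P]) auto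
qed

text \<open>Contraction turns a chain of the localization into one of \<open>R\<close> that ends at
  \<open>P\<close>, and keeps its bottom in the support.\<close>

lemma (in noetherian_module) prime_chain_localization_bound:
  assumes P: "primeideal P R"
    and le: "\<And>n Q. prime_chain R n Q P \<Longrightarrow> ann_quot R M {\<zero>\<^bsub>M\<^esub>} \<subseteq> Q \<Longrightarrow> n \<le> d"
    and c: "prime_chain (ring_localization R (carrier R - P)) n Q (extension R (carrier R - P) P)"
      "ann_quot (ring_localization R (carrier R - P)) (module_localization R (carrier R - P) M)
        {\<zero>\<^bsub>module_localization R (carrier R - P) M\<^esub>} \<subseteq> Q"
  shows "n \<le> d"
proof -
  interpret X: module_mult_set R M "carrier R - P"
    by (intro module_mult_set.intro module_axioms R.mult_set_prime P)
  have Q: "primeideal Q X.L" using prime_chain_facts[OF c(1)] by simp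
  have "prime_chain R n (contraction R (carrier R - P) Q) P"
    using X.prime_chain_contraction[OF c(1)] X.contraction_extension[OF P] by simp
  moreover have "ann_quot R M {\<zero>\<^bsub>M\<^esub>} \<subseteq> contraction R (carrier R - P) Q"
    using X.ann_quot_loc_ext_subset_iff[OF noetherian_module_axioms zero_submodule Q] c(2)
    by (simp add: X.loc_ext_zero)
  ultimately show ?thesis by (rule le)
qed

theorem theorem2p14:
  fixes R :: "('a, 'r) ring_scheme" and M :: "('a, 'b, 'm) module_scheme" and p :: "'a set"
  assumes "cring R" and "noetherian_ring R" and "local_ring R"
    and "module R M" and "finitely_generated R M" and "\<not> zero_module M"
    and "p \<in> Supp R M"
    and "ideal_cohen_macaulay R p M"
  shows "cohen_macaulay (ring_localization_at R p) (module_localization_at R p M) \<and>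
    (\<forall>xs. maximal_regular_sequence R p M xs \<longrightarrow>
       system_of_parameters (ring_localization_at R p) (module_localization_at R p M)
         (map (localization_map R p) xs)) \<and>
    (\<forall>q\<in>Supp R M. q \<subseteq> p \<longrightarrow>
       cohen_macaulay (ring_localization_at R q) (module_localization_at R q M))"
proof -
  interpret noetherian_module R M
    by (intro noetherian_module.intro noetherian_module_axioms.intro assms)
  interpret local: noetherian_local_module R M "max_ideal R"
    by (intro noetherian_local_module.intro noetherian_local_module_axioms.intro noetherian_module_axioms
        noetherian_ring.local_ring_facts[OF assms(2,1,3)])
  let ?N = "{\<zero>\<^bsub>M\<^esub>}"
  note p = Supp_ann_quot_subset[OF assms(7)]
  have pid: "ideal p R" and pR: "p \<subseteq> carrier R" using prime_ideal[OF p(1)] prime_subset[OF p(1)] .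
  have pM: "submodule (ideal_smult R p M) R M" by (rule submodule_ideal_smult[OF pR])
  \<comment> \<open>If \<open>pM = M\<close>, Nakayama's lemma at \<open>p\<close> gives
    \<open>t\<close> outside \<open>p\<close> with \<open>tM = 0\<close>, although the annihilator
    lies in \<open>p\<close>. This also excludes the value \<open>\<infinity>\<close> of
    \<open>grade\<close>.\<close>
  have pMne: "ideal_smult R p M \<noteq> carrier M"
  proof
    assume eq: "ideal_smult R p M = carrier M"
    have "\<exists>t\<in>carrier R - p. \<forall>x\<in>carrier M. t \<odot>\<^bsub>M\<^esub> x \<in> ?N"
    proof (rule Nakayama_prime[OF p(1) zero_submodule carrier_is_submodule R.one_closed prime_one[OF p(1)]])
      show "\<one>\<^bsub>R\<^esub> \<odot>\<^bsub>M\<^esub> x \<in> ?N <+>\<^bsub>M\<^esub> ideal_mult R M p (carrier M)" if "x \<in> carrier M" for x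
        using that set_add_upper2[OF zero_submodule pM] unfolding eq ideal_smult_eq[symmetric] by auto
    qed
    then show False using p(2) by (auto simp: ann_quot_def)
  qed
  note max_iff = maximal_regular_sequence_iff[OF pid pMne]
  obtain xs0 where xs0: "maximal_regular_sequence R p M xs0"
    using maximal_regular_sequence_exists[OF pid pMne] by blast
  define n where "n = length xs0"
  have grade: "grade R p M = enat n" unfolding n_def by (rule grade_eq[OF pid pMne xs0])
  have len: "length xs = n" if "maximal_regular_sequence R p M xs" for xs
    using grade_eq[OF pid pMne that] grade by simp
  let ?J = "ann_quot R M ?N" and ?J' = "ann_quot R M (ideal_smult R p M)"
  note J = ann_quot_ideal[OF zero_submodule] and J' = ann_quot_ideal[OF pM]
  define d where "d = krull_dim (R Quot ?J)"
  define d' where "d' = krull_dim (R Quot ?J')"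
  have eq: "ereal (real n) + d' = d"
    using assms(8) grade annihilator_FactModule[OF pM]
    unfolding ideal_cohen_macaulay_def module_dim_def ideal_quotient_def annihilator_eq d_def d'_def by simp
  have "p \<subseteq> ?J'"
    using pR unfolding ann_quot_def ideal_smult_eq by (auto intro: ideal_mult_mem)
  have "?J' \<subseteq> max_ideal R" by (rule local.ann_quot_subset_m[OF pM pMne])
  \<comment> \<open>The trivial chain at the maximal ideal excludes \<open>-\<infinity>\<close>, the
    dimension of the zero ring.\<close>
  then have d'_ge: "ereal 0 \<le> d'"
    using R.krull_dim_Quot_ge[OF J' prime_chain.refl[OF local.m_prime]] unfolding d'_def by simp
  \<comment> \<open>The height of the maximal ideal bounds \<open>d\<close>. With \<open>eq\<close>
    and \<open>d'_ge\<close>, both dimensions become real numbers that can be cancelled.\<close>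
  obtain D where D: "\<And>n Q. prime_chain R n Q (max_ideal R) \<Longrightarrow> n \<le> D"
    using R.finite_height[OF assms(2) local.m_prime] by blast
  have d_le: "d \<le> ereal (real D)"
    unfolding d_def
  proof (rule R.krull_dim_Quot_le[OF J])
    fix n Q P assume c: "prime_chain R n Q P"
    have "primeideal P R" using prime_chain_facts[OF c] by simp
    then obtain k where "k \<ge> n" "prime_chain R k Q (max_ideal R)"
      using prime_chain_extend[OF c local.m_prime local.prime_subset_m] by blast
    then have "n \<le> D" using D[of k Q] by simp
    then show "ereal (real n) \<le> ereal (real D)" by simp
  qed
  \<comment> \<open>Chains below \<open>p\<close> and chains above \<open>p\<close> add up inside
    the support of \<open>M\<close>, so \<open>k + d' \<le> d = n + d'\<close>, and
    \<open>d'\<close> cancels.\<close>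
  have height: "k \<le> n" if k: "prime_chain R k Q p" "?J \<subseteq> Q" for k Q
  proof -
    have "d' \<le> d - ereal (real k)"
      unfolding d'_def
    proof (rule R.krull_dim_Quot_le[OF J'])
      fix j Q' P assume j: "prime_chain R j Q' P" "?J' \<subseteq> Q'"
      have "primeideal Q' R" using prime_chain_facts[OF j(1)] by simp
      then obtain i where i: "i \<ge> k" "prime_chain R i Q Q'"
        using prime_chain_extend[OF k(1)] \<open>p \<subseteq> ?J'\<close> j(2) by blast
      have "ereal (real (i + j)) \<le> d"
        unfolding d_def by (rule R.krull_dim_Quot_ge[OF J prime_chain_trans[OF i(2) j(1)] k(2)])
      then show "ereal (real j) \<le> d - ereal (real k)"
        using i(1) by (cases d) auto
    qed
    then show ?thesis using eq d'_ge d_le by (cases d; cases d') auto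
  qed
  \<comment> \<open>The common end of (1) and (3): enough elements of \<open>q\<close>, regular on
    \<open>M_q\<close>, to match the longest chain below \<open>q\<close> in the support.\<close>
  have CM: "cohen_macaulay (ring_localization_at R q) (module_localization_at R q M) \<and>
      module_dim (ring_localization_at R q) (module_localization_at R q M) = ereal (real (length ys))"
    if q: "q \<in> Supp R M" and ys: "set ys \<subseteq> q"
      "regular (module_localization R (carrier R - q) M) {\<zero>\<^bsub>module_localization R (carrier R - q) M\<^esub>}
        (map (localization_map R q) ys)"
      and le: "\<And>k Q. prime_chain R k Q q \<Longrightarrow> ?J \<subseteq> Q \<Longrightarrow> k \<le> length ys" for q ys
  proof -
    note q = Supp_ann_quot_subset[OF q]
    interpret X: module_mult_set R M "carrier R - q"
      by (intro module_mult_set.intro module_axioms R.mult_set_prime q)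
    interpret Y: noetherian_local_module X.L X.LM "extension R (carrier R - q) q"
      by (rule noetherian_local_module_localization[OF q(1)])
    have loc: "local_ring X.L" "max_ideal X.L = extension R (carrier R - q) q"
      using R.local_ring_localization[OF q(1)] by auto
    have nz: "{\<zero>\<^bsub>X.LM\<^esub>} \<noteq> carrier X.LM" using q(3) by (simp add: module_localization_at_def)
    have sub: "set (map (localization_map R q) ys) \<subseteq> extension R (carrier R - q) q"
      using ys(1) X.S_one by (auto simp: localization_map_def extension_def)
    show ?thesis
      using Y.cohen_macaulayI[OF loc nz sub ys(2)] prime_chain_localization_bound[OF q(1) le]
      by (simp add: ring_localization_at_def module_localization_at_def)
  qed
  interpret X: module_mult_set R M "carrier R - p"
    by (intro module_mult_set.intro module_axioms R.mult_set_prime p)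
  interpret Y: noetherian_local_module X.L X.LM "extension R (carrier R - p) p"
    by (rule noetherian_local_module_localization[OF p(1)])
  let ?m = "extension R (carrier R - p) p"
  have map_eq: "map (localization_map R p) xs = map (\<lambda>x. X.rf x \<one>\<^bsub>R\<^esub>) xs" for xs
    by (simp add: localization_map_def)
  have nzX: "{\<zero>\<^bsub>X.LM\<^esub>} \<noteq> carrier X.LM" using p(3) by (simp add: module_localization_at_def)
  have heightX: "k \<le> n" if "prime_chain X.L k Q ?m" "ann_quot X.L X.LM {\<zero>\<^bsub>X.LM\<^esub>} \<subseteq> Q" for k Q
    using prime_chain_localization_bound[OF p(1) height that] .
  have regX: "regular X.LM {\<zero>\<^bsub>X.LM\<^esub>} (map (localization_map R p) xs)" if "maximal_regular_sequence R p M xs" for xs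
    using that pR X.regular_loc_ext[OF zero_submodule, of xs] unfolding max_iff map_eq X.loc_ext_zero by blast
  have subX: "set (map (localization_map R p) xs) \<subseteq> ?m" if "set xs \<subseteq> p" for xs
    using that X.S_one by (auto simp: localization_map_def extension_def)
  have part1: "cohen_macaulay (ring_localization_at R p) (module_localization_at R p M) \<and>
      module_dim (ring_localization_at R p) (module_localization_at R p M) = ereal (real n)"
    using CM[OF assms(7) _ regX[OF xs0]] xs0 height unfolding n_def[symmetric] max_iff by blast
  have part2: "system_of_parameters (ring_localization_at R p) (module_localization_at R p M)
      (map (localization_map R p) xs)" if xs: "maximal_regular_sequence R p M xs" for xs
  proof -
    let ?xs = "map (localization_map R p) xs"
    have xsp: "set xs \<subseteq> p" using xs by (simp add: max_iff)
    have xsL: "set ?xs \<subseteq> carrier X.L" using subX[OF xsp] prime_subset[OF Y.m_prime] by blast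
    let ?Q = "quot_by X.LM {\<zero>\<^bsub>X.LM\<^esub>} ?xs"
    have Q: "submodule ?Q X.L X.LM" by (rule Y.submodule_quot_by[OF Y.zero_submodule xsL])
    \<comment> \<open>The quotient by \<open>?xs\<close> has finite length because \<open>?m\<close>
      is the only prime of its support: any other \<open>P\<close> would have a chain of length
      \<open>n\<close> below it, and a further step to \<open>?m\<close> would exceed the bound
      \<open>n\<close>.\<close>
    have "\<exists>k. chain_bounded X.L X.LM ?Q (carrier X.LM) k"
    proof (rule Y.chain_bounded_exists[OF Q])
      fix P assume P: "primeideal P X.L" "ann_quot X.L X.LM ?Q \<subseteq> P"
      obtain Q' where Q': "ann_quot X.L X.LM {\<zero>\<^bsub>X.LM\<^esub>} \<subseteq> Q'" "prime_chain X.L (length ?xs) Q' P"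
        using Y.regular_prime_chain[OF Y.zero_submodule xsL regX[OF xs] P] by blast
      show "P = ?m"
      proof (rule ccontr)
        assume "P \<noteq> ?m"
        then have "P \<subset> ?m" using Y.prime_subset_m[OF P(1)] by blast
        then have "prime_chain X.L (Suc 0) P ?m"
          using prime_chain.step[OF P(1) _ prime_chain.refl[OF Y.m_prime]] by blast
        then have "length ?xs + Suc 0 \<le> n" using heightX[OF prime_chain_trans[OF Q'(2)] Q'(1)] by blast
        then show False using len[OF xs] by simp
      qed
    qed
    then obtain k where "chain_bounded X.L X.LM ?Q (carrier X.LM) k" by blast
    then have "module_length X.L (FactModule X.LM ?Q) < \<infinity>"
      by (rule Y.module_length_FactModule_finite[OF Q])
    then have "module_length X.L (ideal_quotient X.L (Idl\<^bsub>X.L\<^esub> (set ?xs)) X.LM) < \<infinity>"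
      unfolding ideal_quotient_def using Y.ideal_smult_Idl[OF xsL] by simp
    moreover have "set ?xs \<subseteq> max_ideal X.L"
      using subX[OF xsp] R.local_ring_localization[OF p(1)] by simp
    moreover have "ereal (real (length ?xs)) = module_dim X.L X.LM"
      using part1 len[OF xs] by (simp add: ring_localization_at_def module_localization_at_def)
    ultimately show ?thesis
      unfolding system_of_parameters_def ring_localization_at_def module_localization_at_def by blast
  qed
  have part3: "cohen_macaulay (ring_localization_at R q) (module_localization_at R q M)"
    if q: "q \<in> Supp R M" "q \<subseteq> p" for q
  proof -
    note qS = Supp_ann_quot_subset[OF q(1)]
    have qR: "q \<subseteq> carrier R" by (rule prime_subset[OF qS(1)])
    have dis: "q \<inter> (carrier R - p) = {}" using q(2) by auto
    let ?q = "extension R (carrier R - p) q"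
    have qL: "primeideal ?q X.L" by (rule X.extension_prime[OF qS(1) dis])
    have annq: "ann_quot X.L X.LM {\<zero>\<^bsub>X.LM\<^esub>} \<subseteq> extension R (carrier R - p) Q"
      if "primeideal Q R" "Q \<inter> (carrier R - p) = {}" "?J \<subseteq> Q" for Q
      using X.ann_quot_loc_ext_subset_iff[OF noetherian_module_axioms zero_submodule X.extension_prime[OF that(1,2)]]
        X.contraction_extension[OF that(1,2)] that(3) by (simp add: X.loc_ext_zero)
    have "set (map (localization_map R p) xs0) \<subseteq> ?m" using subX xs0 max_iff by blast
    \<comment> \<open>Here \<open>M_p\<close> is the Cohen Macaulay module, with the image of
      \<open>xs0\<close> as its sequence of length \<open>n\<close>, and the extension of
      \<open>q\<close> is the prime.\<close>
    then obtain zs where zs: "set zs \<subseteq> ?q" "regular X.LM {\<zero>\<^bsub>X.LM\<^esub>} zs"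
      "\<And>k Q. prime_chain X.L k Q ?q \<Longrightarrow> ann_quot X.L X.LM {\<zero>\<^bsub>X.LM\<^esub>} \<subseteq> Q \<Longrightarrow> k \<le> length zs"
      using Y.cohen_macaulay_regular_in_prime[OF Y.zero_submodule nzX _ regX[OF xs0] _ qL annq[OF qS(1) dis qS(2)]]
        heightX unfolding n_def length_map by metis
    \<comment> \<open>Clearing denominators: \<open>a/s\<close> is the unit \<open>1/s\<close> times
      \<open>a/1\<close>, so the entries of \<open>zs\<close> may be replaced by images of elements
      of \<open>q\<close>.\<close>
    have "\<exists>ys. set ys \<subseteq> q \<and> list_all2 (\<lambda>x y. \<exists>u\<in>Units X.L. x \<in> carrier X.L \<and> y = u \<otimes>\<^bsub>X.L\<^esub> x)
        (map (localization_map R p) ys) zs"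
      using zs(1)
    proof (induction zs)
      case (Cons z zs)
      then obtain ys where ys: "set ys \<subseteq> q" "list_all2 (\<lambda>x y. \<exists>u\<in>Units X.L. x \<in> carrier X.L \<and> y = u \<otimes>\<^bsub>X.L\<^esub> x)
        (map (localization_map R p) ys) zs" by auto
      obtain a s where a: "a \<in> q" "s \<in> carrier R - p" "z = X.rf a s"
        using Cons.prems by (auto simp: extension_def)
      have aR: "a \<in> carrier R" using a(1) qR by auto
      have "X.rf \<one>\<^bsub>R\<^esub> s \<notin> ?m"
        using X.rf_mem_extension_iff[OF p(1) _ R.one_closed a(2)] prime_one[OF p(1)] by auto
      then have "X.rf \<one>\<^bsub>R\<^esub> s \<in> Units X.L" using Y.m_units a(2) by simp
      moreover have "z = X.rf \<one>\<^bsub>R\<^esub> s \<otimes>\<^bsub>X.L\<^esub> localization_map R p a"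
        using a aR X.S_one by (simp add: localization_map_def X.L_mult)
      moreover have "localization_map R p a \<in> carrier X.L"
        using aR X.S_one by (simp add: localization_map_def)
      ultimately show ?case using ys a(1) by (intro exI[of _ "a # ys"]) auto
    qed simp
    then obtain ys where ys: "set ys \<subseteq> q" and units: "list_all2 (\<lambda>x y. \<exists>u\<in>Units X.L. x \<in> carrier X.L \<and> y = u \<otimes>\<^bsub>X.L\<^esub> x)
        (map (localization_map R p) ys) zs" by blast
    have lys: "length ys = length zs" using list_all2_lengthD[OF units] by simp
    have "regular X.LM {\<zero>\<^bsub>X.LM\<^esub>} (map (localization_map R p) ys)"
      using Y.regular_units[OF Y.zero_submodule units] zs(2) by simp
    moreover have ysR: "set ys \<subseteq> carrier R" using ys qR by auto
    ultimately have reg: "\<forall>i<length ys. nzd M (sat M (carrier R - p) (quot_by M ?N (take i ys))) (ys ! i)"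
      using X.regular_loc_ext_iff[OF zero_submodule ysR] unfolding map_eq X.loc_ext_zero by blast
    interpret Z: module_mult_set R M "carrier R - q"
      by (intro module_mult_set.intro module_axioms R.mult_set_prime qS)
    have map_eq_q: "map (localization_map R q) ys = map (\<lambda>x. Z.rf x \<one>\<^bsub>R\<^esub>) ys"
      by (simp add: localization_map_def)
    \<comment> \<open>Since \<open>q\<close> lies in \<open>p\<close>, the complement of
      \<open>q\<close> is the larger multiplicative set, and nonzerodivisors survive the further
      localization.\<close>
    have regZ: "regular Z.LM {\<zero>\<^bsub>Z.LM\<^esub>} (map (localization_map R q) ys)"
      unfolding map_eq_q Z.regular_loc_ext_iff[OF zero_submodule ysR, unfolded Z.loc_ext_zero]
    proof (intro allI impI)
      fix i assume i: "i < length ys"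
      have "set (take i ys) \<subseteq> carrier R" using ysR set_take_subset[of i ys] by blast
      moreover have "ys ! i \<in> carrier R" using ysR i nth_mem by blast
      ultimately show "nzd M (sat M (carrier R - q) (quot_by M ?N (take i ys))) (ys ! i)"
        using Z.nzd_sat[OF submodule_quot_by[OF zero_submodule], of "take i ys" "carrier R - p" "ys ! i"]
          reg i q(2) X.S_one by blast
    qed

    \<comment> \<open>A chain below \<open>q\<close> stays disjoint from the complement of
      \<open>p\<close>, so it extends to \<open>R_p\<close> with the same length, where
      \<open>zs\<close> bounds it.\<close>
    have "k \<le> length ys" if k: "prime_chain R k Q q" "?J \<subseteq> Q" for k Q
    proof -
      have Q: "primeideal Q R" "Q \<subseteq> q" using prime_chain_facts[OF k(1)] by auto
      have "Q \<inter> (carrier R - p) = {}" using Q(2) dis by auto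
      then show ?thesis
        using zs(3)[OF X.prime_chain_extension[OF k(1) dis] annq[OF Q(1) _ k(2)]] lys by simp
    qed
    then show ?thesis using CM[OF q(1) ys regZ] by blast
  qed
  show ?thesis using part1 part2 part3 by blast
qed

end
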